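(* Let $A=\{(a_1,\dots,a_d\,|\,a_1+1,\dots,a_d+1)\}$ and $B=\{(b_1+1,\dots,b_d+1\,|\,b_1,\dots,b_d)\}$ be the sets of partitions (all $d\ge0$, all admissible Frobenius coordinates) as below. For $\theta>0$ define probability measures $$\mathbb P_A(\alpha)=e^{-\theta^2/2}\frac{\theta^{|\alpha|}\dim\alpha}{|\alpha|!}\ (\alpha\in A),\qquad \mathbb P_B(\beta)=e^{-\theta^2/2}\frac{\theta^{|\beta|}\dim\beta}{|\beta|!}\ (\beta\in B).$$ Then for every $s\in\mathbb R$, $$\lim_{\theta\to\infty}\mathbb P_A\Big(\frac{\alpha_1-2\theta}{\theta^{1/3}}\le s\Big)=\lim_{\theta\to\infty}\mathbb P_B\Big(\frac{\beta_1-2\theta}{\theta^{1/3}}\le s\Big)=F_2(s):=\det(1-\mathcal A)_{L^2(s,\infty)},$$ where $\mathcal A(x,y)=\int_0^\infty\mathrm{Ai}(x+u)\mathrm{Ai}(y+u)\,du$ is the Airy kernel ($F_2$ is the Tracy–Widom GUE distribution).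
   Context: Frobenius coordinates: a partition $\lambda$ with $d$ diagonal boxes (Durfee square size) is written $(p_1,\dots,p_d\,|\,q_1,\dots,q_d)$ with $p_i=\lambda_i-i$ and $q_i=\lambda'_i-i$, where $\lambda'$ is the conjugate partition; here $p_1>\dots>p_d\ge0$, $q_1>\dots>q_d\ge0$. $|\lambda|$ is the size of $\lambda$, $\dim\lambda$ is the number of standard Young tableaux of shape $\lambda$, and $\alpha_1$ (resp. $\beta_1$) is the largest part. That $\mathbb P_A,\mathbb P_B$ sum to $1$ is part of the setting. *)

theory Defs
  imports "HOL-Analysis.Analysis"
begin

definition is_partition :: "nat list \<Rightarrow> bool" where
  "is_partition lam \<longleftrightarrow> sorted_wrt (\<ge>) lam \<and> 0 \<notin> set lam"

definition psize :: "nat list \<Rightarrow> nat" where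
  "psize lam = sum_list lam"

definition largest_part :: "nat list \<Rightarrow> nat" where
  "largest_part lam = (if lam = [] then 0 else hd lam)"

text \<open>Conjugate partition, 0-indexed: conj_part lam j = lambda'_(j+1).\<close>
definition conj_part :: "nat list \<Rightarrow> nat \<Rightarrow> nat" where
  "conj_part lam j = card {i. i < length lam \<and> j < lam ! i}"

definition durfee :: "nat list \<Rightarrow> nat" where
  "durfee lam = card {i. i < length lam \<and> i < lam ! i}"

text \<open>Frobenius coordinates, 0-indexed: frob_p lam i = p_(i+1) = lambda_(i+1) - (i+1),
  frob_q lam i = q_(i+1) = lambda'_(i+1) - (i+1), for i < durfee lam.\<close>
definition frob_p :: "nat list \<Rightarrow> nat \<Rightarrow> nat" where
  "frob_p lam i = lam ! i - (i + 1)"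

definition frob_q :: "nat list \<Rightarrow> nat \<Rightarrow> nat" where
  "frob_q lam i = conj_part lam i - (i + 1)"

definition setA :: "nat list set" where
  "setA = {lam. is_partition lam \<and> (\<forall>i < durfee lam. frob_q lam i = frob_p lam i + 1)}"

definition setB :: "nat list set" where
  "setB = {lam. is_partition lam \<and> (\<forall>i < durfee lam. frob_p lam i = frob_q lam i + 1)}"

definition cells :: "nat list \<Rightarrow> (nat \<times> nat) set" where
  "cells lam = {(i, j). i < length lam \<and> j < lam ! i}"

definition syt :: "nat list \<Rightarrow> (nat \<times> nat \<Rightarrow> nat) set" where
  "syt lam = {T. bij_betw T (cells lam) {1..psize lam}
               \<and> (\<forall>c. c \<notin> cells lam \<longrightarrow> T c = 0)
               \<and> (\<forall>i j. (i, Suc j) \<in> cells lam \<longrightarrow> T (i, j) < T (i, Suc j))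
               \<and> (\<forall>i j. (Suc i, j) \<in> cells lam \<longrightarrow> T (i, j) < T (Suc i, j))}"

definition dimp :: "nat list \<Rightarrow> nat" where
  "dimp lam = card (syt lam)"

definition pweight :: "real \<Rightarrow> nat list \<Rightarrow> real" where
  "pweight \<theta> lam = exp (- \<theta>\<^sup>2 / 2) * \<theta> ^ psize lam * real (dimp lam) / fact (psize lam)"

definition PA_event :: "real \<Rightarrow> real \<Rightarrow> real" where
  "PA_event \<theta> s = infsum (pweight \<theta>)
     {a \<in> setA. (real (largest_part a) - 2 * \<theta>) / \<theta> powr (1/3) \<le> s}"

definition PB_event :: "real \<Rightarrow> real \<Rightarrow> real" where
  "PB_event \<theta> s = infsum (pweight \<theta>)
     {b \<in> setB. (real (largest_part b) - 2 * \<theta>) / \<theta> powr (1/3) \<le> s}"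

definition airy_ai :: "real \<Rightarrow> real" where
  "airy_ai x = Lim at_top (\<lambda>R. integral {0..R} (\<lambda>t. cos (t ^ 3 / 3 + x * t))) / pi"

definition airy_kernel :: "real \<Rightarrow> real \<Rightarrow> real" where
  "airy_kernel x y = (LINT u : {0..} | lborel. airy_ai (x + u) * airy_ai (y + u))"

definition kdet :: "(real \<Rightarrow> real \<Rightarrow> real) \<Rightarrow> nat \<Rightarrow> (nat \<Rightarrow> real) \<Rightarrow> real" where
  "kdet K n x = (\<Sum>p | p permutes {..<n}. of_int (sign p) * (\<Prod>i<n. K (x i) (x (p i))))"

text \<open>Fredholm determinant det(1 - K) on L^2(s,oo), via its Fredholm series.\<close>
definition fredholm_det :: "(real \<Rightarrow> real \<Rightarrow> real) \<Rightarrow> real \<Rightarrow> real" where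
  "fredholm_det K s = (\<Sum>n. (-1) ^ n / fact n *
      (LINT x | PiM {..<n} (\<lambda>_. restrict_space lborel {s<..}). kdet K n x))"

definition F2 :: "real \<Rightarrow> real" where
  "F2 s = fredholm_det airy_kernel s"

end

(* Expanding along Frobenius hooks, the determinantal (Aitken) formula for dim/n! turns the sum over
   partitions in A with first part at most m into det (1 + L) on {1..m}, where
   L(r,c) = t^(r+c) / ((r+c) (c-1)! r!); the sum over B gives the same determinant for m - 1.
   By the symmetry z -> -1/z of exp(t(z-1/z)), the inverse of 1 + L is 1 - K with
     K(n,k) = sum_{l>=0} J_{n+l} (J_{k+l} - (-1)^l J_{k-l}),   J_n = J_n(2t),
   so Jacobi's identity for complementary minors rewrites the probability as det (1 - K) on {m+1,...}.
   The first part of K is the discrete Bessel kernel, which converges to the Airy kernel; the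
   alternating part vanishes in the limit by cancellation of consecutive terms. The bound
   |J_n(2t)| <= C t^(-1/3) exp(-c (n-2t) t^(-1/3)), valid for all n, and Hadamard's inequality give
   dominated convergence in the Fredholm series. *)

theory Submission
  imports Defs "Jordan_Normal_Form.Determinant" "HOL-Real_Asymp.Real_Asymp"
begin

section \<open>Determinants of real arrays\<close>

text \<open>Both families are instances of \<open>frob_set e\<close>, with e = 1 and e = -1; t
  stands for \<theta>. No operator on an infinite-dimensional space occurs before the limit: the
  inversion of 1 + L and Jacobi's identity are carried out on N by N truncations with explicit
  errors, and N is sent to infinity afterwards. Jacobi's identity brings in the determinant of the
  whole matrix, so its value exp (t^2/2) has to be proved as a fact about determinants; it follows
  from a differential equation in t. The obstacle in the scaling limit is the factor J_{k-l} of the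
  alternating part of K: it moves away from the transition region to the side where the exponential
  bound grows with l. The rate c of that bound is free, with a constant depending only on c, so
  J_{n+l} is taken at rate 2 and J_{k-l} at rate 1, and the product still decays. Finally
  \<open>fredholm_det\<close> is a series of integrals; the discrete determinants are therefore
  written as integrals of step kernels on the half-line, which makes the two series comparable term
  by term.\<close>

definition ldet :: "nat \<Rightarrow> (nat \<Rightarrow> nat \<Rightarrow> real) \<Rightarrow> real" where
  "ldet n A = (\<Sum>p | p permutes {..<n}. of_int (sign p) * (\<Prod>i<n. A i (p i)))"

lemma kdet_eq_ldet: "kdet K n x = ldet n (\<lambda>i j. K (x i) (x j))"
  by (simp add: kdet_def ldet_def)

text \<open>The Leibniz sum is taken over plain functions, so that \<open>kdet\<close> is an
  instance of it, a row is replaced by function update and a block is an index shift. This bridge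
  brings in the product, triangular, block and row rules for matrices.\<close>

lemma ldet_eq_det: "ldet n A = det (mat n n (\<lambda>(i, j). A i j))"
proof -
  have "(\<Prod>i<n. A i (p i)) = (\<Prod>i = 0..<n. mat n n (\<lambda>(i, j). A i j) $$ (i, p i))"
    if "p permutes {..<n}" for p
    unfolding lessThan_atLeast0
    using permutes_in_image[OF that] by (intro prod.cong) auto
  then show ?thesis
    by (simp add: ldet_def det_def lessThan_atLeast0)
qed

lemma ldet_cong:
  assumes "\<And>i j. i < n \<Longrightarrow> j < n \<Longrightarrow> A i j = B i j"
  shows "ldet n A = ldet n B"
  unfolding ldet_def using assms
  by (intro sum.cong refl arg_cong2[where f = "(*)"] prod.cong)
     (auto dest: permutes_in_image)

lemma ldet_transpose: "ldet n (\<lambda>i j. A j i) = ldet n A"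
proof -
  have "mat n n (\<lambda>(i, j). A j i) = transpose_mat (mat n n (\<lambda>(i, j). A i j))"
    by (rule eq_matI) auto
  then show ?thesis
    by (simp add: ldet_eq_det det_transpose[of _ n])
qed

lemma ldet_mult: "ldet n (\<lambda>i j. \<Sum>k<n. A i k * B k j) = ldet n A * ldet n B"
proof -
  have "mat n n (\<lambda>(i, j). \<Sum>k<n. A i k * B k j) =
      mat n n (\<lambda>(i, j). A i j) * mat n n (\<lambda>(i, j). B i j)"
    by (rule eq_matI) (auto simp: scalar_prod_def lessThan_atLeast0)
  then show ?thesis
    by (simp add: ldet_eq_det det_mult[of _ n])
qed

lemma ldet_upper_triangular:
  assumes "\<And>i j. j < i \<Longrightarrow> i < n \<Longrightarrow> A i j = 0"
  shows "ldet n A = (\<Prod>i<n. A i i)"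
proof -
  have "det (mat n n (\<lambda>(i, j). A i j)) = prod_list (diag_mat (mat n n (\<lambda>(i, j). A i j)))"
    by (rule det_upper_triangular[of _ n]) (auto simp: assms upper_triangular_def)
  also have "\<dots> = (\<Prod>i<n. A i i)"
    by (auto simp: prod_list_diag_prod lessThan_atLeast0)
  finally show ?thesis by (simp add: ldet_eq_det)
qed

lemma ldet_scale_rows: "ldet n (\<lambda>i j. a i * A i j) = (\<Prod>i<n. a i) * ldet n A"
  by (simp add: ldet_def prod.distrib sum_distrib_left mult_ac)

lemma ldet_scale_cols: "ldet n (\<lambda>i j. a j * A i j) = (\<Prod>i<n. a i) * ldet n A"
  using ldet_scale_rows[of n a "\<lambda>i j. A j i"]
  by (simp add: ldet_transpose[of n "\<lambda>i j. a j * A i j", symmetric] ldet_transpose[of n A])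

lemma ldet_row_linear:
  assumes "k < n"
  shows "ldet n (A(k := \<lambda>j. a * u j + b * v j)) = a * ldet n (A(k := u)) + b * ldet n (A(k := v))"
proof -
  have *: "(\<Prod>i<n. (A(k := w)) i (p i)) = w (p k) * (\<Prod>i\<in>{..<n} - {k}. A i (p i))" for w p
  proof -
    have "(\<Prod>i<n. (A(k := w)) i (p i)) =
        (A(k := w)) k (p k) * (\<Prod>i\<in>{..<n} - {k}. (A(k := w)) i (p i))"
      by (rule prod.remove) (use assms in auto)
    also have "(\<Prod>i\<in>{..<n} - {k}. (A(k := w)) i (p i)) = (\<Prod>i\<in>{..<n} - {k}. A i (p i))"
      by (rule prod.cong) auto
    finally show ?thesis by simp
  qed
  show ?thesis
    unfolding ldet_def *
    by (simp add: algebra_simps sum.distrib sum_distrib_left)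
qed

lemma ldet_identical_rows:
  assumes "i \<noteq> j" "i < n" "j < n" "\<And>k. k < n \<Longrightarrow> A i k = A j k"
  shows "ldet n A = 0"
  unfolding ldet_eq_det
  by (rule det_identical_rows[of _ n i j]) (use assms in \<open>auto intro!: eq_vecI\<close>)

lemma ldet_row_sum:
  assumes "k < n" "finite I"
  shows "ldet n (A(k := \<lambda>j. \<Sum>i\<in>I. c i * R i j)) = (\<Sum>i\<in>I. c i * ldet n (A(k := R i)))"
  using assms(2)
proof (induction I)
  case empty
  show ?case
    using ldet_row_linear[OF assms(1), of A 0 "\<lambda>_. 0" 0 "\<lambda>_. 0"] by (simp del: fun_upd_apply)
next
  case (insert x F)
  have "ldet n (A(k := \<lambda>j. \<Sum>i\<in>insert x F. c i * R i j)) =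
      ldet n (A(k := \<lambda>j. c x * R x j + 1 * (\<Sum>i\<in>F. c i * R i j)))"
    using insert by simp
  also have "\<dots> = c x * ldet n (A(k := R x)) + 1 * ldet n (A(k := \<lambda>j. \<Sum>i\<in>F. c i * R i j))"
    by (rule ldet_row_linear[OF assms(1)])
  finally show ?case using insert by (simp del: fun_upd_apply)
qed

lemma ldet_add_rows:
  assumes "k < n" "I \<subseteq> {..<n} - {k}"
  shows "ldet n (A(k := \<lambda>j. A k j + (\<Sum>i\<in>I. c i * A i j))) = ldet n A"
proof -
  have fin: "finite I"
    using assms(2) finite_subset by auto
  have "ldet n (A(k := \<lambda>j. 1 * A k j + 1 * (\<Sum>i\<in>I. c i * A i j))) =
      1 * ldet n (A(k := A k)) + 1 * ldet n (A(k := \<lambda>j. \<Sum>i\<in>I. c i * A i j))"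
    by (rule ldet_row_linear[OF assms(1)])
  also have "ldet n (A(k := \<lambda>j. \<Sum>i\<in>I. c i * A i j)) = (\<Sum>i\<in>I. c i * ldet n (A(k := A i)))"
    by (rule ldet_row_sum[OF assms(1) fin])
  also have "\<dots> = 0"
  proof (rule sum.neutral, rule ballI)
    fix i assume "i \<in> I"
    then have "ldet n (A(k := A i)) = 0"
      using assms by (intro ldet_identical_rows[of i k]) auto
    then show "c i * ldet n (A(k := A i)) = 0" by (simp del: fun_upd_apply)
  qed
  finally show ?thesis by (simp del: fun_upd_apply)
qed

lemma ldet_block:
  assumes "\<And>i j. n \<le> i \<Longrightarrow> i < n + m \<Longrightarrow> j < n \<Longrightarrow> A i j = 0"
  shows "ldet (n + m) A = ldet n A * ldet m (\<lambda>i j. A (n + i) (n + j))"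
proof -
  have "mat (n + m) (n + m) (\<lambda>(i, j). A i j) =
     four_block_mat (mat n n (\<lambda>(i, j). A i j)) (mat n m (\<lambda>(i, j). A i (n + j)))
       (0\<^sub>m m n) (mat m m (\<lambda>(i, j). A (n + i) (n + j)))"
    by (rule eq_matI) (auto simp: assms)
  then show ?thesis
    unfolding ldet_eq_det
    by (simp add: det_four_block_mat_lower_left_zero[of _ n _ m])
qed

lemma ldet_swap_rows:
  assumes "k < n" "l < n" "k \<noteq> l"
  shows "ldet n (A(k := A l, l := A k)) = - ldet n A"
proof -
  have "mat n n (\<lambda>(i, j). (A(k := A l, l := A k)) i j) =
      swaprows k l (mat n n (\<lambda>(i, j). A i j))"
    by (rule eq_matI) (use assms in auto)
  then show ?thesis
    using det_swaprows[OF assms, of "mat n n (\<lambda>(i, j). A i j)"] by (simp add: ldet_eq_det)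
qed

text \<open>x moves past the rows \<open>ys\<close> by adjacent transpositions, one sign each. The
  row order is a list because hooks put new rows at the front while the induction over the cut-off
  works from the back.\<close>

lemma ldet_rotate_list:
  fixes xs :: "(nat \<Rightarrow> real) list"
  shows "ldet (length (pre @ x # ys @ zs)) (\<lambda>i. (pre @ x # ys @ zs) ! i) =
    (-1) ^ length ys * ldet (length (pre @ x # ys @ zs)) (\<lambda>i. (pre @ ys @ x # zs) ! i)"
proof (induction ys arbitrary: pre)
  case Nil
  show ?case by simp
next
  case (Cons y ys)
  let ?n = "length (pre @ x # (y # ys) @ zs)"
  let ?A = "\<lambda>i. (pre @ y # x # ys @ zs) ! i"
  have "(\<lambda>i. (pre @ x # (y # ys) @ zs) ! i) =
      ?A(length pre := ?A (Suc (length pre)), Suc (length pre) := ?A (length pre))"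
    by (auto simp: fun_eq_iff nth_append nth_Cons split: nat.splits)
  then have "ldet ?n (\<lambda>i. (pre @ x # (y # ys) @ zs) ! i) = - ldet ?n ?A"
    using ldet_swap_rows[of "length pre" ?n "Suc (length pre)" ?A] by (simp del: fun_upd_apply)
  also have "ldet ?n ?A = (-1) ^ length ys * ldet ?n (\<lambda>i. (pre @ (y # ys) @ x # zs) ! i)"
    using Cons.IH[of "pre @ [y]"] by simp
  finally show ?case by simp
qed

lemma abs_real_of_int_sign: "\<bar>real_of_int (sign p)\<bar> = 1"
  by (simp add: sign_def)

section \<open>Bounds for determinants: row sums and Hadamard's inequality\<close>

lemma ldet_abs_le_perms:
  "\<bar>ldet n A\<bar> \<le> (\<Sum>p | p permutes {..<n}. \<Prod>i<n. \<bar>A i (p i)\<bar>)"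
  unfolding ldet_def
  by (rule order_trans[OF sum_abs]) (simp add: abs_mult abs_prod abs_real_of_int_sign)

text \<open>Restricted permutations are among all maps of the index set, and a product summed over
  all maps factors into row sums (\<open>prod_sum_PiE\<close>). This is how permutation sums become
  products of row sums below.\<close>

lemma sum_permutes_le_prod_sum:
  fixes F :: "(nat \<Rightarrow> nat) \<Rightarrow> real"
  assumes "\<And>f. f \<in> {..<n} \<rightarrow>\<^sub>E {..<n} \<Longrightarrow> 0 \<le> F f"
  shows "(\<Sum>p | p permutes {..<n}. F (restrict p {..<n})) \<le> (\<Sum>f\<in>{..<n} \<rightarrow>\<^sub>E {..<n}. F f)"
proof -
  have inj: "inj_on (\<lambda>p. restrict p {..<n}) {p. p permutes {..<n}}"
  proof (rule inj_onI)
    fix p q :: "nat \<Rightarrow> nat"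
    assume a: "p \<in> {p. p permutes {..<n}}" "q \<in> {p. p permutes {..<n}}"
      and e: "restrict p {..<n} = restrict q {..<n}"
    show "p = q"
    proof
      fix x show "p x = q x"
        using a fun_cong[OF e, of x] by (cases "x < n") (auto simp: permutes_def)
    qed
  qed
  have "(\<Sum>p | p permutes {..<n}. F (restrict p {..<n})) =
      (\<Sum>f\<in>(\<lambda>p. restrict p {..<n}) ` {p. p permutes {..<n}}. F f)"
    by (simp only: sum.reindex[OF inj] comp_def)
  also have "\<dots> \<le> (\<Sum>f\<in>{..<n} \<rightarrow>\<^sub>E {..<n}. F f)"
  proof (rule sum_mono2)
    show "finite ({..<n} \<rightarrow>\<^sub>E {..<n})"
      by (simp add: finite_PiE)
    show "(\<lambda>p. restrict p {..<n}) ` {p. p permutes {..<n}} \<subseteq> {..<n} \<rightarrow>\<^sub>E {..<n}"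
      using permutes_in_image by (fastforce simp: PiE_def extensional_def)
  qed (simp add: assms)
  finally show ?thesis .
qed

lemma ldet_abs_le: "\<bar>ldet n A\<bar> \<le> (\<Prod>i<n. \<Sum>j<n. \<bar>A i j\<bar>)"
proof -
  have "(\<Sum>p | p permutes {..<n}. \<Prod>i<n. \<bar>A i (p i)\<bar>) \<le> (\<Sum>f\<in>{..<n} \<rightarrow>\<^sub>E {..<n}. \<Prod>i<n. \<bar>A i (f i)\<bar>)"
    using sum_permutes_le_prod_sum[of n "\<lambda>f. \<Prod>i<n. \<bar>A i (f i)\<bar>"] by (simp add: prod_nonneg)
  then show ?thesis
    using ldet_abs_le_perms[of n A] by (simp add: prod_sum_PiE)
qed

text \<open>Substituting x = y + (x - y) and expanding, the right side is the sum of the absolute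
  values of all terms except the leading one. Written as a difference of two products, it can be
  summed over maps.\<close>

lemma prod_diff_le:
  fixes x y :: "nat \<Rightarrow> real"
  shows "\<bar>(\<Prod>i<n. x i) - (\<Prod>i<n. y i)\<bar> \<le> (\<Prod>i<n. \<bar>y i\<bar> + \<bar>x i - y i\<bar>) - (\<Prod>i<n. \<bar>y i\<bar>)"
proof (induction n)
  case 0
  show ?case by simp
next
  case (Suc n)
  let ?X = "\<Prod>i<n. x i" and ?Y = "\<Prod>i<n. y i"
  let ?P = "\<Prod>i<n. \<bar>y i\<bar> + \<bar>x i - y i\<bar>" and ?Q = "\<Prod>i<n. \<bar>y i\<bar>"
  have X: "\<bar>?X\<bar> \<le> ?P"
    unfolding abs_prod by (rule prod_mono) auto
  have "?X * x n - ?Y * y n = ?X * (x n - y n) + (?X - ?Y) * y n"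
    by (simp add: algebra_simps)
  then have "\<bar>?X * x n - ?Y * y n\<bar> \<le> \<bar>?X\<bar> * \<bar>x n - y n\<bar> + \<bar>?X - ?Y\<bar> * \<bar>y n\<bar>"
    by (metis abs_mult abs_triangle_ineq)
  also have "\<dots> \<le> ?P * \<bar>x n - y n\<bar> + (?P - ?Q) * \<bar>y n\<bar>"
    by (intro add_mono mult_right_mono X Suc) auto
  also have "\<dots> = ?P * (\<bar>y n\<bar> + \<bar>x n - y n\<bar>) - ?Q * \<bar>y n\<bar>"
    by (simp add: algebra_simps)
  finally show ?case by simp
qed

lemma ldet_diff_le:
  "\<bar>ldet n X - ldet n Y\<bar> \<le>
    (\<Prod>i<n. (\<Sum>j<n. \<bar>Y i j\<bar>) + (\<Sum>j<n. \<bar>X i j - Y i j\<bar>)) - (\<Prod>i<n. \<Sum>j<n. \<bar>Y i j\<bar>)"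
proof -
  let ?F = "\<lambda>f. (\<Prod>i<n. \<bar>Y i (f i)\<bar> + \<bar>X i (f i) - Y i (f i)\<bar>) - (\<Prod>i<n. \<bar>Y i (f i)\<bar>)"
  have "ldet n X - ldet n Y =
      (\<Sum>p | p permutes {..<n}. of_int (sign p) * ((\<Prod>i<n. X i (p i)) - (\<Prod>i<n. Y i (p i))))"
    by (simp add: ldet_def sum_subtractf algebra_simps)
  also have "\<bar>\<dots>\<bar> \<le> (\<Sum>p | p permutes {..<n}. \<bar>(\<Prod>i<n. X i (p i)) - (\<Prod>i<n. Y i (p i))\<bar>)"
    by (rule order_trans[OF sum_abs]) (simp add: abs_mult abs_real_of_int_sign)
  also have "\<dots> \<le> (\<Sum>p | p permutes {..<n}. ?F p)"
    by (intro sum_mono prod_diff_le)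
  also have "\<dots> = (\<Sum>p | p permutes {..<n}. ?F (restrict p {..<n}))"
    by simp
  also have "\<dots> \<le> (\<Sum>f\<in>{..<n} \<rightarrow>\<^sub>E {..<n}. ?F f)"
  proof (rule sum_permutes_le_prod_sum[where F = ?F])
    fix f
    have "(\<Prod>i<n. \<bar>Y i (f i)\<bar>) \<le> (\<Prod>i<n. \<bar>Y i (f i)\<bar> + \<bar>X i (f i) - Y i (f i)\<bar>)"
      by (rule prod_mono) simp
    then show "0 \<le> ?F f" by simp
  qed
  also have "\<dots> = (\<Prod>i<n. \<Sum>j<n. \<bar>Y i j\<bar> + \<bar>X i j - Y i j\<bar>) - (\<Prod>i<n. \<Sum>j<n. \<bar>Y i j\<bar>)"
    by (simp add: sum_subtractf prod_sum_PiE)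
  finally show ?thesis by (simp add: sum.distrib)
qed

text \<open>The square of the determinant is that of the Gram matrix A A^T, which is diagonal
  here.\<close>

lemma ldet_hadamard_orthogonal:
  assumes "\<And>i j. i < n \<Longrightarrow> j < n \<Longrightarrow> i \<noteq> j \<Longrightarrow> (\<Sum>k<n. A i k * A j k) = 0"
  shows "(ldet n A)\<^sup>2 = (\<Prod>i<n. \<Sum>k<n. (A i k)\<^sup>2)"
proof -
  have "(ldet n A)\<^sup>2 = ldet n A * ldet n (\<lambda>i j. A j i)"
    by (simp add: power2_eq_square ldet_transpose[of n A])
  also have "\<dots> = ldet n (\<lambda>i j. \<Sum>k<n. A i k * A j k)"
    by (simp add: ldet_mult)
  also have "\<dots> = (\<Prod>i<n. \<Sum>k<n. A i k * A i k)"
    by (rule ldet_upper_triangular) (simp add: assms)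
  finally show ?thesis by (simp add: power2_eq_square)
qed

text \<open>Gram--Schmidt: making one more row orthogonal to the previous ones preserves the determinant and
  shortens the row.\<close>

lemma ldet_hadamard_aux:
  assumes "m \<le> n"
    and "\<And>i j. i < m \<Longrightarrow> j < m \<Longrightarrow> i \<noteq> j \<Longrightarrow> (\<Sum>k<n. A i k * A j k) = 0"
  shows "(ldet n A)\<^sup>2 \<le> (\<Prod>i<n. \<Sum>k<n. (A i k)\<^sup>2)"
  using assms
proof (induction "n - m" arbitrary: m A)
  case 0
  then show ?case
    using ldet_hadamard_orthogonal[of n A] by simp
next
  case (Suc d)
  then have m: "m < n" by simp
  define ip where "ip u v = (\<Sum>k<n. u k * v k)" for u v :: "nat \<Rightarrow> real"
  \<comment> \<open>Projection coefficients. For a zero row the quotient is 0 by the convention x /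
    0 = 0, and \<open>ip0\<close> shows that such a row is orthogonal to every vector
    anyway.\<close>
  define c where "c i = - ip (A m) (A i) / ip (A i) (A i)" for i
  define B where "B = A(m := \<lambda>j. A m j + (\<Sum>i<m. c i * A i j))"
  have ip0: "ip u v = 0" if "ip u u = 0" for u v
  proof -
    have "u k = 0" if "k < n" for k
      using \<open>ip u u = 0\<close> that by (auto simp: ip_def sum_nonneg_eq_0_iff)
    then show ?thesis by (simp add: ip_def)
  qed
  have ip_sym: "ip u v = ip v u" for u v
    by (simp add: ip_def mult.commute)
  have ip_lin: "ip (\<lambda>j. u j + (\<Sum>i<m. c i * A i j)) w = ip u w + (\<Sum>i<m. c i * ip (A i) w)" for u w
    by (simp add: ip_def distrib_right sum.distrib sum_distrib_right sum_distrib_left mult.assoc)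
       (rule sum.swap)
  have orth: "ip (A i) (A j) = 0" if "i < m" "j < m" "i \<noteq> j" for i j
    using Suc.prems(2)[OF that] by (simp add: ip_def)
  have Bm: "ip (B m) (A i) = 0" if "i < m" for i
  proof -
    have "ip (B m) (A i) = ip (A m) (A i) + (\<Sum>l<m. c l * ip (A l) (A i))"
      by (simp add: B_def ip_lin)
    also have "(\<Sum>l<m. c l * ip (A l) (A i)) = (\<Sum>l<m. if l = i then c i * ip (A i) (A i) else 0)"
      by (rule sum.cong) (use orth that in auto)
    also have "\<dots> = c i * ip (A i) (A i)"
      using that by simp
    also have "ip (A m) (A i) + \<dots> = 0"
      using ip0[of "A i" "A m"] ip_sym[of "A i" "A m"] by (auto simp: c_def)
    finally show ?thesis .
  qed
  have "ldet n B = ldet n A"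
    unfolding B_def by (rule ldet_add_rows) (use m in auto)
  moreover have "(ldet n B)\<^sup>2 \<le> (\<Prod>i<n. \<Sum>k<n. (B i k)\<^sup>2)"
  proof (rule Suc.hyps(1))
    show "d = n - Suc m" "Suc m \<le> n" using Suc.hyps m by auto
    show "(\<Sum>k<n. B i k * B j k) = 0" if "i < Suc m" "j < Suc m" "i \<noteq> j" for i j
    proof -
      have "ip (B i) (B j) = 0"
        using that Bm[of i] Bm[of j] orth[of i j] ip_sym[of "B m"]
        by (cases "i = m"; cases "j = m") (auto simp: B_def)
      then show ?thesis by (simp add: ip_def)
    qed
  qed
  moreover have "(\<Prod>i<n. \<Sum>k<n. (B i k)\<^sup>2) \<le> (\<Prod>i<n. \<Sum>k<n. (A i k)\<^sup>2)"
  proof (rule prod_mono, safe)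
    fix i
    show "0 \<le> (\<Sum>k<n. (B i k)\<^sup>2)" by (simp add: sum_nonneg)
    show "(\<Sum>k<n. (B i k)\<^sup>2) \<le> (\<Sum>k<n. (A i k)\<^sup>2)"
    proof (cases "i = m")
      case False
      then show ?thesis by (simp add: B_def)
    next
      case True
      define v where "v j = (\<Sum>i<m. c i * A i j)" for j
      have Am: "A m j = B m j - v j" for j by (simp add: B_def v_def)
      have "ip (B m) v = (\<Sum>i<m. c i * ip (B m) (A i))"
        by (simp add: ip_def v_def sum_distrib_left mult_ac) (rule sum.swap)
      then have z: "ip (B m) v = 0" using Bm by simp
      \<comment> \<open>Pythagoras: the old row is the new one minus v, and these are
        orthogonal.\<close>
      have "(\<Sum>k<n. (A m k)\<^sup>2) = (\<Sum>k<n. (B m k)\<^sup>2) + (\<Sum>k<n. (v k)\<^sup>2) - 2 * ip (B m) v"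
        unfolding Am by (simp add: ip_def power2_diff sum.distrib sum_subtractf sum_distrib_left mult_ac)
      then show ?thesis using z True by (simp add: sum_nonneg)
    qed
  qed
  ultimately show ?case by simp
qed

lemma sqrt_prod: "sqrt (\<Prod>i\<in>I. f i) = (\<Prod>i\<in>I. sqrt (f i))"
  by (induction I rule: infinite_finite_induct) (auto simp: real_sqrt_mult)

lemma ldet_hadamard: "\<bar>ldet n A\<bar> \<le> (\<Prod>i<n. sqrt (\<Sum>k<n. (A i k)\<^sup>2))"
proof -
  have "(ldet n A)\<^sup>2 \<le> (\<Prod>i<n. \<Sum>k<n. (A i k)\<^sup>2)"
    using ldet_hadamard_aux[of 0 n A] by simp
  then have "sqrt ((ldet n A)\<^sup>2) \<le> sqrt (\<Prod>i<n. \<Sum>k<n. (A i k)\<^sup>2)"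
    by (rule real_sqrt_le_mono)
  then show ?thesis by (simp add: sqrt_prod)
qed

section \<open>Principal minors and the expansion of det (1 + A)\<close>

definition detS :: "nat set \<Rightarrow> (nat \<Rightarrow> nat \<Rightarrow> real) \<Rightarrow> real" where
  "detS T A = (\<Sum>p | p permutes T. of_int (sign p) * (\<Prod>i\<in>T. A i (p i)))"

text \<open>Conjugating a permutation with the enumeration x keeps its sign, so a principal minor
  depends only on the set of its indices.\<close>

lemma ldet_eq_detS:
  assumes x: "bij_betw x {..<k} T"
  shows "ldet k (\<lambda>i j. A (x i) (x j)) = detS T A"
proof -
  let ?g = "the_inv_into {..<k} x"
  have inj: "inj_on x {..<k}" and im: "x ` {..<k} = T"
    using x by (auto simp: bij_betw_def)
  have g: "bij_betw ?g T {..<k}" "\<And>i. i < k \<Longrightarrow> ?g (x i) = i" "\<And>y. y \<in> T \<Longrightarrow> x (?g y) = y"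
    using x bij_betw_the_inv_into[OF x] inj im
    by (auto simp: the_inv_into_f_f f_the_inv_into_f)
  show ?thesis
    unfolding ldet_def detS_def
  proof (rule sum.reindex_bij_witness[of _ "map_permutation T ?g" "map_permutation {..<k} x"])
    fix p assume "p \<in> {p. p permutes {..<k}}"
    then have p: "p permutes {..<k}" by simp
    show "map_permutation T ?g (map_permutation {..<k} x p) = p"
      using p x g by (intro map_permutation_compose_inv) auto
    show "map_permutation {..<k} x p \<in> {p. p permutes T}"
      using map_permutation_permutes[OF x p] by simp
    have "(\<Prod>y\<in>T. A y (map_permutation {..<k} x p y)) =
        (\<Prod>i<k. A (x i) (map_permutation {..<k} x p (x i)))"
      using prod.reindex_bij_betw[OF x, of "\<lambda>y. A y (map_permutation {..<k} x p y)"] by simp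
    also have "\<dots> = (\<Prod>i<k. A (x i) (x (p i)))"
      by (rule prod.cong) (auto simp: map_permutation_apply[OF inj])
    finally show "real_of_int (sign (map_permutation {..<k} x p)) *
        (\<Prod>y\<in>T. A y (map_permutation {..<k} x p y)) =
        real_of_int (sign p) * (\<Prod>i<k. A (x i) (x (p i)))"
      using sign_map_permutation[OF inj p] by simp
  next
    fix q assume "q \<in> {p. p permutes T}"
    then have q: "q permutes T" by simp
    show "map_permutation {..<k} x (map_permutation T ?g q) = q"
      using q x g by (intro map_permutation_compose_inv) auto
    show "map_permutation T ?g q \<in> {p. p permutes {..<k}}"
      using map_permutation_permutes[OF g(1) q] by simp
  qed
qed

text \<open>Expanding each product over the set T of indices where A is chosen, the identity factors
  off T force p to fix every point there, which makes p a permutation of T.\<close>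

lemma ldet_one_plus_detS:
  "ldet n (\<lambda>i j. (if i = j then 1 else 0) + A i j) = (\<Sum>T\<in>Pow {..<n}. detS T A)"
proof -
  have *: "(\<Prod>i<n. (if i = p i then 1 else 0) + A i (p i)) =
      (\<Sum>T\<in>Pow {..<n}. if p permutes T then \<Prod>i\<in>T. A i (p i) else 0)"
    if p: "p permutes {..<n}" for p :: "nat \<Rightarrow> nat"
  proof -
    have "(\<Prod>i<n. (if i = p i then 1 else 0) + A i (p i)) =
        (\<Sum>T\<in>Pow {..<n}. (\<Prod>i\<in>T. A i (p i)) * (\<Prod>i\<in>{..<n} - T. if i = p i then 1 else 0))"
      by (subst prod_add[symmetric]) (simp_all add: add.commute)
    also have "\<dots> = (\<Sum>T\<in>Pow {..<n}. if p permutes T then \<Prod>i\<in>T. A i (p i) else 0)"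
    proof (rule sum.cong[OF refl])
      fix T assume "T \<in> Pow {..<n}"
      then have T: "T \<subseteq> {..<n}" by simp
      show "(\<Prod>i\<in>T. A i (p i)) * (\<Prod>i\<in>{..<n} - T. if i = p i then 1 else 0) =
          (if p permutes T then \<Prod>i\<in>T. A i (p i) else 0)"
      proof (cases "\<forall>i\<in>{..<n} - T. p i = i")
        case True
        then have "p permutes T"
          using p T permutes_superset[of p "{..<n}" T] by auto
        then show ?thesis using True by simp
      next
        case False
        then have "\<not> p permutes T" by (auto simp: permutes_def)
        moreover obtain i where i: "i \<in> {..<n} - T" "p i \<noteq> i"
          using False by blast
        then have "(\<Prod>i\<in>{..<n} - T. if i = p i then 1 else 0) = (0::real)"
          by (intro prod_zero bexI[OF _ i(1)]) auto
        ultimately show ?thesis by simp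
      qed
    qed
    finally show ?thesis .
  qed
  have "ldet n (\<lambda>i j. (if i = j then 1 else 0) + A i j) =
      (\<Sum>p | p permutes {..<n}. \<Sum>T\<in>Pow {..<n}.
        if p permutes T then of_int (sign p) * (\<Prod>i\<in>T. A i (p i)) else 0)"
    unfolding ldet_def
  proof (rule sum.cong[OF refl])
    fix p :: "nat \<Rightarrow> nat" assume "p \<in> {p. p permutes {..<n}}"
    then show "of_int (sign p) * (\<Prod>i<n. (if i = p i then 1 else 0) + A i (p i)) =
        (\<Sum>T\<in>Pow {..<n}. if p permutes T then of_int (sign p) * (\<Prod>i\<in>T. A i (p i)) else 0)"
      by (simp only: * mem_Collect_eq sum_distrib_left) (rule sum.cong; simp)
  qed
  also have "\<dots> = (\<Sum>T\<in>Pow {..<n}. \<Sum>p | p permutes {..<n}.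
        if p permutes T then of_int (sign p) * (\<Prod>i\<in>T. A i (p i)) else 0)"
    by (rule sum.swap)
  also have "\<dots> = (\<Sum>T\<in>Pow {..<n}. detS T A)"
  proof (rule sum.cong[OF refl])
    fix T assume "T \<in> Pow {..<n}"
    then have T: "T \<subseteq> {..<n}" by simp
    have "{p. p permutes {..<n}} \<inter> {p. p permutes T} = {p. p permutes T}"
      using permutes_subset[OF _ T] by auto
    then show "(\<Sum>p | p permutes {..<n}.
        if p permutes T then of_int (sign p) * (\<Prod>i\<in>T. A i (p i)) else 0) = detS T A"
      by (subst sum.If_cases) (auto simp: finite_permutations detS_def)
  qed
  finally show ?thesis .
qed

lemma card_inj_PiE:
  assumes "finite T" "card T = k"
  shows "card {x \<in> {..<k} \<rightarrow>\<^sub>E T. inj_on x {..<k}} = fact k"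
  using card_inj_on_subset_funcset[of "{..<k}" T "{..<k}"] assms
  by (simp add: fact_prod_rev)

text \<open>A tuple with a repetition gives two equal rows; the injective ones enumerate each k-set
  in \<open>fact k\<close> ways, all with the same minor.\<close>

lemma sum_tuples_ldet:
  "(\<Sum>x\<in>{..<k} \<rightarrow>\<^sub>E {..<n}. ldet k (\<lambda>i j. A (x i) (x j))) =
    fact k * (\<Sum>T | T \<subseteq> {..<n} \<and> card T = k. detS T A)"
proof -
  let ?S = "{..<k} \<rightarrow>\<^sub>E {..<n}" and ?I = "{x \<in> {..<k} \<rightarrow>\<^sub>E {..<n}. inj_on x {..<k}}"
  let ?T = "{T. T \<subseteq> {..<n} \<and> card T = k}"
  have fin: "finite ?S" by (simp add: finite_PiE)
  have "(\<Sum>x\<in>?S. ldet k (\<lambda>i j. A (x i) (x j))) = (\<Sum>x\<in>?I. ldet k (\<lambda>i j. A (x i) (x j)))"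
  proof (rule sum.mono_neutral_right[OF fin])
    show "\<forall>x\<in>?S - ?I. ldet k (\<lambda>i j. A (x i) (x j)) = 0"
    proof
      fix x assume "x \<in> ?S - ?I"
      then obtain i j where "i < k" "j < k" "i \<noteq> j" "x i = x j"
        by (auto simp: inj_on_def)
      then show "ldet k (\<lambda>i j. A (x i) (x j)) = 0"
        by (intro ldet_identical_rows[of i j]) auto
    qed
  qed auto
  also have "\<dots> = (\<Sum>x\<in>?I. detS (x ` {..<k}) A)"
  proof (rule sum.cong[OF refl])
    fix x assume "x \<in> ?I"
    then have "bij_betw x {..<k} (x ` {..<k})" by (simp add: bij_betw_def)
    then show "ldet k (\<lambda>i j. A (x i) (x j)) = detS (x ` {..<k}) A" by (rule ldet_eq_detS)
  qed
  also have "\<dots> = (\<Sum>T\<in>?T. \<Sum>x\<in>{x \<in> ?I. x ` {..<k} = T}. detS (x ` {..<k}) A)"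
  proof (rule sum.group[symmetric])
    show "finite ?I" using fin by simp
    show "(\<lambda>x. x ` {..<k}) ` ?I \<subseteq> ?T"
    proof (rule image_subsetI)
      fix x assume "x \<in> ?I"
      then have "inj_on x {..<k}" "x ` {..<k} \<subseteq> {..<n}" by blast+
      then show "x ` {..<k} \<in> ?T" using card_image[of x "{..<k}"] by simp
    qed
  qed simp
  also have "\<dots> = (\<Sum>T\<in>?T. fact k * detS T A)"
  proof (rule sum.cong[OF refl])
    fix T assume T: "T \<in> ?T"
    then have fT: "finite T" using finite_subset by auto
    have "x ` {..<k} = T" if "x \<in> {..<k} \<rightarrow>\<^sub>E T" "inj_on x {..<k}" for x
      using that T fT by (intro card_subset_eq) (auto simp: card_image)
    moreover have "x \<in> {..<k} \<rightarrow>\<^sub>E T" if "x \<in> {..<k} \<rightarrow>\<^sub>E {..<n}" "x ` {..<k} = T" for x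
      using that by (simp add: PiE_iff image_subset_iff[symmetric])
    moreover have "x \<in> {..<k} \<rightarrow>\<^sub>E {..<n}" if "x \<in> {..<k} \<rightarrow>\<^sub>E T" for x
      using PiE_mono[of "{..<k}" "\<lambda>_. T" "\<lambda>_. {..<n}"] that T by blast
    ultimately have "{x \<in> ?I. x ` {..<k} = T} = {x \<in> {..<k} \<rightarrow>\<^sub>E T. inj_on x {..<k}}"
      by blast
    then have "card {x \<in> ?I. x ` {..<k} = T} = fact k"
      using card_inj_PiE[OF fT] T by simp
    then show "(\<Sum>x\<in>{x \<in> ?I. x ` {..<k} = T}. detS (x ` {..<k}) A) = fact k * detS T A"
      by (simp del: fact_Suc)
  qed
  finally show ?thesis by (simp add: sum_distrib_left)
qed

text \<open>The finite Fredholm series. Summing over all tuples with the weight 1 /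
  \<open>fact k\<close> mirrors the integrals over all points of the half-line in
  \<open>fredholm_det\<close>.\<close>

lemma ldet_one_plus:
  "ldet n (\<lambda>i j. (if i = j then 1 else 0) + A i j) =
    (\<Sum>k\<le>n. (\<Sum>x\<in>{..<k} \<rightarrow>\<^sub>E {..<n}. ldet k (\<lambda>i j. A (x i) (x j))) / fact k)"
proof -
  have "(\<Sum>T\<in>Pow {..<n}. detS T A) = (\<Sum>k\<le>n. \<Sum>T | T \<in> Pow {..<n} \<and> card T = k. detS T A)"
    by (rule sum.group[symmetric]) (auto simp: card_mono[of "{..<n}", simplified])
  also have "\<dots> = (\<Sum>k\<le>n. (\<Sum>x\<in>{..<k} \<rightarrow>\<^sub>E {..<n}. ldet k (\<lambda>i j. A (x i) (x j))) / fact k)"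
    by (simp add: sum_tuples_ldet)
  finally show ?thesis by (simp add: ldet_one_plus_detS)
qed

section \<open>Standard tableaux and determinants\<close>

text \<open>$t^z/z!$, extended by $0$ to negative \<open>z\<close>, so that $z \cdot E(z) = t \cdot E(z-1)$ for all integers.\<close>

definition Ez :: "real \<Rightarrow> int \<Rightarrow> real" where
  "Ez t z = (if z < 0 then 0 else t ^ nat z / fact (nat z))"

lemma Ez_rec: "of_int z * Ez t z = t * Ez t (z - 1)"
proof (cases "z > 0")
  case True
  then obtain n where n: "z = int (Suc n)"
    by (metis zero_less_imp_eq_int gr0_implies_Suc)
  show ?thesis unfolding n
    by (simp add: Ez_def nat_add_distrib del: of_nat_Suc) (simp add: field_simps)
next
  case False
  then show ?thesis by (auto simp: Ez_def)
qed

text \<open>Defined for any set of cells, so that one cell may be deleted at a time: order is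
  required only between neighbours that both lie in D. On diagrams of partitions this is
  \<open>syt\<close>.\<close>

definition tableaux :: "(nat \<times> nat) set \<Rightarrow> (nat \<times> nat \<Rightarrow> nat) set" where
  "tableaux D = {T. bij_betw T D {1..card D} \<and> (\<forall>c. c \<notin> D \<longrightarrow> T c = 0)
     \<and> (\<forall>i j. (i, j) \<in> D \<longrightarrow> (i, Suc j) \<in> D \<longrightarrow> T (i, j) < T (i, Suc j))
     \<and> (\<forall>i j. (i, j) \<in> D \<longrightarrow> (Suc i, j) \<in> D \<longrightarrow> T (i, j) < T (Suc i, j))}"

lemma tableauxD:
  assumes "T \<in> tableaux D"
  shows "bij_betw T D {1..card D}" "c \<notin> D \<Longrightarrow> T c = 0"
    "(i, j) \<in> D \<Longrightarrow> (i, Suc j) \<in> D \<Longrightarrow> T (i, j) < T (i, Suc j)"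
    "(i, j) \<in> D \<Longrightarrow> (Suc i, j) \<in> D \<Longrightarrow> T (i, j) < T (Suc i, j)"
  using assms by (auto simp: tableaux_def simp del: split_paired_All)

definition corners :: "(nat \<times> nat) set \<Rightarrow> (nat \<times> nat) set" where
  "corners D = {(i, j). (i, j) \<in> D \<and> (i, Suc j) \<notin> D \<and> (Suc i, j) \<notin> D}"

lemma finite_tableaux:
  assumes "finite D"
  shows "finite (tableaux D)"
proof (rule finite_subset)
  show "tableaux D \<subseteq> {T. \<forall>c. (c \<in> D \<longrightarrow> T c \<in> {1..card D}) \<and> (c \<notin> D \<longrightarrow> T c = 0)}"
    unfolding tableaux_def by (auto dest: bij_betw_apply)
  show "finite {T. \<forall>c. (c \<in> D \<longrightarrow> T c \<in> {1..card D}) \<and> (c \<notin> D \<longrightarrow> T c = 0)}"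
    by (rule finite_set_of_finite_funs) (use assms in auto)
qed

lemma tableaux_remove:
  assumes "finite D" "D \<noteq> {}" "T \<in> tableaux D"
  obtains c where "c \<in> corners D" "T c = card D" "T(c := 0) \<in> tableaux (D - {c})"
proof -
  have bij: "bij_betw T D {1..card D}" using assms by (simp add: tableaux_def)
  have "card D \<in> {1..card D}" using assms by (simp add: Suc_le_eq card_gt_0_iff)
  then have "card D \<in> T ` D" using bij by (simp add: bij_betw_def)
  then obtain c where c: "c \<in> D" "T c = card D" by auto
  have le: "T x \<le> card D" if "x \<in> D" for x
    using bij_betw_apply[OF bij that] by simp
  obtain i j where ij: "c = (i, j)" by fastforce
  have right: "(i, Suc j) \<notin> D"
  proof
    assume a: "(i, Suc j) \<in> D"
    then have "T (i, j) < T (i, Suc j)" using tableauxD(3)[OF assms(3)] c ij by blast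
    then show False using le[OF a] c ij by simp
  qed
  have below: "(Suc i, j) \<notin> D"
  proof
    assume a: "(Suc i, j) \<in> D"
    then have "T (i, j) < T (Suc i, j)" using tableauxD(4)[OF assms(3)] c ij by blast
    then show False using le[OF a] c ij by simp
  qed
  have b1: "bij_betw T (D - {c}) ({1..card D} - {card D})"
    using bij_betw_DiffI[of T D "{1..card D}" "{c}" "{card D}"] bij c \<open>card D \<in> {1..card D}\<close>
    by (simp add: bij_betw_def)
  have "{1..card D} - {card D} = {1..card (D - {c})}"
    using c assms by auto
  then have "bij_betw (T(c := 0)) (D - {c}) {1..card (D - {c})}"
    using b1 by (subst bij_betw_cong[of _ _ T]) auto
  then have "T(c := 0) \<in> tableaux (D - {c})"
    using assms(3) by (auto simp: tableaux_def)
  then show ?thesis using that[of c] c right below ij by (simp add: corners_def)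
qed

lemma tableaux_insert:
  assumes "finite D" "c \<in> corners D" "T \<in> tableaux (D - {c})"
  shows "T(c := card D) \<in> tableaux D"
proof -
  obtain i j where ij: "c = (i, j)" by fastforce
  have cD: "c \<in> D" and right: "(i, Suc j) \<notin> D" and below: "(Suc i, j) \<notin> D"
    using assms(2) ij by (auto simp: corners_def)
  have bij: "bij_betw T (D - {c}) {1..card (D - {c})}" using assms(3) by (simp add: tableaux_def)
  have card: "card (D - {c}) = card D - 1" "card D > 0"
    using assms(1) cD by (auto simp: card_gt_0_iff)
  have lt: "T x < card D" if "x \<in> D" "x \<noteq> c" for x
    using bij_betw_apply[OF bij, of x] that card by auto
  have "bij_betw (T(c := card D)) (D - {c}) {1..card D - 1}"
    using bij unfolding card by (subst bij_betw_cong[of _ _ T]) auto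
  then have "bij_betw (T(c := card D)) ((D - {c}) \<union> {c}) ({1..card D - 1} \<union> {card D})"
    by (rule bij_betw_combine) (use card in auto)
  moreover have "(D - {c}) \<union> {c} = D" using cD by auto
  moreover have "{1..card D - 1} \<union> {card D} = {1..card D}" using card by auto
  ultimately have b: "bij_betw (T(c := card D)) D {1..card D}" by simp
  note T = tableauxD(2,3,4)[OF assms(3)]
  have r: "(T(c := card D)) (k, l) < (T(c := card D)) (k, Suc l)"
    if "(k, l) \<in> D" "(k, Suc l) \<in> D" for k l
  proof -
    have "(k, l) \<noteq> c" using that right ij by auto
    then show ?thesis using that T(2)[of k l] lt[of "(k, l)"] by auto
  qed
  have d: "(T(c := card D)) (k, l) < (T(c := card D)) (Suc k, l)"
    if "(k, l) \<in> D" "(Suc k, l) \<in> D" for k l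
  proof -
    have "(k, l) \<noteq> c" using that below ij by auto
    then show ?thesis using that T(3)[of k l] lt[of "(k, l)"] by auto
  qed
  show ?thesis
    unfolding tableaux_def using b r d T(1) cD by auto
qed

text \<open>Branching rule: the largest entry sits in a corner, and for each corner deleting it is a
  bijection onto the tableaux of the smaller set.\<close>

lemma card_tableaux_rec:
  assumes "finite D" "D \<noteq> {}"
  shows "card (tableaux D) = (\<Sum>c\<in>corners D. card (tableaux (D - {c})))"
proof -
  let ?I = "\<lambda>c. (\<lambda>T. T(c := card D)) ` tableaux (D - {c})"
  have finC: "finite (corners D)"
    by (rule finite_subset[OF _ assms(1)]) (auto simp: corners_def)
  have pos: "card D > 0" using assms by (simp add: card_gt_0_iff)
  have "tableaux D = (\<Union>c\<in>corners D. ?I c)"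
  proof
    show "tableaux D \<subseteq> (\<Union>c\<in>corners D. ?I c)"
    proof
      fix T assume "T \<in> tableaux D"
      then obtain c where c: "c \<in> corners D" "T c = card D" "T(c := 0) \<in> tableaux (D - {c})"
        using tableaux_remove assms by blast
      have "T = (T(c := 0))(c := card D)" using c(2) by (auto simp: fun_eq_iff)
      then show "T \<in> (\<Union>c\<in>corners D. ?I c)" using c by blast
    qed
    show "(\<Union>c\<in>corners D. ?I c) \<subseteq> tableaux D"
      using tableaux_insert[OF assms(1)] by blast
  qed
  also have "card \<dots> = (\<Sum>c\<in>corners D. card (?I c))"
  proof (rule card_UN_disjoint[OF finC])
    show "\<forall>i\<in>corners D. finite (?I i)" using finite_tableaux assms by auto
    show "\<forall>i\<in>corners D. \<forall>j\<in>corners D. i \<noteq> j \<longrightarrow> ?I i \<inter> ?I j = {}"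
    proof (intro ballI impI)
      fix c c' assume cc: "c \<in> corners D" "c' \<in> corners D" "c \<noteq> c'"
      show "?I c \<inter> ?I c' = {}"
      proof (rule ccontr)
        assume "?I c \<inter> ?I c' \<noteq> {}"
        then obtain T T' where T: "T \<in> tableaux (D - {c})" "T' \<in> tableaux (D - {c'})"
          "T(c := card D) = T'(c' := card D)" by auto
        then have "T' c = card D" using cc(3) by (metis fun_upd_apply)
        moreover have "c \<in> D - {c'}" using cc by (auto simp: corners_def)
        then have "T' c \<in> {1..card (D - {c'})}"
          using T(2) by (auto simp: tableaux_def dest: bij_betw_apply)
        moreover have "card (D - {c'}) = card D - 1"
          using cc assms by (auto simp: corners_def)
        ultimately show False using pos by simp
      qed
    qed
  qed
  also have "\<dots> = (\<Sum>c\<in>corners D. card (tableaux (D - {c})))"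
  proof (rule sum.cong[OF refl], rule card_image, rule inj_onI)
    fix c T T' assume T: "T \<in> tableaux (D - {c})" "T' \<in> tableaux (D - {c})"
      "T(c := card D) = T'(c := card D)"
    show "T = T'"
    proof
      fix x show "T x = T' x"
        using fun_cong[OF T(3), of x] tableauxD(2)[OF T(1)] tableauxD(2)[OF T(2)]
        by (cases "x = c") (metis Diff_iff singletonI, metis fun_upd_apply)
    qed
  qed
  finally show ?thesis .
qed

lemma tableaux_empty: "card (tableaux {}) = 1"
proof -
  have "tableaux {} = {\<lambda>_. 0}"
    by (auto simp: tableaux_def bij_betw_def fun_eq_iff)
  then show ?thesis by simp
qed

text \<open>A diagram given by its column lengths. With columns rather than rows, a bound on the
  first part becomes the size m of the determinant.\<close>

definition colshape :: "nat \<Rightarrow> (nat \<Rightarrow> nat) \<Rightarrow> (nat \<times> nat) set" where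
  "colshape m c = {(i, j). j < m \<and> i < c j}"

lemma finite_colshape: "finite (colshape m c)"
  and card_colshape: "card (colshape m c) = (\<Sum>j<m. c j)"
proof -
  have *: "colshape m c = prod.swap ` (SIGMA j:{..<m}. {..<c j})"
    by (auto simp: colshape_def image_iff)
  show "finite (colshape m c)" unfolding * by auto
  show "card (colshape m c) = (\<Sum>j<m. c j)"
    unfolding * by (subst card_image) (auto simp: inj_on_def)
qed

text \<open>Lowering the \<open>j\<close>-th row multiplies the term of a permutation \<open>p\<close> by \<open>a j + p j\<close>, and the sum of
  these factors does not depend on \<open>p\<close>.\<close>

lemma ldet_Ez_derivation:
  fixes a :: "nat \<Rightarrow> int"
  shows "(\<Sum>j<m. ldet m (\<lambda>i k. Ez 1 (a i - (if i = j then 1 else 0) + int k))) =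
    of_int (\<Sum>i<m. a i + int i) * ldet m (\<lambda>i k. Ez 1 (a i + int k))"
proof -
  have "(\<Sum>j<m. \<Prod>i<m. Ez 1 (a i - (if i = j then 1 else 0) + int (p i))) =
      of_int (\<Sum>i<m. a i + int i) * (\<Prod>i<m. Ez 1 (a i + int (p i)))"
    if p: "p permutes {..<m}" for p
  proof -
    have "(\<Prod>i<m. Ez 1 (a i - (if i = j then 1 else 0) + int (p i))) =
        of_int (a j + int (p j)) * (\<Prod>i<m. Ez 1 (a i + int (p i)))" if j: "j < m" for j
    proof -
      have "(\<Prod>i<m. Ez 1 (a i - (if i = j then 1 else 0) + int (p i))) =
          Ez 1 (a j - 1 + int (p j)) * (\<Prod>i\<in>{..<m} - {j}. Ez 1 (a i + int (p i)))"
        by (subst prod.remove[of _ j]) (use j in \<open>auto intro!: prod.cong\<close>)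
      also have "Ez 1 (a j - 1 + int (p j)) = of_int (a j + int (p j)) * Ez 1 (a j + int (p j))"
        using Ez_rec[of "a j + int (p j)" 1] by (simp add: algebra_simps)
      also have "\<dots> * (\<Prod>i\<in>{..<m} - {j}. Ez 1 (a i + int (p i))) =
          of_int (a j + int (p j)) * (\<Prod>i<m. Ez 1 (a i + int (p i)))"
        using j by (subst (2) prod.remove[of _ j]) auto
      finally show ?thesis .
    qed
    then have "(\<Sum>j<m. \<Prod>i<m. Ez 1 (a i - (if i = j then 1 else 0) + int (p i))) =
        of_int (\<Sum>j<m. a j + int (p j)) * (\<Prod>i<m. Ez 1 (a i + int (p i)))"
      by (simp add: sum_distrib_right)
    also have "(\<Sum>j<m. a j + int (p j)) = (\<Sum>j<m. a j + int j)"
      using sum.permute[OF p, of int] by (simp add: sum.distrib o_def)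
    finally show ?thesis .
  qed
  then have *: "(\<Sum>j<m. c * (\<Prod>i<m. Ez 1 (a i - (if i = j then 1 else 0) + int (p i)))) =
      of_int (\<Sum>i<m. a i + int i) * (c * (\<Prod>i<m. Ez 1 (a i + int (p i))))"
    if "p permutes {..<m}" for p c
    using that by (simp only: sum_distrib_left[symmetric]) (simp only: mult.left_commute)
  show ?thesis
    unfolding ldet_def
    by (subst sum.swap, subst sum_distrib_left, rule sum.cong[OF refl]) (rule *, simp)
qed

text \<open>Whatever the permutation, the exponents of t in its term add up to the same number; a
  term with a negative exponent vanishes for every t.\<close>

lemma ldet_Ez_homogeneous:
  fixes a :: "nat \<Rightarrow> int"
  shows "ldet m (\<lambda>i k. Ez t (a i + int k)) =
    t ^ nat (\<Sum>i<m. a i + int i) * ldet m (\<lambda>i k. Ez 1 (a i + int k))"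
proof -
  have "(\<Prod>i<m. Ez t (a i + int (p i))) =
      t ^ nat (\<Sum>i<m. a i + int i) * (\<Prod>i<m. Ez 1 (a i + int (p i)))"
    if p: "p permutes {..<m}" for p
  proof (cases "\<exists>i<m. a i + int (p i) < 0")
    case True
    then obtain i where i: "i < m" "a i + int (p i) < 0" by blast
    have "(\<Prod>i<m. Ez s (a i + int (p i))) = 0" for s
      by (rule prod_zero) (use i in \<open>auto simp: Ez_def intro!: bexI[of _ i]\<close>)
    from this[of t] this[of 1] show ?thesis by (simp del: prod_zero_iff)
  next
    case False
    have "(\<Prod>i<m. Ez t (a i + int (p i))) =
        (\<Prod>i<m. t ^ nat (a i + int (p i)) * Ez 1 (a i + int (p i)))"
      by (rule prod.cong) (use False in \<open>auto simp: Ez_def\<close>)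
    also have "\<dots> = t ^ (\<Sum>i<m. nat (a i + int (p i))) * (\<Prod>i<m. Ez 1 (a i + int (p i)))"
      by (simp add: prod.distrib power_sum)
    also have "(\<Sum>i<m. nat (a i + int (p i))) = nat (\<Sum>i<m. a i + int (p i))"
    proof -
      have "int (\<Sum>i<m. nat (a i + int (p i))) = (\<Sum>i<m. a i + int (p i))"
        unfolding of_nat_sum by (rule sum.cong) (use False in auto)
      then show ?thesis by linarith
    qed
    also have "(\<Sum>i<m. a i + int (p i)) = (\<Sum>i<m. a i + int i)"
      using sum.permute[OF p, of int] by (simp add: sum.distrib o_def)
    finally show ?thesis .
  qed
  then show ?thesis
    by (simp add: ldet_def sum_distrib_left mult.left_commute)
qed

lemma corners_colshape:
  assumes "\<And>i j. i \<le> j \<Longrightarrow> j < m \<Longrightarrow> c j \<le> c i"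
  shows "corners (colshape m c) =
    (\<lambda>j. (c j - 1, j)) ` {j. j < m \<and> 0 < c j \<and> (Suc j < m \<longrightarrow> c (Suc j) < c j)}"
  using assms by (fastforce simp: corners_def colshape_def image_iff)

lemma colshape_remove:
  assumes "j < m" "0 < c j"
  shows "colshape m c - {(c j - 1, j)} = colshape m (c(j := c j - 1))"
  using assms by (auto simp: colshape_def)

text \<open>Aitken's formula. By \<open>ldet_Ez_derivation\<close> the determinants satisfy the
  branching rule of the tableaux, with a sum over all columns in place of the sum over
  corners.\<close>

lemma card_tableaux_colshape:
  assumes "\<And>i j. i \<le> j \<Longrightarrow> j < m \<Longrightarrow> c j \<le> c i"
  shows "real (card (tableaux (colshape m c))) =
    fact (\<Sum>j<m. c j) * ldet m (\<lambda>i k. Ez 1 (int (c i) - int i + int k))"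
  using assms
proof (induction "\<Sum>j<m. c j" arbitrary: c)
  case 0
  then have z: "\<And>j. j < m \<Longrightarrow> c j = 0" by simp
  then have "colshape m c = {}" by (auto simp: colshape_def)
  moreover have "ldet m (\<lambda>i k. Ez 1 (int (c i) - int i + int k)) = (\<Prod>i<m. 1)"
    by (subst ldet_upper_triangular) (auto simp: z Ez_def)
  ultimately show ?case using 0(1)[symmetric] by (simp add: tableaux_empty)
next
  case (Suc n)
  let ?C = "{j. j < m \<and> 0 < c j \<and> (Suc j < m \<longrightarrow> c (Suc j) < c j)}"
  let ?a = "\<lambda>i. int (c i) - int i"
  let ?g = "\<lambda>j. ldet m (\<lambda>i k. Ez 1 (?a i - (if i = j then 1 else 0) + int k))"
  have card: "card (colshape m c) = Suc n" using Suc.hyps(2) by (simp add: card_colshape)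
  have inj: "inj_on (\<lambda>j. (c j - 1, j)) ?C" by (auto simp: inj_on_def)
  have card_eq: "card (tableaux (colshape m c)) = (\<Sum>j\<in>?C. card (tableaux (colshape m c - {(c j - 1, j)})))"
    by (subst card_tableaux_rec)
       (use card in \<open>auto simp: finite_colshape corners_colshape[OF Suc.prems] sum.reindex[OF inj, unfolded One_nat_def]\<close>)
  have "real (card (tableaux (colshape m c))) = (\<Sum>j\<in>?C. fact n * ?g j)"
    unfolding card_eq of_nat_sum
  proof (rule sum.cong[OF refl])
    fix j assume j: "j \<in> ?C"
    let ?c = "c(j := c j - 1)"
    have s: "n = (\<Sum>i<m. ?c i)"
    proof -
      have "(\<Sum>i<m. c i) = c j + (\<Sum>i\<in>{..<m} - {j}. c i)"
        by (rule sum.remove) (use j in auto)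
      moreover have "(\<Sum>i<m. ?c i) = ?c j + (\<Sum>i\<in>{..<m} - {j}. ?c i)"
        by (rule sum.remove) (use j in auto)
      moreover have "(\<Sum>i\<in>{..<m} - {j}. ?c i) = (\<Sum>i\<in>{..<m} - {j}. c i)"
        by (rule sum.cong) auto
      ultimately show ?thesis using Suc.hyps(2) j by simp
    qed
    have anti: "?c l \<le> ?c i" if "i \<le> l" "l < m" for i l
    proof (cases "i = j \<and> l \<noteq> j")
      case True
      then have "c l \<le> c (Suc j)" using Suc.prems[of "Suc j" l] that by auto
      also have "c (Suc j) < c j" using True that j by auto
      finally show ?thesis using True by auto
    next
      case False
      then show ?thesis using Suc.prems[OF that] by (auto simp: le_diff_conv)
    qed
    have "real (card (tableaux (colshape m c - {(c j - 1, j)}))) = real (card (tableaux (colshape m ?c)))"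
      using colshape_remove[of j m c] j by simp
    also have "\<dots> = fact (\<Sum>i<m. ?c i) * ldet m (\<lambda>i k. Ez 1 (int (?c i) - int i + int k))"
      by (rule Suc.hyps(1)[OF s anti])
    also have "ldet m (\<lambda>i k. Ez 1 (int (?c i) - int i + int k)) = ?g j"
      by (rule ldet_cong) (use j in \<open>auto simp: of_nat_diff algebra_simps\<close>)
    finally show "real (card (tableaux (colshape m c - {(c j - 1, j)}))) = fact n * ?g j"
      using s by simp
  qed
  \<comment> \<open>Columns that end in no corner contribute 0: shortening one that is as long as
    its right neighbour makes two rows equal, and lowering the last column when it is empty makes
    its row vanish.\<close>
  also have "\<dots> = (\<Sum>j<m. fact n * ?g j)"
  proof (rule sum.mono_neutral_left)
    show "\<forall>j\<in>{..<m} - ?C. fact n * ?g j = 0"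
    proof
      fix j assume j: "j \<in> {..<m} - ?C"
      have "?g j = 0"
      proof (cases "Suc j < m")
        case True
        then have "c (Suc j) = c j"
          using j Suc.prems[of j "Suc j"] by auto
        then show ?thesis
          by (intro ldet_identical_rows[of j "Suc j"]) (use True in \<open>auto simp: algebra_simps\<close>)
      next
        case False
        then have jm: "m = Suc j" and c0: "c j = 0" using j by auto
        \<comment> \<open>The zero row is presented as an empty sum, so that
          \<open>ldet_row_sum\<close> evaluates the determinant.\<close>
        have "ldet m ((\<lambda>i k. Ez 1 (?a i - (if i = j then 1 else 0) + int k))(j := \<lambda>k. \<Sum>i\<in>{}. 0 * 0)) = (\<Sum>i\<in>({}::nat set). 0 * 0)"
          using ldet_row_sum[of j m "{}::nat set" "\<lambda>i k. Ez 1 (?a i - (if i = j then 1 else 0) + int k)"]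
          by (simp add: jm)
        moreover have "?g j = ldet m ((\<lambda>i k. Ez 1 (?a i - (if i = j then 1 else 0) + int k))(j := \<lambda>k. \<Sum>i\<in>({}::nat set). 0 * 0))"
          by (rule ldet_cong) (auto simp: jm c0 Ez_def)
        ultimately show ?thesis by simp
      qed
      then show "fact n * ?g j = 0" by simp
    qed
  qed auto
  also have "\<dots> = fact n * (of_int (\<Sum>i<m. ?a i + int i) * ldet m (\<lambda>i k. Ez 1 (?a i + int k)))"
    by (simp only: sum_distrib_left[symmetric] ldet_Ez_derivation)
  also have "(\<Sum>i<m. ?a i + int i) = int (Suc n)"
    unfolding Suc.hyps(2) by simp
  finally show ?case unfolding Suc.hyps(2)[symmetric] by (simp add: algebra_simps)
qed

section \<open>Partitions, their conjugates and the diagonal\<close>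

lemma downclosed_eq_lessThan:
  fixes S :: "nat set"
  assumes "finite S" "\<And>x y. x \<in> S \<Longrightarrow> y < x \<Longrightarrow> y \<in> S"
  shows "S = {..<card S}"
proof (cases "S = {}")
  case False
  have "S = {..<Suc (Max S)}"
  proof
    show "S \<subseteq> {..<Suc (Max S)}" using assms(1) by (auto simp: less_Suc_eq_le)
    show "{..<Suc (Max S)} \<subseteq> S"
      using assms(2)[OF Max_in[OF assms(1) False]] Max_in[OF assms(1) False]
      by (auto simp: less_Suc_eq)
  qed
  then show ?thesis by (metis card_lessThan)
qed simp

lemma partition_nth_mono:
  assumes "is_partition lam" "i \<le> j" "j < length lam"
  shows "lam ! j \<le> lam ! i"
  using assms by (cases "i = j") (auto simp: is_partition_def sorted_wrt_iff_nth_less)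

text \<open>Parts decrease, so the row indices counted by \<open>conj_part\<close> form an initial
  segment; the count thus becomes a membership test.\<close>

lemma less_conj_part_iff:
  assumes "is_partition lam"
  shows "i < conj_part lam j \<longleftrightarrow> i < length lam \<and> j < lam ! i"
proof -
  have "{i. i < length lam \<and> j < lam ! i} = {..<card {i. i < length lam \<and> j < lam ! i}}"
  proof (rule downclosed_eq_lessThan)
    fix x y assume "x \<in> {i. i < length lam \<and> j < lam ! i}" "y < x"
    then show "y \<in> {i. i < length lam \<and> j < lam ! i}"
      using partition_nth_mono[OF assms, of y x] by auto
  qed simp
  then show ?thesis by (auto simp: conj_part_def)
qed

lemma less_durfee_iff:
  assumes "is_partition lam"
  shows "i < durfee lam \<longleftrightarrow> i < length lam \<and> i < lam ! i"
proof -
  have "{i. i < length lam \<and> i < lam ! i} = {..<card {i. i < length lam \<and> i < lam ! i}}"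
  proof (rule downclosed_eq_lessThan)
    fix x y assume "x \<in> {i. i < length lam \<and> i < lam ! i}" "y < x"
    then show "y \<in> {i. i < length lam \<and> i < lam ! i}"
      using partition_nth_mono[OF assms, of y x] by auto
  qed simp
  then show ?thesis by (auto simp: durfee_def)
qed

lemma conj_part_antimono:
  assumes "i \<le> j"
  shows "conj_part lam j \<le> conj_part lam i"
  unfolding conj_part_def by (rule card_mono) (use assms in auto)

lemma partition_nth_le_largest:
  assumes "is_partition lam" "i < length lam"
  shows "lam ! i \<le> largest_part lam"
  using partition_nth_mono[OF assms(1), of 0 i] assms(2) by (auto simp: largest_part_def hd_conv_nth)

lemma cells_eq_colshape:
  assumes "is_partition lam" "largest_part lam \<le> m"
  shows "cells lam = colshape m (conj_part lam)"
  using partition_nth_le_largest[OF assms(1)] assms(2)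
  by (fastforce simp: cells_def colshape_def less_conj_part_iff[OF assms(1)])

lemma card_cells: "card (cells lam) = psize lam"
proof -
  have "cells lam = (SIGMA i:{..<length lam}. {..<lam ! i})"
    by (auto simp: cells_def)
  then show ?thesis
    by (simp add: psize_def sum_list_sum_nth lessThan_atLeast0)
qed

lemma syt_eq_tableaux:
  assumes "is_partition lam"
  shows "syt lam = tableaux (cells lam)"
proof -
  have 1: "(i, j) \<in> cells lam" if "(i, Suc j) \<in> cells lam" for i j
    using that by (auto simp: cells_def)
  have 2: "(i, j) \<in> cells lam" if "(Suc i, j) \<in> cells lam" for i j
    using that partition_nth_mono[OF assms, of i "Suc i"] by (auto simp: cells_def)
  show ?thesis
    unfolding syt_def tableaux_def card_cells using 1 2 by blast
qed

text \<open>Strictly decreasing numbers: the beta-numbers of the conjugate partition up to a shift.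
  An empty column i contributes - i.\<close>

definition colseq :: "nat list \<Rightarrow> nat \<Rightarrow> int list" where
  "colseq lam m = map (\<lambda>i. int (conj_part lam i) - int i) [0..<m]"

text \<open>The size m may be any bound on the first part, so partitions with different first parts
  are all represented by determinants of one size.\<close>

lemma dimp_weight_eq_ldet:
  assumes "is_partition lam" "largest_part lam \<le> m"
  shows "t ^ psize lam * real (dimp lam) / fact (psize lam) =
    ldet m (\<lambda>i k. Ez t (colseq lam m ! i + int k))"
proof -
  let ?a = "\<lambda>i. int (conj_part lam i) - int i"
  have ps: "psize lam = (\<Sum>j<m. conj_part lam j)"
    by (simp add: card_cells[symmetric] cells_eq_colshape[OF assms] card_colshape)
  have "real (dimp lam) = fact (psize lam) * ldet m (\<lambda>i k. Ez 1 (?a i + int k))"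
    unfolding dimp_def syt_eq_tableaux[OF assms(1)] cells_eq_colshape[OF assms] ps
    by (rule card_tableaux_colshape) (rule conj_part_antimono)
  moreover have "ldet m (\<lambda>i k. Ez t (?a i + int k)) =
      t ^ psize lam * ldet m (\<lambda>i k. Ez 1 (?a i + int k))"
  proof -
    have "(\<Sum>i<m. ?a i + int i) = int (psize lam)" unfolding ps by simp
    then have "nat (\<Sum>i<m. ?a i + int i) = psize lam" by (simp only: nat_int)
    then show ?thesis using ldet_Ez_homogeneous[of m t ?a] by simp
  qed
  moreover have "ldet m (\<lambda>i k. Ez t (colseq lam m ! i + int k)) = ldet m (\<lambda>i k. Ez t (?a i + int k))"
    by (rule ldet_cong) (simp add: colseq_def)
  ultimately show ?thesis by simp
qed

section \<open>Partitions with prescribed Frobenius coordinates\<close>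

text \<open>Adds a new first row of length \<open>m\<close> and a new first column with \<open>r\<close> cells below it.\<close>

definition hooked :: "nat \<Rightarrow> nat \<Rightarrow> nat list \<Rightarrow> nat list" where
  "hooked m r lam = m # map Suc lam @ replicate (r - length lam) 1"

text \<open>\<open>setA\<close> and \<open>setB\<close> are the cases e = 1 and e = -1. The equation
  is stated in the integers since e may be negative.\<close>

definition frob_set :: "int \<Rightarrow> nat list set" where
  "frob_set e = {lam. is_partition lam \<and>
     (\<forall>i<durfee lam. int (frob_q lam i) = int (frob_p lam i) + e)}"

lemma setA_eq: "setA = frob_set 1"
  by (auto simp: setA_def frob_set_def)

lemma setB_eq: "setB = frob_set (- 1)"
  by (auto simp: setB_def frob_set_def)

definition frob_upto :: "int \<Rightarrow> nat \<Rightarrow> nat list set" where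
  "frob_upto e m = {lam \<in> frob_set e. largest_part lam \<le> m}"

lemma is_partition_Nil [simp]: "is_partition []"
  by (simp add: is_partition_def)

lemma largest_part_eq_0_iff:
  assumes "is_partition lam"
  shows "largest_part lam = 0 \<longleftrightarrow> lam = []"
  using assms by (cases lam) (auto simp: largest_part_def is_partition_def)

lemma frob_upto_0: "frob_upto e 0 = {[]}"
proof -
  have "[] \<in> frob_set e" by (simp add: frob_set_def durfee_def)
  moreover have "lam = []" if "lam \<in> frob_set e" "largest_part lam = 0" for lam
    using that largest_part_eq_0_iff[of lam] by (simp add: frob_set_def)
  ultimately show ?thesis by (auto simp: frob_upto_def largest_part_def)
qed

lemma length_hooked: "length lam \<le> r \<Longrightarrow> length (hooked m r lam) = Suc r"
  by (simp add: hooked_def)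

lemma hooked_nth_0: "hooked m r lam ! 0 = m"
  by (simp add: hooked_def)

lemma hooked_nth_Suc:
  "length lam \<le> r \<Longrightarrow> i < r \<Longrightarrow> hooked m r lam ! Suc i = (if i < length lam then Suc (lam ! i) else 1)"
  by (simp add: hooked_def nth_append)

lemma largest_part_hooked: "largest_part (hooked m r lam) = m"
  by (simp add: largest_part_def hooked_def)

lemma is_partition_hooked:
  assumes "is_partition lam" "largest_part lam < m"
  shows "is_partition (hooked m r lam)"
proof -
  have le: "Suc x \<le> m" if "x \<in> set lam" for x
    using that partition_nth_le_largest[OF assms(1)] assms(2)
    by (fastforce simp: in_set_conv_nth)
  have "sorted_wrt (\<ge>) (map Suc lam)"
    using assms(1) by (simp add: is_partition_def sorted_wrt_map)
  moreover have "sorted_wrt (\<ge>) (replicate k (1::nat))" for k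
    by (induction k) auto
  ultimately show ?thesis
    using assms le by (fastforce simp: is_partition_def hooked_def sorted_wrt_append)
qed

lemma Collect_less_Suc_split:
  "{i. i < Suc r \<and> P i} = (if P 0 then {0} else {}) \<union> Suc ` {i. i < r \<and> P (Suc i)}"
  by (auto simp: image_iff less_Suc_eq_0_disj)

lemma card_Collect_less_Suc:
  "card {i. i < Suc r \<and> P i} = (if P 0 then 1 else 0) + card {i. i < r \<and> P (Suc i)}"
  unfolding Collect_less_Suc_split
  by (subst card_Un_disjoint) (auto simp: card_image)

lemma durfee_hooked:
  assumes "length lam \<le> r" "0 < m"
  shows "durfee (hooked m r lam) = Suc (durfee lam)"
proof -
  have "{i. i < r \<and> Suc i < hooked m r lam ! Suc i} = {i. i < length lam \<and> i < lam ! i}"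
    using assms by (auto simp: hooked_nth_Suc split: if_splits)
  then show ?thesis
    using assms by (simp add: durfee_def length_hooked card_Collect_less_Suc hooked_nth_0)
qed

lemma conj_part_hooked_0:
  assumes "length lam \<le> r" "0 < m"
  shows "conj_part (hooked m r lam) 0 = Suc r"
proof -
  have "{i. i < r \<and> 0 < hooked m r lam ! Suc i} = {..<r}"
    using assms by (auto simp: hooked_nth_Suc)
  then show ?thesis
    using assms by (simp add: conj_part_def length_hooked card_Collect_less_Suc hooked_nth_0)
qed

lemma conj_part_hooked_Suc:
  assumes "length lam \<le> r" "Suc j < m"
  shows "conj_part (hooked m r lam) (Suc j) = Suc (conj_part lam j)"
proof -
  have "{i. i < r \<and> Suc j < hooked m r lam ! Suc i} = {i. i < length lam \<and> j < lam ! i}"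
    using assms by (auto simp: hooked_nth_Suc split: if_splits)
  then show ?thesis
    using assms by (simp add: conj_part_def length_hooked card_Collect_less_Suc hooked_nth_0)
qed

text \<open>The new row and column surround \<open>lam\<close>: every old diagonal cell keeps its
  arm and leg one step further down the diagonal, and the new corner cell has arm m - 1 and leg
  r.\<close>

lemma frob_hooked:
  assumes "is_partition lam" "length lam \<le> r" "largest_part lam < m"
  shows "frob_p (hooked m r lam) 0 = m - 1" "frob_q (hooked m r lam) 0 = r"
    "\<And>i. i < durfee lam \<Longrightarrow> frob_p (hooked m r lam) (Suc i) = frob_p lam i"
    "\<And>i. i < durfee lam \<Longrightarrow> frob_q (hooked m r lam) (Suc i) = frob_q lam i"
proof -
  have m: "0 < m" using assms by simp
  show "frob_p (hooked m r lam) 0 = m - 1" "frob_q (hooked m r lam) 0 = r"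
    using assms m by (simp_all add: frob_p_def frob_q_def conj_part_hooked_0 hooked_nth_0)
  fix i assume "i < durfee lam"
  then have i: "i < length lam" "i < lam ! i"
    using less_durfee_iff[OF assms(1)] by auto
  then have "Suc i < m"
    using partition_nth_le_largest[OF assms(1) i(1)] assms(3) by simp
  then show "frob_p (hooked m r lam) (Suc i) = frob_p lam i"
    "frob_q (hooked m r lam) (Suc i) = frob_q lam i"
    using i assms(2)
    by (simp_all add: frob_p_def frob_q_def hooked_nth_Suc conj_part_hooked_Suc)
qed

lemma hooked_in_frob_set_iff:
  assumes "is_partition lam" "length lam \<le> r" "largest_part lam < m" "int r = int m - 1 + e"
  shows "hooked m r lam \<in> frob_set e \<longleftrightarrow> lam \<in> frob_set e"
proof -
  have d: "durfee (hooked m r lam) = Suc (durfee lam)"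
    using durfee_hooked assms by auto
  have "(\<forall>i<durfee (hooked m r lam). int (frob_q (hooked m r lam) i) = int (frob_p (hooked m r lam) i) + e)
      \<longleftrightarrow> (\<forall>i<durfee lam. int (frob_q lam i) = int (frob_p lam i) + e)"
    unfolding d All_less_Suc2 using frob_hooked[OF assms(1-3)] assms(3,4)
    by (auto simp: of_nat_diff)
  then show ?thesis
    using is_partition_hooked[OF assms(1,3)] assms(1) by (simp add: frob_set_def)
qed

lemma conj_part_0: "is_partition lam \<Longrightarrow> conj_part lam 0 = length lam"
proof -
  assume p: "is_partition lam"
  have "0 < lam ! i" if "i < length lam" for i
    using nth_mem[OF that] p by (metis is_partition_def neq0_conv)
  then have "{i. i < length lam \<and> 0 < lam ! i} = {..<length lam}"
    by auto
  then show ?thesis by (simp add: conj_part_def)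
qed

text \<open>The first pair of Frobenius coordinates is (first part - 1 | length - 1). So within one
  family the leg of the outer hook is determined by its arm.\<close>

lemma frob_set_length:
  assumes "lam \<in> frob_set e" "lam \<noteq> []"
  shows "int (length lam) = int (largest_part lam) + e" "int (length lam) \<ge> 1"
proof -
  have p: "is_partition lam" using assms by (simp add: frob_set_def)
  have l: "0 < largest_part lam" using assms(2) largest_part_eq_0_iff[OF p] by simp
  have l0: "lam ! 0 = largest_part lam"
    using assms(2) by (simp add: largest_part_def hd_conv_nth)
  have "0 < durfee lam"
    using assms(2) l l0 by (simp add: less_durfee_iff[OF p])
  then have "int (frob_q lam 0) = int (frob_p lam 0) + e"
    using assms(1) by (simp add: frob_set_def)
  moreover have "0 < length lam" using assms(2) by simp
  ultimately show "int (length lam) = int (largest_part lam) + e"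
    using l l0 by (auto simp: frob_p_def frob_q_def conj_part_0[OF p] of_nat_diff Suc_le_eq)
  show "int (length lam) \<ge> 1" using assms(2) by (simp add: Suc_le_eq)
qed

text \<open>The ones of a decreasing list stand at its end; once the first row is gone they are the
  rows that lie entirely in the first column.\<close>

lemma partition_strip_ones:
  assumes "sorted_wrt (\<ge>) mu" "0 \<notin> set mu"
  shows "mu = map Suc (map (\<lambda>x. x - 1) (filter (\<lambda>x. 1 < x) mu)) @
    replicate (length mu - length (filter (\<lambda>x. 1 < x) mu)) (1::nat)"
  using assms
proof (induction mu)
  case (Cons a mu)
  show ?case
  proof (cases "1 < a")
    case True
    then show ?thesis using Cons by auto
  next
    case False
    then have a: "a = 1" "\<forall>x\<in>set mu. x = 1" using Cons.prems by (auto intro: le_antisym simp: Suc_le_eq) (metis One_nat_def Suc_lessI le_antisym not_less_eq_eq neq0_conv le_neq_implies_less less_one)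
    then have "filter (\<lambda>x. 1 < x) mu = []" by (auto simp: filter_empty_conv)
    moreover have "mu = replicate (length mu) 1" using a(2) by (simp add: replicate_length_same)
    ultimately show ?thesis using a(1) by simp
  qed
qed simp

lemma obtain_hooked:
  assumes "lam \<in> frob_set e" "largest_part lam = m" "0 < m"
  obtains r mu where "int r = int m - 1 + e" "is_partition mu" "length mu \<le> r" "largest_part mu < m"
    "lam = hooked m r mu"
proof -
  have p: "is_partition lam" using assms by (simp add: frob_set_def)
  have ne: "lam \<noteq> []" using assms by (auto simp: largest_part_def)
  then obtain nu where lam: "lam = m # nu"
    using assms(2) by (cases lam) (auto simp: largest_part_def)
  define mu where "mu = map (\<lambda>x. x - 1) (filter (\<lambda>x. 1 < x) nu)"
  have nu: "sorted_wrt (\<ge>) nu" "0 \<notin> set nu" "\<forall>x\<in>set nu. x \<le> m"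
    using p lam by (auto simp: is_partition_def)
  have "nu = map Suc mu @ replicate (length nu - length mu) 1"
    using partition_strip_ones[OF nu(1,2)] by (simp add: mu_def)
  then have "lam = hooked m (length nu) mu"
    by (simp add: lam hooked_def)
  moreover have "is_partition mu"
  proof -
    have "sorted_wrt (\<ge>) (filter (\<lambda>x. 1 < x) nu)" using nu(1) by (rule sorted_wrt_filter)
    then have "sorted_wrt (\<ge>) mu"
      unfolding mu_def sorted_wrt_map by (rule sorted_wrt_mono_rel[rotated]) auto
    then show ?thesis by (auto simp: is_partition_def mu_def)
  qed
  moreover have "length mu \<le> length nu" by (simp add: mu_def)
  moreover have "largest_part mu < m"
  proof (cases "mu = []")
    case False
    then have "hd mu \<in> set mu" by simp
    then have "hd mu + 1 \<in> set nu" by (auto simp: mu_def)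
    then show ?thesis using nu(3) False by (auto simp: largest_part_def)
  qed (use assms in \<open>simp add: largest_part_def\<close>)
  moreover have "int (length nu) = int m - 1 + e"
    using frob_set_length[OF assms(1) ne] assms(2) lam by simp
  ultimately show ?thesis using that by blast
qed

text \<open>A member whose first part is Suc m is a hook with arm m and leg r = m + e around a
  member with first part at most m, so each step either adds this hook or does not.\<close>

lemma frob_upto_Suc:
  assumes "int r = int m + e"
  shows "frob_upto e (Suc m) = frob_upto e m \<union> hooked (Suc m) r ` frob_upto e m"
    "frob_upto e m \<inter> hooked (Suc m) r ` frob_upto e m = {}"
    "inj_on (hooked (Suc m) r) (frob_upto e m)"
proof -
  have len: "length lam \<le> r" if "lam \<in> frob_upto e m" for lam
  proof (cases "lam = []")
    case False
    then show ?thesis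
      using frob_set_length[of lam e] that assms by (auto simp: frob_upto_def)
  qed simp
  have h: "hooked (Suc m) r lam \<in> frob_set e" if "lam \<in> frob_upto e m" for lam
    using that len[OF that] hooked_in_frob_set_iff[of lam r "Suc m" e] assms
    by (auto simp: frob_upto_def frob_set_def)
  show "frob_upto e (Suc m) = frob_upto e m \<union> hooked (Suc m) r ` frob_upto e m"
  proof
    show "frob_upto e m \<union> hooked (Suc m) r ` frob_upto e m \<subseteq> frob_upto e (Suc m)"
      using h by (auto simp: frob_upto_def largest_part_hooked)
    show "frob_upto e (Suc m) \<subseteq> frob_upto e m \<union> hooked (Suc m) r ` frob_upto e m"
    proof
      fix lam assume lam: "lam \<in> frob_upto e (Suc m)"
      show "lam \<in> frob_upto e m \<union> hooked (Suc m) r ` frob_upto e m"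
      proof (cases "largest_part lam = Suc m")
        case False
        then show ?thesis using lam by (auto simp: frob_upto_def)
      next
        case True
        have "lam \<in> frob_set e" using lam by (simp add: frob_upto_def)
        then obtain r' mu where mu: "int r' = int (Suc m) - 1 + e" "is_partition mu"
          "length mu \<le> r'" "largest_part mu < Suc m" "lam = hooked (Suc m) r' mu"
          using obtain_hooked[OF _ True] by auto
        have [simp]: "r' = r" using mu(1) assms by simp
        have "mu \<in> frob_set e"
          using hooked_in_frob_set_iff[OF mu(2-4,1)] lam mu(5) by (simp add: frob_upto_def)
        then show ?thesis using mu by (auto simp: frob_upto_def)
      qed
    qed
  qed
  show "frob_upto e m \<inter> hooked (Suc m) r ` frob_upto e m = {}"
    by (auto simp: frob_upto_def largest_part_hooked)
  show "inj_on (hooked (Suc m) r) (frob_upto e m)"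
  proof (rule inj_onI)
    fix a b assume ab: "a \<in> frob_upto e m" "b \<in> frob_upto e m"
      "hooked (Suc m) r a = hooked (Suc m) r b"
    \<comment> \<open>Left inverse of hooking: delete the first row, then the first column.\<close>
    have *: "map (\<lambda>x. x - 1) (filter (\<lambda>x. 1 < x) (tl (hooked (Suc m) r l))) = l"
      if "l \<in> frob_upto e m" for l
    proof -
      have "0 \<notin> set l" using that by (simp add: frob_upto_def frob_set_def is_partition_def)
      then have "filter (\<lambda>x. 1 < Suc x) l = l" by (intro filter_True) (metis One_nat_def Suc_less_eq gr0I)
      then show ?thesis by (simp add: hooked_def filter_map o_def)
    qed
    show "a = b" using *[OF ab(1)] *[OF ab(2)] ab(3) by metis
  qed
qed

text \<open>The hook would need a leg of negative length. For e = -1 this happens at m = 0 and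
  accounts for the determinant of B being one step behind.\<close>

lemma frob_upto_Suc_degenerate:
  assumes "int m + e < 0"
  shows "frob_upto e (Suc m) = frob_upto e m"
proof -
  have "largest_part lam \<noteq> Suc m" if lam: "lam \<in> frob_upto e (Suc m)" for lam
  proof
    assume a: "largest_part lam = Suc m"
    then have "lam \<noteq> []" by (auto simp: largest_part_def)
    then show False using frob_set_length[of lam e] lam a assms by (auto simp: frob_upto_def)
  qed
  then show ?thesis by (fastforce simp: frob_upto_def le_Suc_eq)
qed

lemma finite_frob_upto: "finite (frob_upto e m)"
proof (induction m)
  case (Suc m)
  then show ?case
    using frob_upto_Suc(1)[of "nat (int m + e)" m e] frob_upto_Suc_degenerate[of m e]
    by (cases "int m + e < 0") simp_all
qed (simp add: frob_upto_0)

text \<open>Hooking lengthens each old column by one and moves it one place to the right, so its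
  shifted length is unchanged; only the entry of the new first column is put in front.\<close>

lemma colseq_hooked:
  assumes "length lam \<le> r"
  shows "colseq (hooked (Suc m) r lam) (Suc m) = (int r + 1) # colseq lam m"
proof -
  have "[0..<Suc m] = 0 # map Suc [0..<m]"
    by (simp add: map_Suc_upt upt_conv_Cons del: upt_Suc)
  then show ?thesis
    using assms by (simp add: colseq_def conj_part_hooked_0 conj_part_hooked_Suc del: upt_Suc)
qed

lemma colseq_Suc:
  assumes "is_partition lam" "largest_part lam \<le> m"
  shows "colseq lam (Suc m) = colseq lam m @ [- int m]"
proof -
  have "\<not> (0 < length lam \<and> m < lam ! 0)"
    using partition_nth_le_largest[OF assms(1), of 0] assms(2) by auto
  then have "\<not> 0 < conj_part lam m"
    by (simp add: less_conj_part_iff[OF assms(1)])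
  then show ?thesis by (simp add: colseq_def)
qed

section \<open>Summation over a family by multilinearity\<close>

definition frow :: "real \<Rightarrow> int \<Rightarrow> nat \<Rightarrow> real" where
  "frow t y = (\<lambda>j. Ez t (y + int j))"

text \<open>The shifted columns of a partition in \<open>frob_upto e m\<close> are obtained by choosing, for each
  \<open>k < m\<close>, one of \<open>- k\<close> (no hook) and \<open>k + 1 + e\<close> (a hook); \<open>(-1) ^ k\<close> is the sign of moving the
  corresponding row to the front.\<close>

definition Grow :: "int \<Rightarrow> real \<Rightarrow> nat \<Rightarrow> nat \<Rightarrow> real" where
  "Grow e t k = (\<lambda>j. Ez t (int j - int k) +
     (if int k + e < 0 then 0 else (-1) ^ k * Ez t (int k + 1 + e + int j)))"

text \<open>\<open>suf\<close> holds the rows for the indices already decided. The choices of no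
  hook and of a hook for the index m lead to determinants that differ in row m alone, and linearity
  merges them into \<open>Grow e t m\<close>.\<close>

lemma sum_frob_upto_ldet:
  "(\<Sum>lam\<in>frob_upto e m. ldet (m + length suf) (\<lambda>i. (map (frow t) (colseq lam m) @ suf) ! i)) =
    ldet (m + length suf) (\<lambda>i. (map (Grow e t) [0..<m] @ suf) ! i)"
proof (induction m arbitrary: suf)
  case 0
  show ?case by (simp add: frob_upto_0 colseq_def)
next
  case (Suc m)
  let ?n = "Suc m + length suf"
  let ?a = "frow t (- int m)"
  have nonhook: "(\<Sum>lam\<in>frob_upto e m. ldet ?n (\<lambda>i. (map (frow t) (colseq lam (Suc m)) @ suf) ! i)) =
      ldet ?n (\<lambda>i. (map (Grow e t) [0..<m] @ ?a # suf) ! i)"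
  proof -
    have "(\<Sum>lam\<in>frob_upto e m. ldet ?n (\<lambda>i. (map (frow t) (colseq lam (Suc m)) @ suf) ! i)) =
        (\<Sum>lam\<in>frob_upto e m. ldet ?n (\<lambda>i. (map (frow t) (colseq lam m) @ ?a # suf) ! i))"
      by (rule sum.cong) (auto simp: colseq_Suc frob_upto_def frob_set_def)
    then show ?thesis using Suc.IH[of "?a # suf"] by simp
  qed
  show ?case
  proof (cases "int m + e < 0")
    case True
    have "?a = Grow e t m" using True by (simp add: Grow_def frow_def fun_eq_iff algebra_simps)
    then show ?thesis
      using nonhook by (simp add: frob_upto_Suc_degenerate[OF True])
  next
    case False
    define r where "r = nat (int m + e)"
    have r: "int r = int m + e" using False by (simp add: r_def)
    let ?b = "frow t (int r + 1)"
    note F = frob_upto_Suc[OF r]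
    have len: "length lam \<le> r" if "lam \<in> frob_upto e m" for lam
    proof (cases "lam = []")
      case False
      then show ?thesis
        using frob_set_length[of lam e] that r by (auto simp: frob_upto_def)
    qed simp
    let ?L = "\<lambda>x. \<lambda>i. (map (Grow e t) [0..<m] @ x # suf) ! i"
    have hook: "(\<Sum>lam\<in>hooked (Suc m) r ` frob_upto e m.
        ldet ?n (\<lambda>i. (map (frow t) (colseq lam (Suc m)) @ suf) ! i)) = (-1) ^ m * ldet ?n (?L ?b)"
    proof -
      have "(\<Sum>lam\<in>hooked (Suc m) r ` frob_upto e m.
          ldet ?n (\<lambda>i. (map (frow t) (colseq lam (Suc m)) @ suf) ! i)) =
          (\<Sum>lam\<in>frob_upto e m. ldet ?n (\<lambda>i. (?b # map (frow t) (colseq lam m) @ suf) ! i))"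
        unfolding sum.reindex[OF F(3)] by (rule sum.cong) (simp_all add: colseq_hooked len)
      \<comment> \<open>The hook row enters at the front and is moved behind the other m rows, which
        costs the sign (-1)^m.\<close>
      also have "\<dots> = (\<Sum>lam\<in>frob_upto e m.
          (-1) ^ m * ldet ?n (\<lambda>i. (map (frow t) (colseq lam m) @ ?b # suf) ! i))"
      proof (rule sum.cong[OF refl])
        fix lam
        have "length (colseq lam m) = m" by (simp add: colseq_def)
        then show "ldet ?n (\<lambda>i. (?b # map (frow t) (colseq lam m) @ suf) ! i) =
            (-1) ^ m * ldet ?n (\<lambda>i. (map (frow t) (colseq lam m) @ ?b # suf) ! i)"
          using ldet_rotate_list[of "[]" ?b "map (frow t) (colseq lam m)" suf] by simp
      qed
      also have "\<dots> = (-1) ^ m * ldet ?n (?L ?b)"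
        using Suc.IH[of "?b # suf"] by (simp add: sum_distrib_left[symmetric])
      finally show ?thesis .
    qed
    have "(\<Sum>lam\<in>frob_upto e (Suc m). ldet ?n (\<lambda>i. (map (frow t) (colseq lam (Suc m)) @ suf) ! i)) =
        1 * ldet ?n (?L ?a) + (-1) ^ m * ldet ?n (?L ?b)"
      unfolding F(1) using hook nonhook
      by (subst sum.union_disjoint) (use F(2) finite_frob_upto in auto)
    also have "\<dots> = 1 * ldet ?n ((?L ?a)(m := ?a)) + (-1) ^ m * ldet ?n ((?L ?a)(m := ?b))"
      by (intro arg_cong2[where f = "\<lambda>x y. 1 * ldet ?n x + (-1) ^ m * ldet ?n y"])
         (auto simp: fun_eq_iff nth_append)
    also have "\<dots> = ldet ?n ((?L ?a)(m := \<lambda>j. 1 * ?a j + (-1) ^ m * ?b j))"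
      by (rule ldet_row_linear[symmetric]) simp
    also have "(?L ?a)(m := \<lambda>j. 1 * ?a j + (-1) ^ m * ?b j) = ?L (Grow e t m)"
    proof
      fix i
      have "(\<lambda>j. 1 * ?a j + (-1) ^ m * ?b j) = Grow e t m"
        using False r by (auto simp: fun_eq_iff Grow_def frow_def algebra_simps)
      then show "((?L ?a)(m := \<lambda>j. 1 * ?a j + (-1) ^ m * ?b j)) i = ?L (Grow e t m) i"
        by (auto simp: nth_append)
    qed
    finally show ?thesis by simp
  qed
qed

lemma sum_frob_upto_weight:
  "(\<Sum>lam\<in>frob_upto e m. t ^ psize lam * real (dimp lam) / fact (psize lam)) =
    ldet m (\<lambda>k j. Grow e t k j)"
proof -
  have "(\<Sum>lam\<in>frob_upto e m. t ^ psize lam * real (dimp lam) / fact (psize lam)) =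
      (\<Sum>lam\<in>frob_upto e m. ldet (m + length ([] :: (nat \<Rightarrow> real) list)) (\<lambda>i. (map (frow t) (colseq lam m) @ []) ! i))"
  proof (rule sum.cong[OF refl])
    fix lam assume "lam \<in> frob_upto e m"
    then have p: "is_partition lam" "largest_part lam \<le> m"
      by (auto simp: frob_upto_def frob_set_def)
    have "ldet m (\<lambda>i k. Ez t (colseq lam m ! i + int k)) =
        ldet m (\<lambda>i. (map (frow t) (colseq lam m)) ! i)"
      by (rule ldet_cong) (auto simp: frow_def colseq_def)
    then show "t ^ psize lam * real (dimp lam) / fact (psize lam) =
        ldet (m + length ([] :: (nat \<Rightarrow> real) list)) (\<lambda>i. (map (frow t) (colseq lam m) @ []) ! i)"
      using dimp_weight_eq_ldet[OF p] by simp
  qed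
  also have "\<dots> = ldet (m + length ([] :: (nat \<Rightarrow> real) list)) (\<lambda>i. (map (Grow e t) [0..<m] @ []) ! i)"
    by (rule sum_frob_upto_ldet)
  also have "\<dots> = ldet m (\<lambda>k j. Grow e t k j)"
    by simp (rule ldet_cong, simp)
  finally show ?thesis .
qed

section \<open>Bessel coefficients and the inverse of \<open>1 + L\<close>\<close>

text \<open>Coefficient n of the product of two Laurent series. For real terms \<open>infsum\<close>
  is absolute summation, so no order of summation has to be fixed.\<close>

definition conv :: "(int \<Rightarrow> real) \<Rightarrow> (int \<Rightarrow> real) \<Rightarrow> int \<Rightarrow> real" where
  "conv a b n = (\<Sum>\<^sub>\<infinity>k. a k * b (n - k))"

lemma summable_on_abs_iff:
  fixes a :: "'a \<Rightarrow> real"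
  shows "(\<lambda>n. \<bar>a n\<bar>) summable_on A \<longleftrightarrow> a summable_on A"
  using summable_on_iff_abs_summable_on_real[of a A] by simp

lemma summable_on_bounded:
  fixes a :: "'a \<Rightarrow> real"
  assumes "a summable_on A"
  obtains C where "0 \<le> C" "\<And>n. n \<in> A \<Longrightarrow> \<bar>a n\<bar> \<le> C"
proof
  have abs: "(\<lambda>n. \<bar>a n\<bar>) summable_on A"
    using assms by (simp add: summable_on_abs_iff)
  show "0 \<le> (\<Sum>\<^sub>\<infinity>n\<in>A. \<bar>a n\<bar>)" by (rule infsum_nonneg) simp
  fix n assume "n \<in> A"
  then show "\<bar>a n\<bar> \<le> (\<Sum>\<^sub>\<infinity>n\<in>A. \<bar>a n\<bar>)"
    using finite_sum_le_infsum[OF abs, of "{n}"] by simp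
qed

lemma summable_on_real_comparison:
  fixes f g :: "'a \<Rightarrow> real"
  assumes "g summable_on A" "\<And>x. x \<in> A \<Longrightarrow> \<bar>f x\<bar> \<le> \<bar>g x\<bar>"
  shows "f summable_on A"
  using Infinite_Sum.abs_summable_on_comparison_test[of g A f] assms
  by (simp add: summable_on_abs_iff)

lemma summable_on_mult_pair:
  fixes a :: "'a \<Rightarrow> real" and b :: "'b \<Rightarrow> real"
  assumes "a summable_on A" "b summable_on B"
  shows "(\<lambda>(k, l). a k * b l) summable_on A \<times> B"
proof -
  have a: "(\<lambda>n. \<bar>a n\<bar>) summable_on A" and b: "(\<lambda>n. \<bar>b n\<bar>) summable_on B"
    using assms by (simp_all add: summable_on_abs_iff)
  have "(\<lambda>x. norm (case x of (k, l) \<Rightarrow> a k * b l)) summable_on A \<times> B"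
    unfolding Infinite_Sum.abs_summable_on_Sigma_iff
    using a b by (auto simp: abs_mult infsum_cmult_right' infsum_nonneg
        intro!: summable_on_cmult_right summable_on_cmult_left)
  then show ?thesis by (rule Infinite_Sum.abs_summable_summable)
qed

text \<open>The hypothesis of Fubini in the form met below: a product majorant with a bounded factor
  split off.\<close>

lemma summable_on_mult_pair_bounded:
  fixes a :: "'a \<Rightarrow> real" and b :: "'b \<Rightarrow> real"
  assumes "a summable_on A" "b summable_on B"
    and "\<And>k l. k \<in> A \<Longrightarrow> l \<in> B \<Longrightarrow> \<bar>f k l\<bar> \<le> C * (\<bar>a k\<bar> * \<bar>b l\<bar>)"
  shows "(\<lambda>(k, l). f k l) summable_on A \<times> B"
proof (rule summable_on_real_comparison)
  show "(\<lambda>(k, l). \<bar>C\<bar> * (a k * b l)) summable_on A \<times> B"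
    using summable_on_cmult_right[OF summable_on_mult_pair[OF assms(1,2)], of "\<bar>C\<bar>"]
    by (simp add: case_prod_unfold)
  fix x assume x: "x \<in> A \<times> B"
  have "\<bar>f (fst x) (snd x)\<bar> \<le> C * (\<bar>a (fst x)\<bar> * \<bar>b (snd x)\<bar>)" using assms(3) x by auto
  also have "\<dots> \<le> \<bar>C\<bar> * (\<bar>a (fst x)\<bar> * \<bar>b (snd x)\<bar>)" by (rule mult_right_mono) auto
  finally show "\<bar>case x of (k, l) \<Rightarrow> f k l\<bar> \<le> \<bar>case x of (k, l) \<Rightarrow> \<bar>C\<bar> * (a k * b l)\<bar>"
    by (simp add: case_prod_unfold abs_mult)
qed

lemma conv_pair_summable:
  fixes a b :: "int \<Rightarrow> real"
  assumes "a summable_on UNIV" "b summable_on UNIV"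
  shows "(\<lambda>(n, k). a k * b (n - k)) summable_on UNIV \<times> UNIV"
proof -
  have bij: "bij_betw (\<lambda>(n, k). (k, n - k)) (UNIV :: (int \<times> int) set) UNIV"
    by (rule bij_betw_byWitness[where f' = "\<lambda>(k, l). (k + l, k)"]) auto
  have "(\<lambda>x. (\<lambda>(k, l). a k * b l) ((\<lambda>(n, k). (k, n - k)) x)) summable_on UNIV"
    using summable_on_mult_pair[OF assms] summable_on_reindex_bij_betw[OF bij, of "\<lambda>(k, l). a k * b l"]
    by simp
  then show ?thesis by (simp add: case_prod_unfold)
qed

lemma summable_on_shift:
  fixes a :: "int \<Rightarrow> real"
  assumes "a summable_on UNIV"
  shows "(\<lambda>k. a (k + n)) summable_on UNIV" "(\<lambda>k. a (n + k)) summable_on UNIV"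
    "(\<lambda>k. a (n - k)) summable_on UNIV" "(\<lambda>k. a (k - n)) summable_on UNIV"
    "(\<lambda>k. a (- k)) summable_on UNIV"
proof -
  have b1: "bij (\<lambda>k. k + n)" by (rule bij_betw_byWitness[where f' = "\<lambda>k. k - n"]) auto
  have b2: "bij (\<lambda>k. n - k)" by (rule bij_betw_byWitness[where f' = "\<lambda>k. n - k"]) auto
  have b3: "bij (\<lambda>k. k - n)" by (rule bij_betw_byWitness[where f' = "\<lambda>k. k + n"]) auto
  have b4: "bij (\<lambda>k::int. - k)" by (rule bij_betw_byWitness[where f' = "\<lambda>k. - k"]) auto
  show "(\<lambda>k. a (k + n)) summable_on UNIV" "(\<lambda>k. a (n + k)) summable_on UNIV"
    "(\<lambda>k. a (n - k)) summable_on UNIV" "(\<lambda>k. a (k - n)) summable_on UNIV"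
    "(\<lambda>k. a (- k)) summable_on UNIV"
    using summable_on_reindex_bij_betw[OF b1, of a] summable_on_reindex_bij_betw[OF b2, of a]
      summable_on_reindex_bij_betw[OF b3, of a] summable_on_reindex_bij_betw[OF b4, of a] assms
    by (simp_all add: add.commute)
qed

lemma infsum_shift:
  fixes f :: "int \<Rightarrow> real"
  shows "(\<Sum>\<^sub>\<infinity>k. f (k + n)) = (\<Sum>\<^sub>\<infinity>k. f k)" "(\<Sum>\<^sub>\<infinity>k. f (n - k)) = (\<Sum>\<^sub>\<infinity>k. f k)"
    "(\<Sum>\<^sub>\<infinity>k. f (- k)) = (\<Sum>\<^sub>\<infinity>k. f k)"
proof -
  have b1: "bij (\<lambda>k. k + n)" by (rule bij_betw_byWitness[where f' = "\<lambda>k. k - n"]) auto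
  have b2: "bij (\<lambda>k. n - k)" by (rule bij_betw_byWitness[where f' = "\<lambda>k. n - k"]) auto
  have b4: "bij (\<lambda>k::int. - k)" by (rule bij_betw_byWitness[where f' = "\<lambda>k. - k"]) auto
  show "(\<Sum>\<^sub>\<infinity>k. f (k + n)) = (\<Sum>\<^sub>\<infinity>k. f k)" "(\<Sum>\<^sub>\<infinity>k. f (n - k)) = (\<Sum>\<^sub>\<infinity>k. f k)"
    "(\<Sum>\<^sub>\<infinity>k. f (- k)) = (\<Sum>\<^sub>\<infinity>k. f k)"
    using infsum_reindex_bij_betw[OF b1, of f] infsum_reindex_bij_betw[OF b2, of f]
      infsum_reindex_bij_betw[OF b4, of f] by simp_all
qed

lemma conv_summable:
  assumes "a summable_on UNIV" "b summable_on UNIV"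
  shows "conv a b summable_on UNIV"
  using summable_on_Sigma_banach[of "\<lambda>n k. a k * b (n - k)" UNIV "\<lambda>_. UNIV"] conv_pair_summable[OF assms]
  by (simp add: conv_def[abs_def])

lemma conv_commute: "conv a b n = conv b a n"
  using infsum_shift(2)[of "\<lambda>k. a k * b (n - k)" n] by (simp add: conv_def mult.commute)

lemma conv_assoc:
  assumes "a summable_on UNIV" "b summable_on UNIV" "c summable_on UNIV"
  shows "conv (conv a b) c n = conv a (conv b c) n"
proof -
  obtain C where C: "\<And>n. \<bar>c n\<bar> \<le> C" "0 \<le> C" using summable_on_bounded[OF assms(3)] by auto
  have "(\<lambda>(k, l). C * (a l * b (k - l))) summable_on UNIV \<times> UNIV"
    using summable_on_cmult_right[OF conv_pair_summable[OF assms(1,2)], of C]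
    by (simp add: case_prod_unfold)
  then have "(\<lambda>(k, l). a l * b (k - l) * c (n - k)) summable_on UNIV \<times> UNIV"
  proof (rule summable_on_real_comparison)
    fix x :: "int \<times> int"
    have "\<bar>a (snd x) * b (fst x - snd x)\<bar> * \<bar>c (n - fst x)\<bar> \<le> \<bar>a (snd x) * b (fst x - snd x)\<bar> * C"
      using C by (intro mult_left_mono) auto
    then show "\<bar>case x of (k, l) \<Rightarrow> a l * b (k - l) * c (n - k)\<bar> \<le>
        \<bar>case x of (k, l) \<Rightarrow> C * (a l * b (k - l))\<bar>"
      using C(2) by (simp add: case_prod_unfold abs_mult mult_ac)
  qed
  then have "(\<Sum>\<^sub>\<infinity>k. \<Sum>\<^sub>\<infinity>l. a l * b (k - l) * c (n - k)) =
      (\<Sum>\<^sub>\<infinity>l. \<Sum>\<^sub>\<infinity>k. a l * b (k - l) * c (n - k))"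
    by (rule infsum_swap_banach)
  also have "\<dots> = (\<Sum>\<^sub>\<infinity>l. a l * (\<Sum>\<^sub>\<infinity>k. b k * c (n - l - k)))"
  proof (rule infsum_cong)
    fix l
    have "(\<Sum>\<^sub>\<infinity>k. a l * b (k - l) * c (n - k)) = a l * (\<Sum>\<^sub>\<infinity>k. b (k - l) * c (n - k))"
      by (simp add: infsum_cmult_right' mult.assoc)
    also have "(\<Sum>\<^sub>\<infinity>k. b (k - l) * c (n - k)) = (\<Sum>\<^sub>\<infinity>k. b k * c (n - l - k))"
      using infsum_shift(1)[of "\<lambda>k. b (k - l) * c (n - k)" l] by (simp add: algebra_simps)
    finally show "(\<Sum>\<^sub>\<infinity>k. a l * b (k - l) * c (n - k)) = a l * (\<Sum>\<^sub>\<infinity>k. b k * c (n - l - k))" .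
  qed
  finally show ?thesis by (simp add: conv_def infsum_cmult_left')
qed

lemma conv_reflect: "conv (\<lambda>n. a (- n)) (\<lambda>n. b (- n)) n = conv a b (- n)"
  using infsum_shift(3)[of "\<lambda>k. a k * b (- n - k)"] by (simp add: conv_def algebra_simps)

lemma conv_delta: "conv (\<lambda>n. if n = 0 then 1 else 0) a = a"
proof
  fix n
  have "conv (\<lambda>n. if n = 0 then 1 else 0) a n = (\<Sum>\<^sub>\<infinity>k\<in>{0}. a (n - k))"
    unfolding conv_def by (rule infsum_cong_neutral) auto
  then show "conv (\<lambda>n. if n = 0 then 1 else 0) a n = a n" by simp
qed

definition sg :: "int \<Rightarrow> real" where "sg n = (if even n then 1 else - 1)"

lemma sg_add: "sg (m + n) = sg m * sg n" and sg_diff: "sg (m - n) = sg m * sg n"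
  and sg_minus [simp]: "sg (- n) = sg n" and sg_mult_self [simp]: "sg n * sg n = 1"
  and abs_sg [simp]: "\<bar>sg n\<bar> = 1"
  by (auto simp: sg_def)

lemma sg_of_nat: "sg (int n) = (-1) ^ n"
  by (simp add: sg_def)

lemma Ez_nat [simp]: "Ez t (int n) = t ^ n / fact n"
  by (simp add: Ez_def)

lemma Ez_neg [simp]: "z < 0 \<Longrightarrow> Ez t z = 0"
  by (simp add: Ez_def)

lemma Ez_minus: "Ez (- t) z = sg z * Ez t z"
  by (cases "z < 0") (auto simp: Ez_def sg_def even_nat_iff power_minus_even power_minus_odd)

lemma Ez_nonneg: "0 \<le> t \<Longrightarrow> 0 \<le> Ez t z"
  by (simp add: Ez_def)

lemma Ez_zero: "Ez 0 z = (if z = 0 then 1 else 0)"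
  by (auto simp: Ez_def)

lemma Ez_has_sum: "(Ez t has_sum exp t) UNIV"
proof -
  have "summable (\<lambda>n. norm (t ^ n / fact n))"
    using summable_exp[of "\<bar>t\<bar>"] by (simp add: power_abs abs_mult field_simps)
  moreover have "(\<lambda>n. t ^ n / fact n) sums exp t"
    using exp_converges[of t] by (simp add: field_simps)
  ultimately have "((\<lambda>n. Ez t (int n)) has_sum exp t) UNIV"
    by (simp add: norm_summable_imp_has_sum)
  then have "(Ez t has_sum exp t) (int ` UNIV)"
    by (subst has_sum_reindex) (auto simp: o_def)
  moreover have "int ` UNIV = {0..}"
    using zero_le_imp_eq_int by auto
  ultimately have "(Ez t has_sum exp t) {0..}" by simp
  then show ?thesis
    by (rule has_sum_cong_neutral[THEN iffD1, rotated -1]) auto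
qed

lemma Ez_summable: "Ez t summable_on UNIV"
  using Ez_has_sum has_sum_imp_summable by blast

lemma Ez_le_exp: "0 \<le> t \<Longrightarrow> Ez t z \<le> exp t"
  using finite_sum_le_infsum[OF Ez_summable, of "{z}" t] Ez_nonneg infsumI[OF Ez_has_sum[of t]] by simp

text \<open>Binomial theorem, that is exp (t z) exp (s z) = exp ((t + s) z). With s = -t it inverts
  triangular Toeplitz matrices.\<close>

lemma Ez_add_finite:
  assumes "0 \<le> n"
  shows "(\<Sum>k=0..n. Ez t k * Ez s (n - k)) = Ez (t + s) n"
proof -
  obtain N where N: "n = int N" using assms nonneg_int_cases by blast
  have "(\<Sum>k=0..n. Ez t k * Ez s (n - k)) = (\<Sum>k=0..N. Ez t (int k) * Ez s (n - int k))"
    by (rule sum.reindex_bij_witness[of _ int nat]) (auto simp: N)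
  also have "\<dots> = (\<Sum>k=0..N. of_nat (N choose k) * t ^ k * s ^ (N - k)) / fact N"
    unfolding sum_divide_distrib
  proof (rule sum.cong[OF refl])
    fix k assume k: "k \<in> {0..N}"
    then have "Ez s (n - int k) = s ^ (N - k) / fact (N - k)"
      unfolding N by (simp add: of_nat_diff[symmetric] del: of_nat_diff)
    then show "Ez t (int k) * Ez s (n - int k) = of_nat (N choose k) * t ^ k * s ^ (N - k) / fact N"
      using k by (simp add: binomial_fact field_simps)
  qed
  also have "\<dots> = Ez (t + s) n"
    by (simp add: N binomial_ring atLeast0AtMost)
  finally show ?thesis .
qed

lemma conv_Ez: "conv (Ez t) (Ez s) = Ez (t + s)"
proof
  fix n
  have "conv (Ez t) (Ez s) n = (\<Sum>\<^sub>\<infinity>k\<in>{0..n}. Ez t k * Ez s (n - k))"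
    unfolding conv_def by (rule infsum_cong_neutral) auto
  then show "conv (Ez t) (Ez s) n = Ez (t + s) n"
    using Ez_add_finite[of n t s] by (cases "0 \<le> n") auto
qed

text \<open>\<open>bess t n\<close> is the Bessel function value $bess_n(2t)$, given as the Laurent coefficient of
  $e^{t(z-1/z)}$.\<close>

definition bess :: "real \<Rightarrow> int \<Rightarrow> real" where
  "bess t = conv (Ez t) (\<lambda>k. Ez (- t) (- k))"

lemma bess_summable: "bess t summable_on UNIV"
  unfolding bess_def by (intro conv_summable Ez_summable summable_on_shift)

lemma bess_eq: "bess t n = (\<Sum>\<^sub>\<infinity>k. sg k * Ez t (n + k) * Ez t k)"
proof -
  have "bess t n = (\<Sum>\<^sub>\<infinity>k. Ez t k * (sg (k - n) * Ez t (k - n)))"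
    by (simp add: bess_def conv_def Ez_minus sg_diff mult.commute)
  also have "\<dots> = (\<Sum>\<^sub>\<infinity>k. sg k * Ez t (n + k) * Ez t k)"
    using infsum_shift(1)[of "\<lambda>k. Ez t k * (sg (k - n) * Ez t (k - n))" n] by (simp add: mult_ac add.commute)
  finally show ?thesis .
qed

text \<open>Invariance of exp (t (z - 1/z)) under z -> -1/z, read off from the coefficients.\<close>

lemma bess_minus: "bess t (- n) = sg n * bess t n"
proof -
  have "bess t (- n) = (\<Sum>\<^sub>\<infinity>k. sg k * Ez t (- n + k) * Ez t k)"
    by (rule bess_eq)
  also have "\<dots> = (\<Sum>\<^sub>\<infinity>k. sg (k + n) * Ez t k * Ez t (k + n))"
    using infsum_shift(1)[of "\<lambda>k. sg k * Ez t (- n + k) * Ez t k" n] by simp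
  also have "\<dots> = (\<Sum>\<^sub>\<infinity>k. sg n * (sg k * Ez t (n + k) * Ez t k))"
    by (simp add: sg_add mult_ac add.commute)
  also have "\<dots> = sg n * bess t n"
    by (simp only: infsum_cmult_right' bess_eq)
  finally show ?thesis .
qed

text \<open>exp (t/z) exp (t (z - 1/z)) = exp (t z).\<close>

lemma conv_Ez_reflect_bess: "conv (\<lambda>k. Ez t (- k)) (bess t) = Ez t"
proof
  fix n
  have 1: "conv (\<lambda>k. Ez (- t) (- k)) (\<lambda>k. Ez t (- k)) = (\<lambda>n. if n = 0 then 1 else 0)"
    by (auto simp: fun_eq_iff conv_reflect conv_Ez Ez_zero)
  note S = Ez_summable summable_on_shift(5)[OF Ez_summable]
  have "conv (\<lambda>k. Ez t (- k)) (bess t) n = conv (conv (Ez t) (\<lambda>k. Ez (- t) (- k))) (\<lambda>k. Ez t (- k)) n"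
    by (subst conv_commute) (simp add: bess_def)
  also have "\<dots> = conv (Ez t) (\<lambda>n. if n = 0 then 1 else 0) n"
    by (subst conv_assoc[OF S(1) S(2) S(2)]) (simp add: 1)
  also have "\<dots> = Ez t n"
    by (subst conv_commute) (simp add: conv_delta)
  finally show "conv (\<lambda>k. Ez t (- k)) (bess t) n = Ez t n" .
qed

text \<open>Replacing z by 1/z inverts exp (t (z - 1/z)); hence the shifted Bessel sequences are
  orthonormal, which is \<open>infsum_bess_bess\<close>.\<close>

lemma conv_bess_reflect_bess: "conv (bess t) (\<lambda>k. bess t (- k)) n = (if n = 0 then 1 else 0)"
proof -
  note S = Ez_summable summable_on_shift(5)[OF Ez_summable] bess_summable summable_on_shift(5)[OF bess_summable]
  have r: "(\<lambda>k. bess t (- k)) = conv (\<lambda>k. Ez t (- k)) (Ez (- t))"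
    by (rule ext) (simp add: bess_def conv_reflect[symmetric])
  have "conv (bess t) (\<lambda>k. bess t (- k)) n = conv (conv (bess t) (\<lambda>k. Ez t (- k))) (Ez (- t)) n"
    unfolding r by (rule conv_assoc[symmetric, OF S(3) S(2) S(1)])
  also have "conv (bess t) (\<lambda>k. Ez t (- k)) = Ez t"
    using conv_Ez_reflect_bess[of t] conv_commute[of "bess t"] by (auto simp: fun_eq_iff)
  also have "conv (Ez t) (Ez (- t)) n = (if n = 0 then 1 else 0)"
    by (simp add: conv_Ez Ez_zero)
  finally show ?thesis .
qed

lemma infsum_bess_bess: "(\<Sum>\<^sub>\<infinity>j. bess t (n - j) * bess t (k - j)) = (if n = k then 1 else 0)"
proof -
  have "conv (bess t) (\<lambda>k. bess t (- k)) (n - k) = (\<Sum>\<^sub>\<infinity>m. bess t m * bess t (m - n + k))"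
    by (simp add: conv_def algebra_simps)
  also have "\<dots> = (\<Sum>\<^sub>\<infinity>j. bess t (n - j) * bess t (k - j))"
    using infsum_shift(2)[of "\<lambda>m. bess t m * bess t (m - n + k)" n] by simp
  finally show ?thesis by (simp add: conv_bess_reflect_bess)
qed

section \<open>Inversion of 1 + L by reflection\<close>

definition refl_diff :: "real \<Rightarrow> int \<Rightarrow> int \<Rightarrow> real" where
  "refl_diff t k j = bess t (k - j) - sg k * bess t (- k - j)"

text \<open>f minus its reflection is antisymmetric under z -> -1/z and the exponential is
  invariant, so the coefficients at j and -j determine each other; at j = 0 this forces the value
  0.\<close>

lemma refl_diff_minus: "refl_diff t k (- j) = - sg j * refl_diff t k j"
proof -
  have "bess t (k + j) = sg (k + j) * bess t (- k - j)"
    using bess_minus[of t "- k - j"] by (simp add: sg_diff sg_add add.commute)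
  moreover have "bess t (- k + j) = sg (k - j) * bess t (k - j)"
    using bess_minus[of t "k - j"] by simp
  ultimately show ?thesis
    by (simp add: refl_diff_def sg_add sg_diff algebra_simps)
qed

lemma refl_diff_0 [simp]: "refl_diff t k 0 = 0"
  using refl_diff_minus[of t k 0] by (simp add: sg_def)

lemma refl_diff_summable: "refl_diff t k summable_on A"
proof -
  have "(\<lambda>j. bess t (k - j)) summable_on UNIV" "(\<lambda>j. bess t (- k - j)) summable_on UNIV"
    using summable_on_shift(3)[OF bess_summable] by auto
  then have "(\<lambda>j. bess t (k - j) + (- sg k) * bess t (- k - j)) summable_on UNIV"
    by (intro summable_on_add summable_on_cmult_right)
  then have "refl_diff t k summable_on UNIV"
    by (simp add: refl_diff_def[abs_def])
  then show ?thesis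
    by (rule summable_on_subset_banach) auto
qed

text \<open>With $f = e_k$ and $\tilde f(z) = f(-1/z)$, \<open>refl_diff t k\<close> is the coefficient sequence of
  $e^{-t(z-1/z)}(f - \tilde f)$, and \<open>resK\<close> is obtained from its positive part by multiplying with
  $e^{t(z-1/z)}$.\<close>

definition resK :: "real \<Rightarrow> int \<Rightarrow> int \<Rightarrow> real" where
  "resK t n k = (\<Sum>\<^sub>\<infinity>j\<in>{1..}. bess t (n - j) * refl_diff t k j)"

text \<open>For n, i >= 1 this is t^(n+i) / ((n+i) (i-1)! n!), by the alternating partial sum of
  binomial coefficients. The sum over a is kept because it factors L into a Hankel matrix, a
  diagonal of signs and a triangular Toeplitz matrix, each of which acts simply on Laurent
  coefficients.\<close>

definition Lker :: "real \<Rightarrow> int \<Rightarrow> int \<Rightarrow> real" where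
  "Lker t n i = - (\<Sum>a=1..i. sg a * Ez t (n + a) * Ez t (i - a))"

lemma bess_bounded: obtains C where "0 \<le> C" "\<And>n. \<bar>bess t n\<bar> \<le> C"
  using summable_on_bounded[OF bess_summable] by auto

lemma bess_refl_diff_summable: "(\<lambda>j. bess t (n - j) * refl_diff t k j) summable_on A"
proof -
  obtain C where C: "0 \<le> C" "\<And>n. \<bar>bess t n\<bar> \<le> C" using bess_bounded[of t] by blast
  show ?thesis
  proof (rule summable_on_real_comparison)
    show "(\<lambda>j. C * refl_diff t k j) summable_on A" by (intro summable_on_cmult_right refl_diff_summable)
    show "\<bar>bess t (n - j) * refl_diff t k j\<bar> \<le> \<bar>C * refl_diff t k j\<bar>" for j
      using C by (simp add: abs_mult mult_right_mono)
  qed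
qed

text \<open>Orthonormality pairs n with k and with -k; the second never happens for n, k >= 1, so
  the reflected part drops out.\<close>

lemma infsum_bess_refl_diff:
  assumes "1 \<le> n" "1 \<le> k"
  shows "(\<Sum>\<^sub>\<infinity>j. bess t (n - j) * refl_diff t k j) = (if n = k then 1 else 0)"
proof -
  obtain C where C: "0 \<le> C" "\<And>n. \<bar>bess t n\<bar> \<le> C" using bess_bounded[of t] by blast
  have S: "(\<lambda>j. bess t (n - j) * bess t (i - j)) summable_on UNIV" for i
  proof (rule summable_on_real_comparison)
    show "(\<lambda>j. C * bess t (i - j)) summable_on UNIV"
      by (intro summable_on_cmult_right summable_on_shift bess_summable)
    show "\<bar>bess t (n - j) * bess t (i - j)\<bar> \<le> \<bar>C * bess t (i - j)\<bar>" for j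
      using C by (simp add: abs_mult mult_right_mono)
  qed
  have "(\<Sum>\<^sub>\<infinity>j. bess t (n - j) * refl_diff t k j) =
      (\<Sum>\<^sub>\<infinity>j. bess t (n - j) * bess t (k - j) + (- sg k) * (bess t (n - j) * bess t (- k - j)))"
    by (simp add: refl_diff_def algebra_simps)
  also have "\<dots> = (\<Sum>\<^sub>\<infinity>j. bess t (n - j) * bess t (k - j)) + (\<Sum>\<^sub>\<infinity>j. (- sg k) * (bess t (n - j) * bess t (- k - j)))"
    by (rule infsum_add[OF S summable_on_cmult_right[OF S]])
  also have "(\<Sum>\<^sub>\<infinity>j. (- sg k) * (bess t (n - j) * bess t (- k - j))) = (- sg k) * (\<Sum>\<^sub>\<infinity>j. bess t (n - j) * bess t (- k - j))"
    by (rule infsum_cmult_right')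
  finally show ?thesis using assms by (simp add: infsum_bess_bess)
qed

lemma infsum_UNIV_split_int:
  fixes f :: "int \<Rightarrow> real"
  assumes "f summable_on UNIV"
  shows "(\<Sum>\<^sub>\<infinity>j. f j) = (\<Sum>\<^sub>\<infinity>j\<in>{1..}. f j) + (\<Sum>\<^sub>\<infinity>j\<in>{0..}. f (- j))"
    "(\<Sum>\<^sub>\<infinity>j. f j) = (\<Sum>\<^sub>\<infinity>j\<in>{1..}. f j) + f 0 + (\<Sum>\<^sub>\<infinity>j\<in>{1..}. f (- j))"
proof -
  have S: "f summable_on A" for A using assms summable_on_subset_banach by blast
  have U: "(UNIV :: int set) = {1..} \<union> {..0}" by auto
  have b: "bij_betw uminus {0..} {..0::int}"
    by (rule bij_betw_byWitness[where f' = uminus]) auto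
  show 1: "(\<Sum>\<^sub>\<infinity>j. f j) = (\<Sum>\<^sub>\<infinity>j\<in>{1..}. f j) + (\<Sum>\<^sub>\<infinity>j\<in>{0..}. f (- j))"
    unfolding infsum_reindex_bij_betw[OF b]
    by (subst U, rule infsum_Un_disjoint) (auto intro: S)
  have b': "bij_betw uminus {1..} {..-1::int}"
    by (rule bij_betw_byWitness[where f' = uminus]) auto
  have "(\<Sum>\<^sub>\<infinity>j\<in>{..0}. f j) = (\<Sum>\<^sub>\<infinity>j\<in>{0} \<union> {..-1}. f j)"
    by (rule arg_cong[where f = "infsum f"]) auto
  also have "\<dots> = f 0 + (\<Sum>\<^sub>\<infinity>j\<in>{..-1}. f j)"
    by (subst infsum_Un_disjoint) (auto intro: S)
  finally show "(\<Sum>\<^sub>\<infinity>j. f j) = (\<Sum>\<^sub>\<infinity>j\<in>{1..}. f j) + f 0 + (\<Sum>\<^sub>\<infinity>j\<in>{1..}. f (- j))"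
    using 1 infsum_reindex_bij_betw[OF b, of f] infsum_reindex_bij_betw[OF b', of f] by simp
qed

text \<open>Uniform in both indices: the bound for the interchange of sums and for the truncation
  errors later on.\<close>

lemma resK_bounded: obtains C where "0 \<le> C" "\<And>n k. \<bar>resK t n k\<bar> \<le> C"
proof -
  obtain C where C: "0 \<le> C" "\<And>n. \<bar>bess t n\<bar> \<le> C" using bess_bounded[of t] by blast
  let ?S = "\<Sum>\<^sub>\<infinity>j. \<bar>bess t j\<bar>"
  have A: "(\<lambda>j. \<bar>bess t j\<bar>) summable_on UNIV"
    using bess_summable by (simp add: summable_on_abs_iff)
  have S0: "0 \<le> ?S" by (rule infsum_nonneg) simp
  have "\<bar>resK t n k\<bar> \<le> C * (2 * ?S)" for n k
  proof -
    have "\<bar>resK t n k\<bar> \<le> (\<Sum>\<^sub>\<infinity>j\<in>{1..}. \<bar>bess t (n - j) * refl_diff t k j\<bar>)"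
      unfolding resK_def
      using norm_infsum_bound[of "\<lambda>j. bess t (n - j) * refl_diff t k j" "{1..}"] bess_refl_diff_summable[of t n k "{1..}"]
      by (simp add: summable_on_abs_iff)
    also have "\<dots> \<le> (\<Sum>\<^sub>\<infinity>j. C * (\<bar>bess t (k - j)\<bar> + \<bar>bess t (- k - j)\<bar>))"
    proof (rule infsum_mono_neutral)
      show "(\<lambda>j. \<bar>bess t (n - j) * refl_diff t k j\<bar>) summable_on {1..}"
        using bess_refl_diff_summable[of t n k "{1..}"] by (simp add: summable_on_abs_iff)
      show "(\<lambda>j. C * (\<bar>bess t (k - j)\<bar> + \<bar>bess t (- k - j)\<bar>)) summable_on UNIV"
        by (intro summable_on_cmult_right summable_on_add summable_on_shift(3)[OF A])
      fix j
      have "\<bar>refl_diff t k j\<bar> \<le> \<bar>bess t (k - j)\<bar> + \<bar>bess t (- k - j)\<bar>"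
        unfolding refl_diff_def using abs_triangle_ineq4[of "bess t (k - j)" "sg k * bess t (- k - j)"]
        by (simp add: abs_mult)
      then show "\<bar>bess t (n - j) * refl_diff t k j\<bar> \<le> C * (\<bar>bess t (k - j)\<bar> + \<bar>bess t (- k - j)\<bar>)"
        unfolding abs_mult using C by (intro mult_mono) auto
      show "0 \<le> C * (\<bar>bess t (k - j)\<bar> + \<bar>bess t (- k - j)\<bar>)" using C by simp
    qed auto
    also have "\<dots> = C * (2 * ?S)"
      using infsum_shift(2)[of "\<lambda>j. \<bar>bess t j\<bar>" k] infsum_shift(2)[of "\<lambda>j. \<bar>bess t j\<bar>" "- k"]
      by (simp add: infsum_cmult_right' infsum_add summable_on_shift(3)[OF A])
    finally show ?thesis .
  qed
  then show ?thesis using that[of "C * (2 * ?S)"] C(1) S0 by simp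
qed

text \<open>Since Ez t (i - a) vanishes for i < a, the sum over i is a full convolution with exp
  (t/z), which turns exp (t (z - 1/z)) into exp (t z); the latter has no negative powers, so only j
  <= a survives.\<close>

lemma infsum_Ez_resK:
  assumes a: "1 \<le> a"
  shows "(\<Sum>\<^sub>\<infinity>i\<in>{1..}. Ez t (i - a) * resK t i k) = (\<Sum>j=1..a. Ez t (a - j) * refl_diff t k j)"
proof -
  obtain C where C: "0 \<le> C" "\<And>n. \<bar>bess t n\<bar> \<le> C" using bess_bounded[of t] by blast
  have "(\<Sum>\<^sub>\<infinity>i\<in>{1..}. Ez t (i - a) * resK t i k) = (\<Sum>\<^sub>\<infinity>i. Ez t (i - a) * resK t i k)"
    by (rule infsum_cong_neutral) (use a in auto)
  also have "\<dots> = (\<Sum>\<^sub>\<infinity>i. \<Sum>\<^sub>\<infinity>j\<in>{1..}. Ez t (i - a) * (bess t (i - j) * refl_diff t k j))"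
    by (simp add: resK_def infsum_cmult_right')
  also have "\<dots> = (\<Sum>\<^sub>\<infinity>j\<in>{1..}. \<Sum>\<^sub>\<infinity>i. Ez t (i - a) * (bess t (i - j) * refl_diff t k j))"
  proof (rule infsum_swap_banach, rule summable_on_mult_pair_bounded)
    show "(\<lambda>i. Ez t (i - a)) summable_on UNIV" by (intro summable_on_shift Ez_summable)
    show "refl_diff t k summable_on {1..}" by (rule refl_diff_summable)
    show "\<bar>Ez t (i - a) * (bess t (i - j) * refl_diff t k j)\<bar> \<le> C * (\<bar>Ez t (i - a)\<bar> * \<bar>refl_diff t k j\<bar>)" for i j
      using mult_right_mono[OF C(2)[of "i - j"], of "\<bar>Ez t (i - a)\<bar> * \<bar>refl_diff t k j\<bar>"]
      by (simp add: abs_mult mult_ac)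
  qed
  also have "\<dots> = (\<Sum>\<^sub>\<infinity>j\<in>{1..}. Ez t (a - j) * refl_diff t k j)"
  proof (rule infsum_cong)
    fix j
    have "(\<Sum>\<^sub>\<infinity>i. Ez t (i - a) * (bess t (i - j) * refl_diff t k j)) = (\<Sum>\<^sub>\<infinity>i. Ez t (i - a) * bess t (i - j)) * refl_diff t k j"
      by (simp add: infsum_cmult_left'[symmetric] mult.assoc)
    also have "(\<Sum>\<^sub>\<infinity>i. Ez t (i - a) * bess t (i - j)) = conv (\<lambda>k. Ez t (- k)) (bess t) (a - j)"
      unfolding conv_def using infsum_shift(2)[of "\<lambda>i. Ez t (i - a) * bess t (i - j)" a]
      by (simp add: algebra_simps)
    finally show "(\<Sum>\<^sub>\<infinity>i. Ez t (i - a) * (bess t (i - j) * refl_diff t k j)) = Ez t (a - j) * refl_diff t k j"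
      by (simp add: conv_Ez_reflect_bess)
  qed
  also have "\<dots> = (\<Sum>\<^sub>\<infinity>j\<in>{1..a}. Ez t (a - j) * refl_diff t k j)"
    by (rule infsum_cong_neutral) auto
  finally show ?thesis by simp
qed

lemma Lker_resK_summable: "(\<lambda>(i, a). sg a * Ez t (n + a) * Ez t (i - a) * resK t i k) summable_on {1..} \<times> {1..}"
proof -
  obtain C where C: "0 \<le> C" "\<And>n k. \<bar>resK t n k\<bar> \<le> C" using resK_bounded[of t] by blast
  have "(\<lambda>(i, a). Ez t (n + a) * Ez t (i - a)) summable_on UNIV \<times> UNIV"
    by (rule conv_pair_summable) (intro summable_on_shift Ez_summable)+
  then have "(\<lambda>(i, a). Ez t (n + a) * Ez t (i - a)) summable_on {1..} \<times> {1..}"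
    by (rule summable_on_subset_banach) auto
  from summable_on_cmult_right[OF this, of C] show ?thesis
  proof (rule summable_on_real_comparison)
    fix x :: "int \<times> int"
    obtain i a where x: "x = (i, a)" by fastforce
    show "\<bar>case x of (i, a) \<Rightarrow> sg a * Ez t (n + a) * Ez t (i - a) * resK t i k\<bar> \<le>
        \<bar>C * (case x of (i, a) \<Rightarrow> Ez t (n + a) * Ez t (i - a))\<bar>"
      unfolding x using mult_right_mono[OF C(2)[of i k], of "\<bar>Ez t (n + a)\<bar> * \<bar>Ez t (i - a)\<bar>"] C(1)
      by (simp add: abs_mult mult_ac)
  qed
qed

lemma Lker_eq_infsum: "Lker t n i = - (\<Sum>\<^sub>\<infinity>a\<in>{1..}. sg a * Ez t (n + a) * Ez t (i - a))"
proof -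
  have "(\<Sum>\<^sub>\<infinity>a\<in>{1..}. sg a * Ez t (n + a) * Ez t (i - a)) =
      (\<Sum>\<^sub>\<infinity>a\<in>{1..i}. sg a * Ez t (n + a) * Ez t (i - a))"
    by (rule infsum_cong_neutral) auto
  then show ?thesis by (simp add: Lker_def)
qed

text \<open>\<open>resK\<close> inverts \<open>1 + Lker\<close>: both are read off from the reflection $z \mapsto -1/z$, under which
  $e^{t(z-1/z)}$ is invariant.\<close>

lemma one_plus_Lker_mult_resK:
  assumes "1 \<le> n" "1 \<le> k"
  shows "resK t n k + (\<Sum>\<^sub>\<infinity>i\<in>{1..}. Lker t n i * resK t i k) = (if n = k then 1 else 0)"
proof -
  have "(\<Sum>\<^sub>\<infinity>i\<in>{1..}. Lker t n i * resK t i k) =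
      - (\<Sum>\<^sub>\<infinity>i\<in>{1..}. \<Sum>\<^sub>\<infinity>a\<in>{1..}. sg a * Ez t (n + a) * Ez t (i - a) * resK t i k)"
    by (simp add: Lker_eq_infsum infsum_cmult_left' infsum_uminus)
  also have "(\<Sum>\<^sub>\<infinity>i\<in>{1..}. \<Sum>\<^sub>\<infinity>a\<in>{1..}. sg a * Ez t (n + a) * Ez t (i - a) * resK t i k) =
      (\<Sum>\<^sub>\<infinity>a\<in>{1..}. \<Sum>\<^sub>\<infinity>i\<in>{1..}. sg a * Ez t (n + a) * Ez t (i - a) * resK t i k)"
    by (rule infsum_swap_banach[OF Lker_resK_summable])
  also have "\<dots> = (\<Sum>\<^sub>\<infinity>a\<in>{1..}. \<Sum>\<^sub>\<infinity>j\<in>{1..}. sg a * Ez t (n + a) * (Ez t (a - j) * refl_diff t k j))"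
  proof (rule infsum_cong)
    fix a :: int assume a: "a \<in> {1..}"
    have "(\<Sum>\<^sub>\<infinity>i\<in>{1..}. sg a * Ez t (n + a) * Ez t (i - a) * resK t i k) =
        sg a * Ez t (n + a) * (\<Sum>j=1..a. Ez t (a - j) * refl_diff t k j)"
      using infsum_Ez_resK[of a t k] a by (simp add: infsum_cmult_right' mult.assoc)
    also have "(\<Sum>j=1..a. Ez t (a - j) * refl_diff t k j) = (\<Sum>\<^sub>\<infinity>j\<in>{1..a}. Ez t (a - j) * refl_diff t k j)"
      by simp
    also have "\<dots> = (\<Sum>\<^sub>\<infinity>j\<in>{1..}. Ez t (a - j) * refl_diff t k j)"
      by (rule infsum_cong_neutral) auto
    finally show "(\<Sum>\<^sub>\<infinity>i\<in>{1..}. sg a * Ez t (n + a) * Ez t (i - a) * resK t i k) =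
        (\<Sum>\<^sub>\<infinity>j\<in>{1..}. sg a * Ez t (n + a) * (Ez t (a - j) * refl_diff t k j))"
      by (simp add: infsum_cmult_right')
  qed
  also have "\<dots> = (\<Sum>\<^sub>\<infinity>j\<in>{1..}. \<Sum>\<^sub>\<infinity>a\<in>{1..}. sg a * Ez t (n + a) * (Ez t (a - j) * refl_diff t k j))"
  proof (rule infsum_swap_banach)
    obtain C where C: "0 \<le> C" "\<And>z. \<bar>Ez t z\<bar> \<le> C"
      using summable_on_bounded[OF Ez_summable] by auto
    show "(\<lambda>(a, j). sg a * Ez t (n + a) * (Ez t (a - j) * refl_diff t k j)) summable_on {1..} \<times> {1..}"
    proof (rule summable_on_mult_pair_bounded)
      show "(\<lambda>a. Ez t (n + a)) summable_on {1..}"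
        by (rule summable_on_subset_banach[OF summable_on_shift(2)[OF Ez_summable]]) auto
      show "refl_diff t k summable_on {1..}" by (rule refl_diff_summable)
      show "\<bar>sg a * Ez t (n + a) * (Ez t (a - j) * refl_diff t k j)\<bar> \<le> C * (\<bar>Ez t (n + a)\<bar> * \<bar>refl_diff t k j\<bar>)" for a j
        using mult_right_mono[OF C(2)[of "a - j"], of "\<bar>Ez t (n + a)\<bar> * \<bar>refl_diff t k j\<bar>"]
        by (simp add: abs_mult mult_ac)
    qed
  qed
  also have "\<dots> = (\<Sum>\<^sub>\<infinity>j\<in>{1..}. - (bess t (n + j) * refl_diff t k (- j)))"
  proof (rule infsum_cong)
    fix j :: int assume j: "j \<in> {1..}"
    have "(\<Sum>\<^sub>\<infinity>a\<in>{1..}. sg a * Ez t (n + a) * (Ez t (a - j) * refl_diff t k j)) =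
        (\<Sum>\<^sub>\<infinity>a. sg a * Ez t (n + a) * (Ez t (a - j) * refl_diff t k j))"
      by (rule infsum_cong_neutral) (use j in auto)
    \<comment> \<open>After a = b + j the sign splits off (-1)^j, which by antisymmetry turns the
      coefficient at j into minus the one at -j.\<close>
    also have "\<dots> = (\<Sum>\<^sub>\<infinity>b. sg (b + j) * Ez t (n + (b + j)) * (Ez t (b + j - j) * refl_diff t k j))"
      by (rule infsum_shift(1)[symmetric])
    also have "\<dots> = (\<Sum>\<^sub>\<infinity>b. sg b * Ez t (n + j + b) * Ez t b * (sg j * refl_diff t k j))"
      by (simp add: sg_add mult_ac add_ac)
    also have "\<dots> = bess t (n + j) * (sg j * refl_diff t k j)"
      by (simp only: infsum_cmult_left' bess_eq)
    finally show "(\<Sum>\<^sub>\<infinity>a\<in>{1..}. sg a * Ez t (n + a) * (Ez t (a - j) * refl_diff t k j)) =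
        - (bess t (n + j) * refl_diff t k (- j))"
      by (simp add: refl_diff_minus)
  qed
  finally have "(\<Sum>\<^sub>\<infinity>i\<in>{1..}. Lker t n i * resK t i k) = (\<Sum>\<^sub>\<infinity>j\<in>{1..}. bess t (n + j) * refl_diff t k (- j))"
    by (simp add: infsum_uminus)
  \<comment> \<open>\<open>resK\<close> supplies the terms with j >= 1, the sum just computed those
    with j <= -1, and the term j = 0 is 0: together they are the full sum of
    \<open>infsum_bess_refl_diff\<close>.\<close>
  then show ?thesis
    using infsum_UNIV_split_int(2)[OF bess_refl_diff_summable[of t n k UNIV]] infsum_bess_refl_diff[OF assms, of t]
    by (simp add: resK_def)
qed

definition bessK :: "real \<Rightarrow> int \<Rightarrow> int \<Rightarrow> real" where
  "bessK t n k = (\<Sum>\<^sub>\<infinity>l\<in>{0..}. bess t (n + l) * (bess t (k + l) - sg l * bess t (k - l)))"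

text \<open>The sum over all j is the Kronecker delta and \<open>resK\<close> is its part with j >=
  1; the remaining part, written with l = -j >= 0, is \<open>bessK\<close>.\<close>

lemma resK_eq_one_minus_bessK:
  assumes "1 \<le> n" "1 \<le> k"
  shows "resK t n k = (if n = k then 1 else 0) - bessK t n k"
proof -
  have "refl_diff t k (- l) = bess t (k + l) - sg l * bess t (k - l)" for l
    using bess_minus[of t "k - l"] by (simp add: refl_diff_def sg_diff mult.assoc[symmetric])
  then show ?thesis
    using infsum_UNIV_split_int(1)[OF bess_refl_diff_summable[of t n k UNIV]] infsum_bess_refl_diff[OF assms, of t]
    by (simp add: resK_def bessK_def)
qed

section \<open>Normalisation and complementary minors\<close>

text \<open>The Toeplitz matrices of exp (t z) and exp (-t z) stay inverse to each other when cut to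
  the window from p to j, because they are triangular. This splits a unipotent factor off
  \<open>Grow\<close>.\<close>

lemma sum_Ez_window:
  assumes "p \<le> j"
  shows "(\<Sum>i=p..j. (\<Sum>a=p..i. Ez t (k + a) * Ez (- t) (i - a)) * Ez t (j - i)) = Ez t (k + j)"
proof -
  have inner: "(\<Sum>i=p..j. Ez (- t) (i - a) * Ez t (j - i)) = (if a = j then 1 else 0)"
    if a: "p \<le> a" "a \<le> j" for a
  proof -
    have "(\<Sum>i=p..j. Ez (- t) (i - a) * Ez t (j - i)) = (\<Sum>i=a..j. Ez (- t) (i - a) * Ez t (j - i))"
      by (rule sum.mono_neutral_right) (use a in auto)
    also have "\<dots> = (\<Sum>b=0..j - a. Ez (- t) b * Ez t (j - a - b))"
      by (rule sum.reindex_bij_witness[of _ "\<lambda>b. b + a" "\<lambda>i. i - a"]) auto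
    also have "\<dots> = Ez 0 (j - a)"
      using Ez_add_finite[of "j - a" "- t" t] a by simp
    finally show ?thesis by (simp add: Ez_zero)
  qed
  have "(\<Sum>i=p..j. (\<Sum>a=p..i. Ez t (k + a) * Ez (- t) (i - a)) * Ez t (j - i)) =
      (\<Sum>i=p..j. \<Sum>a=p..j. Ez t (k + a) * (Ez (- t) (i - a) * Ez t (j - i)))"
  proof (rule sum.cong[OF refl])
    fix i assume "i \<in> {p..j}"
    then have "(\<Sum>a=p..i. Ez t (k + a) * Ez (- t) (i - a)) = (\<Sum>a=p..j. Ez t (k + a) * Ez (- t) (i - a))"
      by (intro sum.mono_neutral_left) auto
    then show "(\<Sum>a=p..i. Ez t (k + a) * Ez (- t) (i - a)) * Ez t (j - i) =
        (\<Sum>a=p..j. Ez t (k + a) * (Ez (- t) (i - a) * Ez t (j - i)))"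
      by (simp add: sum_distrib_right mult.assoc)
  qed
  also have "\<dots> = (\<Sum>a=p..j. Ez t (k + a) * (\<Sum>i=p..j. Ez (- t) (i - a) * Ez t (j - i)))"
    by (subst sum.swap) (simp add: sum_distrib_left)
  also have "\<dots> = (\<Sum>a=p..j. if a = j then Ez t (k + j) else 0)"
    by (rule sum.cong) (auto simp: inner)
  also have "\<dots> = Ez t (k + j)" using assms by simp
  finally show ?thesis .
qed

text \<open>The sum over all a from -k to i is, up to sign, a coefficient of exp (-t z) exp (t z)
  and vanishes, so the part with a >= 0 is minus the part with a < 0, which gives L with the indices
  exchanged. Needed for B, whose window starts at 0.\<close>

lemma sum_sg_Ez_eq_Lker:
  assumes "1 \<le> k" "1 \<le> i"
  shows "(\<Sum>a=0..i. sg a * Ez t (k + a) * Ez t (i - a)) = Lker t i k"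
proof -
  have "(\<Sum>a=-k..i. sg a * Ez t (k + a) * Ez t (i - a)) =
      (\<Sum>b=0..i + k. sg (b - k) * Ez t b * Ez t (i + k - b))"
    by (rule sum.reindex_bij_witness[of _ "\<lambda>b. b - k" "\<lambda>a. a + k"]) (auto simp: algebra_simps)
  also have "\<dots> = sg k * (\<Sum>b=0..i + k. Ez (- t) b * Ez t (i + k - b))"
    by (simp add: sg_diff Ez_minus sum_distrib_left mult_ac)
  also have "\<dots> = 0"
    using Ez_add_finite[of "i + k" "- t" t] assms by (simp add: Ez_zero)
  finally have z: "(\<Sum>a=-k..i. sg a * Ez t (k + a) * Ez t (i - a)) = 0" .
  have "{-k..i} = {-k..-1} \<union> {0..i}" using assms by auto
  then have "(\<Sum>a=-k..i. sg a * Ez t (k + a) * Ez t (i - a)) =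
      (\<Sum>a=-k..-1. sg a * Ez t (k + a) * Ez t (i - a)) + (\<Sum>a=0..i. sg a * Ez t (k + a) * Ez t (i - a))"
    by (simp only:) (rule sum.union_disjoint; auto)
  moreover have "(\<Sum>a=-k..-1. sg a * Ez t (k + a) * Ez t (i - a)) =
      (\<Sum>a=1..k. sg a * Ez t (i + a) * Ez t (k - a))"
    by (rule sum.reindex_bij_witness[of _ uminus uminus]) (auto simp: mult_ac add.commute)
  ultimately show ?thesis using z by (simp add: Lker_def)
qed

definition one_L :: "real \<Rightarrow> nat \<Rightarrow> nat \<Rightarrow> real" where
  "one_L t i j = (if i = j then 1 else 0) + Lker t (int i + 1) (int j + 1)"

lemma ldet_conj_sg:
  "ldet m (\<lambda>i j. (if i = j then 1 else 0) + sg (int i + 1) * sg (int j + 1) * A i j) =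
    ldet m (\<lambda>i j. (if i = j then 1 else 0) + A i j)"
proof -
  let ?B = "\<lambda>i j. (if i = j then 1 else 0) + A i j"
  have "ldet m (\<lambda>i j. (if i = j then 1 else 0) + sg (int i + 1) * sg (int j + 1) * A i j) =
      ldet m (\<lambda>i j. sg (int i + 1) * (sg (int j + 1) * ?B i j))"
    by (rule ldet_cong, case_tac "i = j") (simp_all add: distrib_left mult.assoc[symmetric])
  also have "\<dots> = (\<Prod>i<m. sg (int i + 1)) * ((\<Prod>i<m. sg (int i + 1)) * ldet m ?B)"
    by (simp only: ldet_scale_rows ldet_scale_cols)
  also have "\<dots> = (\<Prod>i<m. sg (int i + 1) * sg (int i + 1)) * ldet m ?B"
    by (simp only: prod.distrib mult.assoc)
  finally show ?thesis by simp
qed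

lemma ldet_Ez_unipotent: "ldet m (\<lambda>i j. Ez t (int j - int i)) = 1"
  by (subst ldet_upper_triangular) (auto simp: Ez_def)

lemma sum_int_interval: "(\<Sum>i<m. f (int i + 1)) = (\<Sum>i=1..int m. f i)"
  by (rule sum.reindex_bij_witness[of _ "\<lambda>i. nat (i - 1)" "\<lambda>i. int i + 1"]) auto

lemma sum_int_interval0: "(\<Sum>i<m. f (int i)) = (\<Sum>i=0..int m - 1. f i)"
  by (rule sum.reindex_bij_witness[of _ "\<lambda>i. nat i" "\<lambda>i. int i"]) auto

lemma sum_delta_plus:
  fixes c :: real
  shows "(\<Sum>i\<in>I. ((if k = i then 1 else 0) + c * S i) * U i) =
    (\<Sum>i\<in>I. if k = i then U i else 0) + c * (\<Sum>i\<in>I. S i * U i)"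
  unfolding sum_distrib_left sum.distrib[symmetric]
  by (rule sum.cong) (auto simp: algebra_simps)

text \<open>Splitting off the unipotent Toeplitz matrix Ez t (j - i) on the right turns the no-hook
  part into the identity and the hook part into L, up to conjugation by signs.\<close>

lemma ldet_Grow_A: "ldet m (Grow 1 t) = ldet m (one_L t)"
proof -
  let ?S = "\<lambda>k i. \<Sum>a=1..i. Ez t (k + a) * Ez (- t) (i - a)"
  let ?M = "\<lambda>k i. (if k = i then 1 else 0) + sg (int k) * ?S (int k + 1) (int i + 1)"
  let ?U = "\<lambda>i j. Ez t (int j - int i)"
  have "ldet m (Grow 1 t) = ldet m (\<lambda>k j. \<Sum>i<m. ?M k i * ?U i j)"
  proof (rule ldet_cong)
    fix k j assume kj: "k < m" "j < m"
    have "(\<Sum>i<m. ?M k i * ?U i j) =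
        (\<Sum>i<m. if k = i then ?U i j else 0) + sg (int k) * (\<Sum>i<m. ?S (int k + 1) (int i + 1) * ?U i j)"
      by (rule sum_delta_plus)
    also have "(\<Sum>i<m. if k = i then ?U i j else 0) = ?U k j" using kj by simp
    also have "(\<Sum>i<m. ?S (int k + 1) (int i + 1) * ?U i j) =
        (\<Sum>i=1..int m. ?S (int k + 1) i * Ez t (int j + 1 - i))"
      using sum_int_interval[of "\<lambda>i. ?S (int k + 1) i * Ez t (int j + 1 - i)" m] by simp
    also have "\<dots> = (\<Sum>i=1..int j + 1. ?S (int k + 1) i * Ez t (int j + 1 - i))"
      by (rule sum.mono_neutral_right) (use kj in auto)
    also have "\<dots> = Ez t (int k + 1 + (int j + 1))"
      by (rule sum_Ez_window) simp
    finally show "Grow 1 t k j = (\<Sum>i<m. ?M k i * ?U i j)"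
      by (simp add: Grow_def sg_of_nat algebra_simps)
  qed
  also have "\<dots> = ldet m ?M"
    by (simp only: ldet_mult ldet_Ez_unipotent mult_1_right)
  also have "\<dots> = ldet m (\<lambda>k i. (if k = i then 1 else 0) +
      sg (int k + 1) * sg (int i + 1) * Lker t (int k + 1) (int i + 1))"
    by (rule ldet_cong)
       (simp add: Lker_def Ez_minus sg_diff sg_add sum_distrib_left sum_negf[symmetric] sg_def[of 1] mult_ac)
  also have "\<dots> = ldet m (one_L t)"
    unfolding ldet_conj_sg one_L_def ..
  finally show ?thesis .
qed

text \<open>Index 0 admits no hook when e = -1, so row 0 of the factored matrix is a unit vector and
  splits off. What is left is, up to signs, the transpose of 1 + L, of size one less.\<close>

lemma ldet_Grow_B: "ldet (Suc m) (Grow (- 1) t) = ldet m (one_L t)"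
proof -
  let ?S = "\<lambda>k i. \<Sum>a=0..i. Ez t (k + a) * Ez (- t) (i - a)"
  let ?M = "\<lambda>k i. (if k = i then 1 else 0) + (if k = 0 then 0 else sg (int k) * ?S (int k) (int i))"
  let ?U = "\<lambda>i j. Ez t (int j - int i)"
  have "ldet (Suc m) (Grow (- 1) t) = ldet (Suc m) (\<lambda>k j. \<Sum>i<Suc m. ?M k i * ?U i j)"
  proof (rule ldet_cong)
    fix k j assume kj: "k < Suc m" "j < Suc m"
    have "(\<Sum>i<Suc m. ?M k i * ?U i j) = (\<Sum>i<Suc m. if k = i then ?U i j else 0) +
        (if k = 0 then 0 else sg (int k) * (\<Sum>i<Suc m. ?S (int k) (int i) * ?U i j))"
      using sum_delta_plus[of k "if k = 0 then 0 else sg (int k)" "\<lambda>i. ?S (int k) (int i)"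
          "\<lambda>i. ?U i j" "{..<Suc m}"]
      by (cases "k = 0") (simp_all del: sum.lessThan_Suc)
    also have "(\<Sum>i<Suc m. if k = i then ?U i j else 0) = ?U k j" using kj by (simp del: sum.lessThan_Suc)
    also have "(\<Sum>i<Suc m. ?S (int k) (int i) * ?U i j) =
        (\<Sum>i=0..int m. ?S (int k) i * Ez t (int j - i))"
      using sum_int_interval0[of "\<lambda>i. ?S (int k) i * Ez t (int j - i)" "Suc m"] by simp
    also have "\<dots> = (\<Sum>i=0..int j. ?S (int k) i * Ez t (int j - i))"
      by (rule sum.mono_neutral_right) (use kj in auto)
    also have "\<dots> = Ez t (int k + int j)"
      by (rule sum_Ez_window) simp
    finally show "Grow (- 1) t k j = (\<Sum>i<Suc m. ?M k i * ?U i j)"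
      by (auto simp: Grow_def sg_of_nat)
  qed
  also have "\<dots> = ldet (Suc m) ?M"
    by (simp only: ldet_mult ldet_Ez_unipotent mult_1_right)
  also have "\<dots> = ldet (1 + m) (\<lambda>i k. ?M k i)"
    by (subst ldet_transpose) simp
  also have "\<dots> = ldet 1 (\<lambda>i k. ?M k i) * ldet m (\<lambda>i k. ?M (1 + k) (1 + i))"
    by (rule ldet_block) auto
  also have "ldet 1 (\<lambda>i k. ?M k i) = 1"
    by (subst ldet_upper_triangular) auto
  also have "ldet m (\<lambda>i k. ?M (1 + k) (1 + i)) = ldet m (\<lambda>i k. (if i = k then 1 else 0) +
      sg (int i + 1) * sg (int k + 1) * Lker t (int i + 1) (int k + 1))"
  proof (rule ldet_cong)
    fix i k
    have "Lker t (int i + 1) (int k + 1) = (\<Sum>a=0..int i + 1. sg a * Ez t (int k + 1 + a) * Ez t (int i + 1 - a))"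
      by (rule sum_sg_Ez_eq_Lker[symmetric]) auto
    then show "?M (1 + k) (1 + i) = (if i = k then 1 else 0) +
        sg (int i + 1) * sg (int k + 1) * Lker t (int i + 1) (int k + 1)"
      by (simp add: Ez_minus sg_diff sum_distrib_left mult_ac add.commute)
  qed
  also have "\<dots> = ldet m (one_L t)"
    unfolding ldet_conj_sg one_L_def ..
  finally show ?thesis by simp
qed

text \<open>The total mass comes from the equation $D' = tD + {}$tail for the determinants \<open>D\<close>:
  differentiating in \<open>t\<close> shifts the columns, so only the first one contributes, and up to a tail its
  derivative is \<open>t\<close> times itself modulo the other columns.\<close>

lemma Ez_has_derivative: "((\<lambda>t. Ez t z) has_real_derivative Ez t (z - 1)) (at t)"
proof (cases "z > 0")
  case True
  then obtain n where n: "z = int (Suc n)"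
    by (metis zero_less_imp_eq_int gr0_implies_Suc)
  have "((\<lambda>t. t ^ Suc n / fact (Suc n)) has_real_derivative (real (Suc n) * t ^ n) / fact (Suc n)) (at t)"
    by (rule DERIV_cdivide) (use DERIV_pow[of "Suc n" t] in simp)
  moreover have "(real (Suc n) * t ^ n) / fact (Suc n) = Ez t (z - 1)"
  proof -
    have "z - 1 = int n" using n by simp
    then show ?thesis by (simp add: field_simps del: of_nat_Suc)
  qed
  ultimately show ?thesis by (simp add: n del: of_nat_Suc fact_Suc power_Suc)
next
  case False
  then have "(\<lambda>t. Ez t z) = (\<lambda>t. if z = 0 then 1 else 0)" by (auto simp: Ez_def)
  then show ?thesis using False by simp
qed

lemma ldet_has_derivative:
  assumes "\<And>i j. i < n \<Longrightarrow> j < n \<Longrightarrow> ((\<lambda>t. A t i j) has_real_derivative A' i j) (at t)"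
  shows "((\<lambda>t. ldet n (A t)) has_real_derivative (\<Sum>i<n. ldet n ((A t)(i := A' i)))) (at t)"
proof -
  have "((\<lambda>t. \<Sum>p | p permutes {..<n}. of_int (sign p) * (\<Prod>i<n. A t i (p i))) has_real_derivative
      (\<Sum>p | p permutes {..<n}. of_int (sign p) *
        (\<Sum>i<n. A' i (p i) * (\<Prod>y\<in>{..<n} - {i}. A t y (p y))))) (at t)"
  proof (rule DERIV_sum, rule DERIV_cmult)
    fix p assume "p \<in> {p. p permutes {..<n}}"
    then have p: "p i < n" if "i < n" for i using permutes_in_image[of p "{..<n}" i] that by auto
    show "((\<lambda>t. \<Prod>i<n. A t i (p i)) has_real_derivative
        (\<Sum>i<n. A' i (p i) * (\<Prod>y\<in>{..<n} - {i}. A t y (p y)))) (at t)"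
      by (rule has_field_derivative_prod) (use assms p in auto)
  qed
  moreover have "A' i (p i) * (\<Prod>y\<in>{..<n} - {i}. A t y (p y)) = (\<Prod>y<n. ((A t)(i := A' i)) y (p y))"
    if "i < n" for i p
    by (subst prod.remove[of _ i]) (use that in \<open>auto intro!: prod.cong\<close>)
  ultimately show ?thesis
    unfolding ldet_def by (subst sum.swap) (simp add: sum_distrib_left)
qed

text \<open>The transpose of \<open>Grow 1\<close>, because the operations needed are on columns
  while \<open>ldet\<close> is updated by rows. Family A suffices for the total mass, since both
  families lead to the same matrix 1 + L.\<close>

definition Gcol :: "real \<Rightarrow> nat \<Rightarrow> nat \<Rightarrow> real" where
  "Gcol t j k = Ez t (int j - int k) + (-1) ^ k * Ez t (int j + int k + 2)"

lemma Grow_eq_Gcol: "Grow 1 t k j = Gcol t j k"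
  by (simp add: Grow_def Gcol_def algebra_simps)

definition Ez_tail :: "real \<Rightarrow> nat \<Rightarrow> real" where
  "Ez_tail s N = (\<Sum>\<^sub>\<infinity>i\<in>{int N..}. Ez s i)"

lemma Ez_summable_on: "Ez s summable_on A"
  by (rule summable_on_subset_banach[OF Ez_summable]) auto

lemma Ez_tail_eq: "Ez_tail s N = exp s - (\<Sum>i<N. s ^ i / fact i)"
proof -
  have U: "(UNIV :: int set) = {..-1} \<union> ({0..int N - 1} \<union> {int N..})" by auto
  have "exp s = infsum (Ez s) UNIV" using infsumI[OF Ez_has_sum] by simp
  also have "\<dots> = infsum (Ez s) {..-1} + infsum (Ez s) ({0..int N - 1} \<union> {int N..})"
    by (subst U, rule infsum_Un_disjoint) (auto intro: Ez_summable_on)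
  also have "infsum (Ez s) {..-1} = 0" by (rule infsum_0) auto
  also have "infsum (Ez s) ({0..int N - 1} \<union> {int N..}) = infsum (Ez s) {0..int N - 1} + Ez_tail s N"
    unfolding Ez_tail_def by (rule infsum_Un_disjoint) (auto intro: Ez_summable_on)
  also have "infsum (Ez s) {0..int N - 1} = (\<Sum>i<N. s ^ i / fact i)"
    using sum_int_interval0[of "Ez s" N] by simp
  finally show ?thesis by simp
qed

lemma Ez_tail_tendsto: "Ez_tail s \<longlonglongrightarrow> 0"
proof -
  have "(\<lambda>N. \<Sum>i<N. s ^ i / fact i) \<longlonglongrightarrow> exp s"
    using exp_converges[of s] by (simp add: sums_def field_simps)
  then have "(\<lambda>N. exp s - (\<Sum>i<N. s ^ i / fact i)) \<longlonglongrightarrow> exp s - exp s"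
    by (intro tendsto_intros)
  then show ?thesis by (simp add: Ez_tail_eq[abs_def])
qed

lemma Ez_tail_nonneg: "0 \<le> s \<Longrightarrow> 0 \<le> Ez_tail s N"
  unfolding Ez_tail_def by (rule infsum_nonneg) (simp add: Ez_nonneg)

text \<open>A factor i cancels against i!, so N times the tail still tends to 0, as the sums of N
  error terms require.\<close>

lemma mult_Ez_tail_le:
  assumes "0 \<le> s"
  shows "real (Suc N) * Ez_tail s (Suc N) \<le> s * Ez_tail s N"
proof -
  have b: "bij_betw (\<lambda>i. i - 1) {int (Suc N)..} {int N..}"
    by (rule bij_betw_byWitness[where f' = "\<lambda>i. i + 1"]) auto
  have "real (Suc N) * Ez_tail s (Suc N) = (\<Sum>\<^sub>\<infinity>i\<in>{int (Suc N)..}. real (Suc N) * Ez s i)"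
    by (simp add: Ez_tail_def infsum_cmult_right')
  also have "\<dots> \<le> (\<Sum>\<^sub>\<infinity>i\<in>{int (Suc N)..}. s * Ez s (i - 1))"
  proof (rule infsum_mono)
    show "(\<lambda>i. real (Suc N) * Ez s i) summable_on {int (Suc N)..}"
      by (intro summable_on_cmult_right Ez_summable_on)
    have "(\<lambda>i. Ez s (i - 1)) summable_on UNIV" by (intro summable_on_shift Ez_summable)
    then show "(\<lambda>i. s * Ez s (i - 1)) summable_on {int (Suc N)..}"
      by (intro summable_on_cmult_right) (rule summable_on_subset_banach, auto)
    fix i :: int assume "i \<in> {int (Suc N)..}"
    then have "real (Suc N) * Ez s i \<le> of_int i * Ez s i"
      by (intro mult_right_mono Ez_nonneg assms) auto
    then show "real (Suc N) * Ez s i \<le> s * Ez s (i - 1)" by (simp add: Ez_rec)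
  qed
  also have "\<dots> = s * Ez_tail s N"
    using infsum_reindex_bij_betw[OF b, of "Ez s"] by (simp add: Ez_tail_def infsum_cmult_right')
  finally show ?thesis .
qed

lemma mult_Ez_tail_tendsto:
  assumes "0 \<le> s"
  shows "(\<lambda>N. real N * Ez_tail s (Suc N)) \<longlonglongrightarrow> 0"
proof (rule tendsto_sandwich)
  show "\<forall>\<^sub>F N in sequentially. 0 \<le> real N * Ez_tail s (Suc N)"
    using Ez_tail_nonneg[OF assms] by simp
  show "\<forall>\<^sub>F N in sequentially. real N * Ez_tail s (Suc N) \<le> s * Ez_tail s N"
  proof (rule always_eventually, rule allI)
    fix N
    have "real N * Ez_tail s (Suc N) \<le> real (Suc N) * Ez_tail s (Suc N)"
      using Ez_tail_nonneg[OF assms] by (intro mult_right_mono) auto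
    then show "real N * Ez_tail s (Suc N) \<le> s * Ez_tail s N"
      using mult_Ez_tail_le[OF assms, of N] by simp
  qed
  show "(\<lambda>N. s * Ez_tail s N) \<longlonglongrightarrow> 0"
    using tendsto_mult_right_zero[OF Ez_tail_tendsto] by simp
qed auto

text \<open>c^N <= c^i for i >= N. Geometric growth in N, as of determinant bounds, is thus absorbed
  by enlarging the argument of an exponential tail.\<close>

lemma power_Ez_tail_le:
  assumes "1 \<le> c" "0 \<le> s"
  shows "c ^ N * Ez_tail s N \<le> Ez_tail (c * s) N"
proof -
  have "c ^ N * Ez_tail s N = (\<Sum>\<^sub>\<infinity>i\<in>{int N..}. c ^ N * Ez s i)"
    by (simp add: Ez_tail_def infsum_cmult_right')
  also have "\<dots> \<le> (\<Sum>\<^sub>\<infinity>i\<in>{int N..}. Ez (c * s) i)"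
  proof (rule infsum_mono)
    show "(\<lambda>i. c ^ N * Ez s i) summable_on {int N..}"
      by (intro summable_on_cmult_right Ez_summable_on)
    show "Ez (c * s) summable_on {int N..}" by (rule Ez_summable_on)
    fix i assume "i \<in> {int N..}"
    then have i: "0 \<le> i" "N \<le> nat i" by auto
    have "c ^ N * Ez s i \<le> c ^ nat i * Ez s i"
      using assms i by (intro mult_right_mono power_increasing Ez_nonneg) auto
    then show "c ^ N * Ez s i \<le> Ez (c * s) i"
      using i by (simp add: Ez_def power_mult_distrib)
  qed
  finally show ?thesis by (simp add: Ez_tail_def)
qed

lemma sum_Ez_shift_le:
  assumes "0 \<le> t" "finite I" "inj_on f I"
  shows "(\<Sum>i\<in>I. Ez t (f i)) \<le> exp t"
proof -
  have "(\<Sum>i\<in>I. Ez t (f i)) = sum (Ez t) (f ` I)"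
    using assms by (simp add: sum.reindex)
  also have "\<dots> \<le> infsum (Ez t) UNIV"
    by (rule finite_sum_le_infsum) (use assms in \<open>auto simp: Ez_summable Ez_nonneg\<close>)
  also have "\<dots> = exp t" by (rule infsumI[OF Ez_has_sum])
  finally show ?thesis .
qed

lemma sum_abs_Gcol_le:
  assumes "0 \<le> t"
  shows "(\<Sum>k<m. \<bar>Gcol t j k\<bar>) \<le> 2 * exp t"
proof -
  have "(\<Sum>k<m. \<bar>Gcol t j k\<bar>) \<le> (\<Sum>k<m. Ez t (int j - int k) + Ez t (int j + int k + 2))"
  proof (rule sum_mono)
    fix k
    have "\<bar>Gcol t j k\<bar> \<le> \<bar>Ez t (int j - int k)\<bar> + \<bar>(-1) ^ k * Ez t (int j + int k + 2)\<bar>"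
      unfolding Gcol_def by (rule abs_triangle_ineq)
    then show "\<bar>Gcol t j k\<bar> \<le> Ez t (int j - int k) + Ez t (int j + int k + 2)"
      using Ez_nonneg[OF assms] by (simp add: abs_mult)
  qed
  also have "\<dots> \<le> exp t + exp t"
    unfolding sum.distrib
    by (intro add_mono sum_Ez_shift_le assms) (auto simp: inj_on_def)
  finally show ?thesis by simp
qed

definition Gtail :: "real \<Rightarrow> nat \<Rightarrow> nat \<Rightarrow> real" where
  "Gtail t m k = (\<Sum>\<^sub>\<infinity>j\<in>{int m..}. Ez (- t) (j + 1) * (Ez t (j - int k) + (-1) ^ k * Ez t (j + int k + 2)))"

text \<open>The sum over all integers j is J_{-(k+1)} + (-1)^k J_{k+1} = 0. The terms with j <= -2
  vanish, j = -1 gives the left side, 0 <= j < m the finite sum and j >= m the tail. The left side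
  is the derivative in t of row 0 of \<open>Gcol\<close>.\<close>

lemma Gcol_relation:
  "(-1) ^ k * Ez t (int k + 1) =
    - (\<Sum>j<m. Ez (- t) (int j + 1) * Gcol t j k) - Gtail t m k"
proof -
  let ?f = "\<lambda>j. Ez (- t) (j + 1) * (Ez t (j - int k) + (-1) ^ k * Ez t (j + int k + 2))"
  obtain C where C: "0 \<le> C" "\<And>z. \<bar>Ez t z\<bar> \<le> C"
    using summable_on_bounded[OF Ez_summable[of t]] by auto
  have s0: "(\<lambda>j. Ez (- t) (j + 1)) summable_on UNIV" by (intro summable_on_shift Ez_summable)
  have S: "(\<lambda>j. Ez (- t) (j + 1) * Ez t (h j)) summable_on UNIV" for h :: "int \<Rightarrow> int"
  proof (rule summable_on_real_comparison)
    show "(\<lambda>j. C * Ez (- t) (j + 1)) summable_on UNIV" by (intro summable_on_cmult_right s0)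
    show "\<bar>Ez (- t) (j + 1) * Ez t (h j)\<bar> \<le> \<bar>C * Ez (- t) (j + 1)\<bar>" for j
      using mult_right_mono[OF C(2)[of "h j"], of "\<bar>Ez (- t) (j + 1)\<bar>"] C(1)
      by (simp add: abs_mult mult.commute)
  qed
  let ?g = "\<lambda>j. Ez (- t) (j + 1) * Ez t (j - int k)"
  let ?h = "\<lambda>j. Ez (- t) (j + 1) * Ez t (j + int k + 2)"
  have f: "?f j = ?g j + (-1) ^ k * ?h j" for j by (simp add: algebra_simps)
  have Sf: "?f summable_on UNIV"
    unfolding f by (intro summable_on_add summable_on_cmult_right S)
  have g: "infsum ?g UNIV = bess t (- (int k + 1))"
  proof -
    have "infsum ?g UNIV = (\<Sum>\<^sub>\<infinity>j. ?g (j + int k))" by (rule infsum_shift(1)[symmetric])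
    also have "\<dots> = (\<Sum>\<^sub>\<infinity>j. Ez t j * Ez (- t) (- (- (int k + 1) - j)))"
      by (simp add: algebra_simps)
    finally show ?thesis by (simp add: bess_def conv_def)
  qed
  have h: "infsum ?h UNIV = bess t (int k + 1)"
  proof -
    have "infsum ?h UNIV = (\<Sum>\<^sub>\<infinity>j. ?h (j + (- int k - 2)))" by (rule infsum_shift(1)[symmetric])
    also have "\<dots> = (\<Sum>\<^sub>\<infinity>j. Ez t j * Ez (- t) (- (int k + 1 - j)))"
      by (simp add: algebra_simps)
    finally show ?thesis by (simp add: bess_def conv_def)
  qed
  have "infsum ?f UNIV = infsum ?g UNIV + (-1) ^ k * infsum ?h UNIV"
    unfolding f by (subst infsum_add) (auto intro: S summable_on_cmult_right simp: infsum_cmult_right')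
  also have "\<dots> = 0"
    unfolding g h bess_minus by (simp add: sg_add sg_of_nat sg_def[of 1])
  finally have z: "infsum ?f UNIV = 0" .
  have Sf': "?f summable_on A" for A by (rule summable_on_subset_banach[OF Sf]) auto
  have U: "(UNIV :: int set) = {..-2} \<union> ({-1} \<union> ({0..int m - 1} \<union> {int m..}))" by auto
  have "infsum ?f UNIV = infsum ?f {..-2} + infsum ?f ({-1} \<union> ({0..int m - 1} \<union> {int m..}))"
    by (subst U, rule infsum_Un_disjoint) (auto intro: Sf')
  also have "infsum ?f {..-2} = 0" by (rule infsum_0) auto
  also have "infsum ?f ({-1} \<union> ({0..int m - 1} \<union> {int m..})) =
      infsum ?f {-1} + infsum ?f ({0..int m - 1} \<union> {int m..})"
    by (rule infsum_Un_disjoint) (auto intro: Sf')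
  also have "infsum ?f ({0..int m - 1} \<union> {int m..}) = infsum ?f {0..int m - 1} + Gtail t m k"
    unfolding Gtail_def by (rule infsum_Un_disjoint) (auto intro: Sf')
  also have "infsum ?f {0..int m - 1} = (\<Sum>j<m. Ez (- t) (int j + 1) * Gcol t j k)"
    using sum_int_interval0[of ?f m] by (simp add: Gcol_def)
  also have "infsum ?f {-1} = (-1) ^ k * Ez t (int k + 1)"
    by (simp add: Ez_def[of "- t" 0] add.commute)
  finally show ?thesis using z by simp
qed

lemma abs_Gtail_le:
  assumes "0 \<le> t"
  shows "\<bar>Gtail t m k\<bar> \<le> Ez_tail t (Suc m) * (2 * exp t)"
proof -
  let ?f = "\<lambda>j. Ez (- t) (j + 1) * (Ez t (j - int k) + (-1) ^ k * Ez t (j + int k + 2))"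
  have b: "bij_betw (\<lambda>i. i + 1) {int m..} {int (Suc m)..}"
    by (rule bij_betw_byWitness[where f' = "\<lambda>i. i - 1"]) auto
  have s0: "(\<lambda>j. Ez t (j + 1)) summable_on {int m..}"
    by (rule summable_on_subset_banach[OF summable_on_shift(1)[OF Ez_summable]]) auto
  have le: "\<bar>?f j\<bar> \<le> Ez t (j + 1) * (2 * exp t)" for j
  proof -
    have "\<bar>Ez t (j - int k) + (-1) ^ k * Ez t (j + int k + 2)\<bar> \<le>
        \<bar>Ez t (j - int k)\<bar> + \<bar>(-1) ^ k * Ez t (j + int k + 2)\<bar>"
      by (rule abs_triangle_ineq)
    also have "\<dots> \<le> exp t + exp t"
      using Ez_le_exp[OF assms] Ez_nonneg[OF assms] by (intro add_mono) (simp_all add: abs_mult)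
    finally show ?thesis
      using Ez_nonneg[OF assms] by (simp add: abs_mult Ez_minus mult_left_mono)
  qed
  have s1: "(\<lambda>j. Ez t (j + 1) * (2 * exp t)) summable_on {int m..}"
    by (intro summable_on_cmult_left s0)
  have s2: "(\<lambda>j. \<bar>?f j\<bar>) summable_on {int m..}"
    by (rule summable_on_real_comparison[OF s1])
       (use le Ez_nonneg[OF assms] in \<open>auto simp: abs_mult\<close>)
  have "\<bar>Gtail t m k\<bar> \<le> (\<Sum>\<^sub>\<infinity>j\<in>{int m..}. \<bar>?f j\<bar>)"
    unfolding Gtail_def using norm_infsum_bound[of ?f "{int m..}"] s2 by simp
  also have "\<dots> \<le> (\<Sum>\<^sub>\<infinity>j\<in>{int m..}. Ez t (j + 1) * (2 * exp t))"
    by (rule infsum_mono[OF s2 s1 le])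
  also have "\<dots> = Ez_tail t (Suc m) * (2 * exp t)"
    using infsum_reindex_bij_betw[OF b, of "Ez t"] by (simp add: infsum_cmult_left' Ez_tail_def)
  finally show ?thesis .
qed

lemma ldet_Gcol_derivative:
  "((\<lambda>t. ldet (Suc m) (Gcol t)) has_real_derivative
    t * ldet (Suc m) (Gcol t) - ldet (Suc m) ((Gcol t)(0 := Gtail t (Suc m)))) (at t)"
proof -
  let ?n = "Suc m"
  let ?A' = "\<lambda>j k. Ez t (int j - 1 - int k) + (-1) ^ k * Ez t (int j - 1 + int k + 2)"
  have "((\<lambda>t. ldet ?n (Gcol t)) has_real_derivative (\<Sum>i<?n. ldet ?n ((Gcol t)(i := ?A' i)))) (at t)"
  proof (rule ldet_has_derivative)
    fix i j
    have "((\<lambda>t. Gcol t i j) has_real_derivative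
        Ez t (int i - int j - 1) + (-1) ^ j * Ez t (int i + int j + 2 - 1)) (at t)"
      unfolding Gcol_def by (intro DERIV_add DERIV_cmult Ez_has_derivative)
    then show "((\<lambda>t. Gcol t i j) has_real_derivative ?A' i j) (at t)"
      by (simp add: algebra_simps)
  qed
  moreover have "(\<Sum>i<?n. ldet ?n ((Gcol t)(i := ?A' i))) = ldet ?n ((Gcol t)(0 := ?A' 0))"
  proof -
    have "(\<Sum>i<?n. ldet ?n ((Gcol t)(i := ?A' i))) = (\<Sum>i\<in>{0}. ldet ?n ((Gcol t)(i := ?A' i)))"
    proof (rule sum.mono_neutral_right)
      show "\<forall>i\<in>{..<?n} - {0}. ldet ?n ((Gcol t)(i := ?A' i)) = 0"
      proof
        \<comment> \<open>The derivative of row i is row i - 1, so for i >= 1 two rows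
          coincide.\<close>
        fix i assume i: "i \<in> {..<?n} - {0}"
        then show "ldet ?n ((Gcol t)(i := ?A' i)) = 0"
          by (intro ldet_identical_rows[of i "i - 1"]) (auto simp: Gcol_def of_nat_diff Suc_le_eq)
      qed
    qed auto
    then show ?thesis by simp
  qed
  moreover have "ldet ?n ((Gcol t)(0 := ?A' 0)) =
      t * ldet ?n (Gcol t) - ldet ?n ((Gcol t)(0 := Gtail t ?n))"
  proof -
    let ?I = "{1..<?n}"
    let ?v = "\<lambda>k. t * Gcol t 0 k + (- 1) * Gtail t ?n k"
    have A0: "?A' 0 k = ?v k + (\<Sum>j\<in>?I. (- Ez (- t) (int j + 1)) * Gcol t j k)" for k
    proof -
      have "?A' 0 k = - (\<Sum>j<?n. Ez (- t) (int j + 1) * Gcol t j k) - Gtail t ?n k"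
        using Gcol_relation[of k t ?n] by (simp add: algebra_simps)
      also have "(\<Sum>j<?n. Ez (- t) (int j + 1) * Gcol t j k) =
          Ez (- t) (int 0 + 1) * Gcol t 0 k + (\<Sum>j\<in>?I. Ez (- t) (int j + 1) * Gcol t j k)"
        by (simp only: lessThan_atLeast0 sum.atLeast_Suc_lessThan[OF zero_less_Suc] One_nat_def)
      \<comment> \<open>The coefficient of row 0 itself; with the minus sign in front it becomes t,
        the term tD of the differential equation.\<close>
      also have "Ez (- t) (int 0 + 1) = - t" by (simp add: Ez_def)
      finally show ?thesis by (simp add: sum_negf)
    qed
    have e: "(\<Sum>j\<in>?I. (- Ez (- t) (int j + 1)) * ((Gcol t)(0 := ?v)) j k) =
        (\<Sum>j\<in>?I. (- Ez (- t) (int j + 1)) * Gcol t j k)" for k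
      by (rule sum.cong) auto
    have "ldet ?n ((Gcol t)(0 := ?A' 0)) =
        ldet ?n (((Gcol t)(0 := ?v))(0 := \<lambda>k. ((Gcol t)(0 := ?v)) 0 k +
          (\<Sum>j\<in>?I. (- Ez (- t) (int j + 1)) * ((Gcol t)(0 := ?v)) j k)))"
      by (simp only: fun_upd_upd fun_upd_same e A0)
    also have "\<dots> = ldet ?n ((Gcol t)(0 := ?v))"
      by (rule ldet_add_rows) auto
    also have "\<dots> = t * ldet ?n ((Gcol t)(0 := Gcol t 0)) + (- 1) * ldet ?n ((Gcol t)(0 := Gtail t ?n))"
      by (rule ldet_row_linear) simp
    finally show ?thesis by (simp del: fun_upd_apply)
  qed
  ultimately show ?thesis by simp
qed

text \<open>Every row of \<open>Gcol\<close> has absolute sum at most 2 exp t. The resulting power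
  is absorbed into the tail of the replaced row through \<open>power_Ez_tail_le\<close>.\<close>

lemma abs_ldet_Gtail_le:
  assumes "0 \<le> t" "t \<le> T"
  shows "\<bar>ldet (Suc m) ((Gcol t)(0 := Gtail t (Suc m)))\<bar> \<le>
    real (Suc m) * Ez_tail (2 * exp T * T) (Suc (Suc m))"
proof -
  let ?c = "2 * exp t"
  have T: "0 \<le> T" using assms by simp
  have "\<bar>ldet (Suc m) ((Gcol t)(0 := Gtail t (Suc m)))\<bar> \<le>
      (\<Prod>i<Suc m. \<Sum>j<Suc m. \<bar>((Gcol t)(0 := Gtail t (Suc m))) i j\<bar>)"
    by (rule ldet_abs_le)
  also have "\<dots> = (\<Sum>j<Suc m. \<bar>Gtail t (Suc m) j\<bar>) * (\<Prod>i<m. \<Sum>j<Suc m. \<bar>Gcol t (Suc i) j\<bar>)"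
    by (subst prod.lessThan_Suc_shift) simp
  also have "\<dots> \<le> (\<Sum>j<Suc m. Ez_tail t (Suc (Suc m)) * ?c) * (\<Prod>i<m. ?c)"
    by (intro mult_mono sum_mono prod_mono conjI sum_abs_Gcol_le abs_Gtail_le assms prod_nonneg sum_nonneg)
       (auto simp: Ez_tail_nonneg assms intro!: sum_nonneg mult_nonneg_nonneg)
  also have "\<dots> = real (Suc m) * (?c ^ Suc m * Ez_tail t (Suc (Suc m)))"
    by (simp add: mult_ac)
  also have "\<dots> \<le> real (Suc m) * Ez_tail (2 * exp T * T) (Suc (Suc m))"
  proof (rule mult_left_mono)
    have c1: "1 \<le> 2 * exp T" using T by (simp add: add_increasing2 one_le_exp_iff order_trans[of 1 "exp T"])
    have tail_mono: "Ez_tail t N \<le> Ez_tail T N" for N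
      unfolding Ez_tail_def
      by (intro infsum_mono Ez_summable_on) (use assms in \<open>auto simp: Ez_def intro!: divide_right_mono power_mono\<close>)
    have "?c ^ Suc m * Ez_tail t (Suc (Suc m)) \<le> (2 * exp T) ^ Suc m * Ez_tail T (Suc (Suc m))"
      using assms T by (intro mult_mono power_mono tail_mono) (auto simp: Ez_tail_nonneg)
    also have "\<dots> \<le> (2 * exp T) ^ Suc (Suc m) * Ez_tail T (Suc (Suc m))"
      using c1 T by (intro mult_right_mono power_increasing) (auto simp: Ez_tail_nonneg)
    also have "\<dots> \<le> Ez_tail (2 * exp T * T) (Suc (Suc m))"
      by (rule power_Ez_tail_le[OF c1 T])
    finally show "?c ^ Suc m * Ez_tail t (Suc (Suc m)) \<le> Ez_tail (2 * exp T * T) (Suc (Suc m))" .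
  qed simp
  finally show ?thesis .
qed

lemma ldet_Gcol_0: "ldet m (Gcol 0) = 1"
  by (subst ldet_upper_triangular) (auto simp: Gcol_def Ez_zero)

lemma ldet_one_L_tendsto:
  assumes T: "0 \<le> T"
  shows "(\<lambda>m. ldet m (one_L T)) \<longlonglongrightarrow> exp (T\<^sup>2 / 2)"
proof -
  let ?e = "\<lambda>m. real (Suc m) * Ez_tail (2 * exp T * T) (Suc (Suc m))"
  \<comment> \<open>The integrating factor exp (-t^2/2) removes the term tD, so g starts at 1 and
    its derivative consists of the tail only.\<close>
  define g where "g m t = ldet (Suc m) (Gcol t) * exp (- t\<^sup>2 / 2)" for m t
  have bound: "\<bar>g m T - 1\<bar> \<le> T * ?e m" for m
  proof (cases "T = 0")
    case True
    then show ?thesis by (simp add: g_def ldet_Gcol_0)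
  next
    case False
    then have T': "0 < T" using T by simp
    let ?g' = "\<lambda>t. - exp (- t\<^sup>2 / 2) * ldet (Suc m) ((Gcol t)(0 := Gtail t (Suc m)))"
    have der: "(g m has_real_derivative ?g' t) (at t)" for t
    proof -
      have "((\<lambda>t. exp (- t\<^sup>2 / 2)) has_real_derivative - t * exp (- t\<^sup>2 / 2)) (at t)"
        by (auto intro!: derivative_eq_intros)
      from DERIV_mult[OF ldet_Gcol_derivative[of m t] this] show ?thesis
        unfolding g_def by (simp add: algebra_simps del: fun_upd_apply)
    qed
    obtain z where z: "0 < z" "z < T" "g m T - g m 0 = (T - 0) * ?g' z"
      using MVT2[OF T', of "g m" ?g'] der by blast
    have "\<bar>?g' z\<bar> \<le> 1 * ?e m"
      unfolding abs_mult
      by (intro mult_mono abs_ldet_Gtail_le) (use z in auto)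
    moreover have "\<bar>g m T - 1\<bar> = T * \<bar>?g' z\<bar>"
      using z T' by (simp add: g_def ldet_Gcol_0 abs_mult)
    ultimately show ?thesis using T' by (simp add: mult_left_mono)
  qed
  have "(\<lambda>m. T * ?e m) \<longlonglongrightarrow> T * 0"
  proof (rule tendsto_mult_left)
    have "(\<lambda>N. real N * Ez_tail (2 * exp T * T) (Suc N)) \<longlonglongrightarrow> 0"
      by (rule mult_Ez_tail_tendsto) (use T in simp)
    then show "?e \<longlonglongrightarrow> 0" by (rule LIMSEQ_Suc)
  qed
  then have lim: "(\<lambda>m. T * ?e m) \<longlonglongrightarrow> 0"
    by (simp only: mult_zero_right)
  have "(\<lambda>m. g m T - 1) \<longlonglongrightarrow> 0"
    by (intro Lim_null_comparison[OF always_eventually lim] allI) (simp only: real_norm_def bound)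
  then have "(\<lambda>m. g m T) \<longlonglongrightarrow> 1" by (simp add: LIM_zero_iff)
  then have "(\<lambda>m. g m T * exp (T\<^sup>2 / 2)) \<longlonglongrightarrow> 1 * exp (T\<^sup>2 / 2)"
    by (intro tendsto_intros)
  moreover have "g m T * exp (T\<^sup>2 / 2) = ldet (Suc m) (one_L T)" for m
  proof -
    have "ldet (Suc m) (Gcol T) = ldet (Suc m) (Grow 1 T)"
      using ldet_transpose[of "Suc m" "Grow 1 T"] by (simp add: Grow_eq_Gcol)
    moreover have "exp (- T\<^sup>2 / 2) * exp (T\<^sup>2 / 2) = 1" by (simp add: exp_minus)
    ultimately show ?thesis by (simp add: g_def ldet_Grow_A mult.assoc)
  qed
  ultimately have "(\<lambda>m. ldet (Suc m) (one_L T)) \<longlonglongrightarrow> exp (T\<^sup>2 / 2)" by simp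
  then show ?thesis by (rule LIMSEQ_imp_Suc)
qed

section \<open>Stability of determinants and complementary minors\<close>

lemma prod_add_diff_le:
  fixes a b e :: "nat \<Rightarrow> real"
  assumes "\<And>i. i < n \<Longrightarrow> 0 \<le> a i" "\<And>i. i < n \<Longrightarrow> a i \<le> b i" "\<And>i. i < n \<Longrightarrow> 1 \<le> b i"
    "\<And>i. i < n \<Longrightarrow> 0 \<le> e i"
  shows "(\<Prod>i<n. a i + e i) - (\<Prod>i<n. a i) \<le> (\<Sum>i<n. e i) * (\<Prod>i<n. b i + e i)"
  using assms
proof (induction n)
  case (Suc n)
  let ?X = "\<Prod>i<n. a i + e i" and ?Y = "\<Prod>i<n. a i" and ?B = "\<Prod>i<n. b i + e i"
  have IH: "?X - ?Y \<le> (\<Sum>i<n. e i) * ?B" using Suc by simp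
  have XB: "?X \<le> ?B" by (rule prod_mono) (use Suc.prems in \<open>auto intro: add_nonneg_nonneg\<close>)
  have "0 \<le> b i + e i" if "i < n" for i
    using Suc.prems(3)[of i] Suc.prems(4)[of i] that by simp
  then have B0: "0 \<le> ?B" by (intro prod_nonneg) auto
  have S0: "0 \<le> (\<Sum>i<n. e i)" by (rule sum_nonneg) (use Suc.prems in auto)
  have a: "0 \<le> a n" "a n \<le> b n" "1 \<le> b n" "0 \<le> e n" using Suc.prems by auto
  have "?X * (a n + e n) - ?Y * a n = (?X - ?Y) * a n + ?X * e n" by (simp add: algebra_simps)
  also have "\<dots> \<le> (\<Sum>i<n. e i) * ?B * b n + ?B * e n"
  proof (rule add_mono)
    have "(?X - ?Y) * a n \<le> ((\<Sum>i<n. e i) * ?B) * a n" by (intro mult_right_mono IH a)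
    also have "\<dots> \<le> (\<Sum>i<n. e i) * ?B * b n" by (intro mult_left_mono a mult_nonneg_nonneg S0 B0)
    finally show "(?X - ?Y) * a n \<le> (\<Sum>i<n. e i) * ?B * b n" .
    show "?X * e n \<le> ?B * e n" by (intro mult_right_mono XB a)
  qed
  also have "\<dots> \<le> ((\<Sum>i<n. e i) + e n) * (?B * (b n + e n))"
  proof -
    have "(\<Sum>i<n. e i) * ?B * b n \<le> (\<Sum>i<n. e i) * (?B * (b n + e n))"
      using a B0 S0 by (simp add: mult.assoc mult_left_mono)
    moreover have "?B * e n \<le> e n * (?B * (b n + e n))"
    proof -
      have "?B * e n * 1 \<le> ?B * e n * (b n + e n)"
        using a B0 by (intro mult_left_mono) auto
      then show ?thesis by (simp add: mult_ac)
    qed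
    ultimately show ?thesis by (simp add: distrib_right)
  qed
  finally show ?case by simp
qed simp

text \<open>A product of factors 1 + l i is at most the exponential of the sum of the l i, a bound
  independent of n if the l i are summable. So the determinants of growing truncations are uniformly
  stable.\<close>

lemma ldet_perturb:
  assumes Y: "\<And>i. i < n \<Longrightarrow> (\<Sum>j<n. \<bar>Y i j\<bar>) \<le> 1 + l i" and l: "\<And>i. i < n \<Longrightarrow> 0 \<le> l i"
  shows "\<bar>ldet n X - ldet n Y\<bar> \<le> (\<Sum>i<n. \<Sum>j<n. \<bar>X i j - Y i j\<bar>) *
    exp ((\<Sum>i<n. l i) + (\<Sum>i<n. \<Sum>j<n. \<bar>X i j - Y i j\<bar>))"
proof -
  let ?e = "\<lambda>i. \<Sum>j<n. \<bar>X i j - Y i j\<bar>"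
  have "\<bar>ldet n X - ldet n Y\<bar> \<le> (\<Sum>i<n. ?e i) * (\<Prod>i<n. (1 + l i) + ?e i)"
    by (rule order_trans[OF ldet_diff_le prod_add_diff_le]) (use Y l in \<open>auto intro: sum_nonneg\<close>)
  also have "\<dots> \<le> (\<Sum>i<n. ?e i) * (\<Prod>i<n. exp (l i + ?e i))"
  proof (intro mult_left_mono prod_mono conjI sum_nonneg)
    fix i assume "i \<in> {..<n}"
    show "(1 + l i) + ?e i \<le> exp (l i + ?e i)"
      using exp_ge_add_one_self[of "l i + ?e i"] by (simp add: add.assoc)
  next
    fix i assume "i \<in> {..<n}"
    then show "0 \<le> 1 + l i + ?e i" using l[of i] by (auto intro!: add_nonneg_nonneg sum_nonneg)
  qed auto
  also have "(\<Prod>i<n. exp (l i + ?e i)) = exp ((\<Sum>i<n. l i) + (\<Sum>i<n. ?e i))"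
    by (simp add: exp_sum[symmetric] sum.distrib)
  finally show ?thesis .
qed

lemma Ez_add_le:
  assumes "0 \<le> s" "0 \<le> a" "0 \<le> b"
  shows "Ez s (a + b) \<le> Ez s a * Ez s b"
proof -
  obtain m n where mn: "a = int m" "b = int n" using assms nonneg_int_cases by metis
  have "fact m * fact n \<le> (fact (m + n) :: real)"
    using fact_fact_dvd_fact[of m n, where ?'a = nat] dvd_imp_le[of "fact m * fact n" "fact (m + n) :: nat"]
    by (metis fact_gt_zero of_nat_fact of_nat_le_iff of_nat_mult)
  then have "s ^ (m + n) / fact (m + n) \<le> s ^ (m + n) / (fact m * fact n)"
    using assms(1) by (intro divide_left_mono) auto
  then show ?thesis
    by (simp add: mn power_add del: of_nat_add add: of_nat_add[symmetric])
qed

text \<open>With all signs dropped the sum is part of the binomial sum for Ez (2 t) (n + i), which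
  splits because m! n! <= (m + n)!. The majorant is a product of a function of n and one of i, both
  summable.\<close>

lemma abs_Lker_le:
  assumes "0 \<le> t" "1 \<le> n" "1 \<le> i"
  shows "\<bar>Lker t n i\<bar> \<le> Ez (2 * t) n * Ez (2 * t) i"
proof -
  have "\<bar>Lker t n i\<bar> \<le> (\<Sum>a=1..i. \<bar>sg a * Ez t (n + a) * Ez t (i - a)\<bar>)"
    unfolding Lker_def abs_minus_cancel by (rule sum_abs)
  also have "\<dots> = (\<Sum>a=1..i. Ez t (n + a) * Ez t (i - a))"
    using Ez_nonneg[OF assms(1)] by (simp add: abs_mult)
  also have "\<dots> = (\<Sum>b=n+1..n+i. Ez t b * Ez t (n + i - b))"
    by (rule sum.reindex_bij_witness[of _ "\<lambda>b. b - n" "\<lambda>a. n + a"]) auto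
  also have "\<dots> \<le> (\<Sum>b=0..n+i. Ez t b * Ez t (n + i - b))"
    by (rule sum_mono2) (use assms Ez_nonneg[OF assms(1)] in auto)
  also have "\<dots> = Ez (2 * t) (n + i)"
    using Ez_add_finite[of "n + i" t t] assms by simp
  also have "\<dots> \<le> Ez (2 * t) n * Ez (2 * t) i"
    by (rule Ez_add_le) (use assms in auto)
  finally show ?thesis .
qed

definition Rn :: "real \<Rightarrow> nat \<Rightarrow> nat \<Rightarrow> real" where
  "Rn t i j = resK t (int i + 1) (int j + 1)"

definition Lerr :: "real \<Rightarrow> nat \<Rightarrow> nat \<Rightarrow> nat \<Rightarrow> real" where
  "Lerr t N r c = (\<Sum>\<^sub>\<infinity>i\<in>{int N + 1..}. Lker t (int r + 1) i * resK t i (int c + 1))"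

lemma Lker_resK_row_summable:
  assumes "0 \<le> t" "1 \<le> n" "A \<subseteq> {1..}"
  shows "(\<lambda>i. Lker t n i * resK t i k) summable_on A"
proof -
  obtain C where C: "0 \<le> C" "\<And>n k. \<bar>resK t n k\<bar> \<le> C" using resK_bounded[of t] by blast
  show ?thesis
  proof (rule summable_on_real_comparison)
    show "(\<lambda>i. (Ez (2 * t) n * C) * Ez (2 * t) i) summable_on A"
      by (intro summable_on_cmult_right Ez_summable_on)
    fix i assume "i \<in> A"
    then have "\<bar>Lker t n i\<bar> * \<bar>resK t i k\<bar> \<le> (Ez (2 * t) n * Ez (2 * t) i) * C"
      using assms C by (intro mult_mono abs_Lker_le mult_nonneg_nonneg Ez_nonneg) auto
    then show "\<bar>Lker t n i * resK t i k\<bar> \<le> \<bar>(Ez (2 * t) n * C) * Ez (2 * t) i\<bar>"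
      using C Ez_nonneg[of "2 * t"] assms by (simp add: abs_mult mult_ac)
  qed
qed

lemma one_L_mult_Rn:
  assumes "0 \<le> t" "r < N"
  shows "(\<Sum>i<N. one_L t r i * Rn t i c) = (if r = c then 1 else 0) - Lerr t N r c"
proof -
  let ?f = "\<lambda>i. Lker t (int r + 1) i * resK t i (int c + 1)"
  have "(\<Sum>i<N. one_L t r i * Rn t i c) =
      (\<Sum>i<N. if r = i then Rn t i c else 0) + (\<Sum>i<N. ?f (int i + 1))"
    using sum_delta_plus[of r 1 "\<lambda>i. Lker t (int r + 1) (int i + 1)" "\<lambda>i. Rn t i c" "{..<N}"]
    by (simp add: one_L_def) (simp add: Rn_def)
  also have "(\<Sum>i<N. if r = i then Rn t i c else 0) = Rn t r c" using assms by simp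
  also have "(\<Sum>i<N. ?f (int i + 1)) = infsum ?f {1..int N}"
    using sum_int_interval[of ?f N] by simp
  finally have 1: "(\<Sum>i<N. one_L t r i * Rn t i c) = Rn t r c + infsum ?f {1..int N}" .
  have "{1..int N} \<union> {int N + 1..} = {1..}" by auto
  then have "infsum ?f {1..} = infsum ?f ({1..int N} \<union> {int N + 1..})" by simp
  also have "\<dots> = infsum ?f {1..int N} + Lerr t N r c"
    unfolding Lerr_def
    by (rule infsum_Un_disjoint) (auto intro!: Lker_resK_row_summable assms)
  finally have "infsum ?f {1..int N} = infsum ?f {1..} - Lerr t N r c" by simp
  then show ?thesis
    using 1 one_plus_Lker_mult_resK[of "int r + 1" "int c + 1" t] by (simp add: Rn_def)
qed

lemma abs_Lerr_le:
  assumes "0 \<le> t" "\<And>n k. \<bar>resK t n k\<bar> \<le> C"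
  shows "\<bar>Lerr t N r c\<bar> \<le> Ez (2 * t) (int r + 1) * (C * Ez_tail (2 * t) (Suc N))"
proof -
  let ?f = "\<lambda>i. Lker t (int r + 1) i * resK t i (int c + 1)"
  have C: "0 \<le> C" using assms(2)[of 0 0] by (rule order_trans[OF abs_ge_zero])
  have s2: "(\<lambda>i. \<bar>?f i\<bar>) summable_on {int N + 1..}"
    unfolding summable_on_abs_iff by (rule Lker_resK_row_summable) (use assms in auto)
  have s1: "(\<lambda>i. (Ez (2 * t) (int r + 1) * C) * Ez (2 * t) i) summable_on {int N + 1..}"
    by (intro summable_on_cmult_right Ez_summable_on)
  have "\<bar>Lerr t N r c\<bar> \<le> (\<Sum>\<^sub>\<infinity>i\<in>{int N + 1..}. \<bar>?f i\<bar>)"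
    unfolding Lerr_def using norm_infsum_bound[of ?f "{int N + 1..}"] s2 by simp
  also have "\<dots> \<le> (\<Sum>\<^sub>\<infinity>i\<in>{int N + 1..}. (Ez (2 * t) (int r + 1) * C) * Ez (2 * t) i)"
  proof (rule infsum_mono[OF s2 s1])
    fix i assume "i \<in> {int N + 1..}"
    then have "\<bar>Lker t (int r + 1) i\<bar> * \<bar>resK t i (int c + 1)\<bar> \<le> (Ez (2 * t) (int r + 1) * Ez (2 * t) i) * C"
      using assms C by (intro mult_mono abs_Lker_le mult_nonneg_nonneg Ez_nonneg) auto
    then show "\<bar>?f i\<bar> \<le> (Ez (2 * t) (int r + 1) * C) * Ez (2 * t) i"
      by (simp add: abs_mult mult_ac)
  qed
  also have "\<dots> = Ez (2 * t) (int r + 1) * (C * Ez_tail (2 * t) (Suc N))"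
    by (simp add: infsum_cmult_right' Ez_tail_def mult.assoc add.commute)
  finally show ?thesis .
qed

text \<open>Jacobi's complementary minor identity, with an error term for the truncation to size \<open>N\<close>.\<close>

lemma ldet_complement:
  assumes t: "0 \<le> t" and mN: "m \<le> N" and C: "\<And>n k. \<bar>resK t n k\<bar> \<le> C"
  shows "\<bar>ldet N (one_L t) * ldet (N - m) (\<lambda>i j. Rn t (m + i) (m + j)) - ldet m (one_L t)\<bar> \<le>
    exp (2 * t) * (C * (real N * Ez_tail (2 * t) (Suc N))) *
      exp (exp (2 * t) * exp (2 * t) + exp (2 * t) * (C * (real N * Ez_tail (2 * t) (Suc N))))"
proof -
  \<comment> \<open>The first m columns of P are unit vectors, the others those of the inverse. Then
    (1 + L) P has the first m columns of 1 + L followed by unit vectors, up to the truncation error: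
    this is Y. Both P and Y are block triangular.\<close>
  define P where "P i j = (if j < m then (if i = j then 1 else 0) else Rn t i j)" for i j
  define Q where "Q r c = (\<Sum>i<N. one_L t r i * P i c)" for r c
  define Y where "Y r c = (if c < m then one_L t r c else if r = c then 1 else 0)" for r c
  let ?u = "\<lambda>i::nat. Ez (2 * t) (int i + 1)"
  have u0: "0 \<le> ?u i" for i by (rule Ez_nonneg) (use t in simp)
  have sum_u: "(\<Sum>i<N. ?u i) \<le> exp (2 * t)"
    by (rule sum_Ez_shift_le) (use t in \<open>auto simp: inj_on_def\<close>)
  have C0: "0 \<le> C" using C[of 0 0] by (rule order_trans[OF abs_ge_zero])
  have T0: "0 \<le> Ez_tail (2 * t) (Suc N)" by (rule Ez_tail_nonneg) (use t in simp)
  obtain d where d: "N = m + d" using mN le_Suc_ex by blast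
  have detP: "ldet N P = ldet (N - m) (\<lambda>i j. Rn t (m + i) (m + j))"
  proof -
    have "ldet N P = ldet m P * ldet d (\<lambda>i j. P (m + i) (m + j))"
      unfolding d by (rule ldet_block) (auto simp: P_def)
    also have "ldet m P = 1" by (subst ldet_upper_triangular) (auto simp: P_def)
    also have "ldet d (\<lambda>i j. P (m + i) (m + j)) = ldet (N - m) (\<lambda>i j. Rn t (m + i) (m + j))"
      by (simp add: d P_def)
    finally show ?thesis by simp
  qed
  have detQ: "ldet N Q = ldet N (one_L t) * ldet N P"
    unfolding Q_def by (rule ldet_mult)
  have detY: "ldet N Y = ldet m (one_L t)"
  proof -
    have "ldet N Y = ldet (m + d) (\<lambda>i j. Y j i)" by (simp add: ldet_transpose[of "m + d" Y] d)
    also have "\<dots> = ldet m (\<lambda>i j. Y j i) * ldet d (\<lambda>i j. Y (m + j) (m + i))"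
      by (rule ldet_block) (auto simp: Y_def)
    also have "ldet d (\<lambda>i j. Y (m + j) (m + i)) = 1"
      by (subst ldet_upper_triangular) (auto simp: Y_def)
    also have "ldet m (\<lambda>i j. Y j i) = ldet m Y" by (rule ldet_transpose)
    also have "ldet m Y = ldet m (one_L t)" by (rule ldet_cong) (auto simp: Y_def)
    finally show ?thesis by simp
  qed
  have diff: "\<bar>Q r c - Y r c\<bar> \<le> ?u r * (C * Ez_tail (2 * t) (Suc N))" if r: "r < N" "c < N" for r c
  proof (cases "c < m")
    case True
    have "Q r c = (\<Sum>i<N. if i = c then one_L t r i else 0)"
      unfolding Q_def using True by (intro sum.cong) (auto simp: P_def)
    then have "Q r c = Y r c" using r True by (simp add: Y_def)
    then show ?thesis using u0 C0 T0 by simp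
  next
    case False
    then have "Q r c = (if r = c then 1 else 0) - Lerr t N r c"
      unfolding Q_def P_def using one_L_mult_Rn[OF t r(1)] by simp
    then have "\<bar>Q r c - Y r c\<bar> = \<bar>Lerr t N r c\<bar>" using False by (simp add: Y_def)
    then show ?thesis using abs_Lerr_le[OF t C] by simp
  qed
  have Yrow: "(\<Sum>c<N. \<bar>Y r c\<bar>) \<le> 1 + ?u r * exp (2 * t)" if r: "r < N" for r
  proof -
    have "(\<Sum>c<N. \<bar>Y r c\<bar>) \<le> (\<Sum>c<N. (if r = c then 1 else 0) + ?u r * ?u c)"
    proof (rule sum_mono)
      fix c
      have "\<bar>one_L t r c\<bar> \<le> (if r = c then 1 else 0) + \<bar>Lker t (int r + 1) (int c + 1)\<bar>"
        unfolding one_L_def by (rule order_trans[OF abs_triangle_ineq]) auto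
      also have "\<dots> \<le> (if r = c then 1 else 0) + ?u r * ?u c"
        by (intro add_left_mono abs_Lker_le t) auto
      finally show "\<bar>Y r c\<bar> \<le> (if r = c then 1 else 0) + ?u r * ?u c"
        using u0 by (auto simp: Y_def)
    qed
    also have "\<dots> = 1 + ?u r * (\<Sum>c<N. ?u c)"
      using r by (simp add: sum.distrib sum_distrib_left)
    also have "\<dots> \<le> 1 + ?u r * exp (2 * t)"
      by (intro add_left_mono mult_left_mono sum_u u0)
    finally show ?thesis .
  qed
  let ?E = "\<Sum>i<N. \<Sum>j<N. \<bar>Q i j - Y i j\<bar>"
  let ?B = "exp (2 * t) * (C * (real N * Ez_tail (2 * t) (Suc N)))"
  have E: "?E \<le> ?B"
  proof -
    have "?E \<le> (\<Sum>i<N. \<Sum>j<N. ?u i * (C * Ez_tail (2 * t) (Suc N)))"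
      by (intro sum_mono diff) auto
    also have "\<dots> = (\<Sum>i<N. ?u i) * (C * (real N * Ez_tail (2 * t) (Suc N)))"
      by (simp add: sum_distrib_right sum_distrib_left mult_ac)
    also have "\<dots> \<le> ?B"
      by (intro mult_right_mono sum_u mult_nonneg_nonneg C0 T0) auto
    finally show ?thesis .
  qed
  have E0: "0 \<le> ?E" by (intro sum_nonneg) auto
  have "\<bar>ldet N Q - ldet N Y\<bar> \<le> ?E * exp ((\<Sum>i<N. ?u i * exp (2 * t)) + ?E)"
    by (rule ldet_perturb) (use Yrow u0 in auto)
  also have "\<dots> \<le> ?B * exp (exp (2 * t) * exp (2 * t) + ?B)"
  proof (intro mult_mono E)
    have "(\<Sum>i<N. ?u i * exp (2 * t)) \<le> exp (2 * t) * exp (2 * t)"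
      unfolding sum_distrib_right[symmetric] by (intro mult_right_mono sum_u) auto
    then show "exp ((\<Sum>i<N. ?u i * exp (2 * t)) + ?E) \<le> exp (exp (2 * t) * exp (2 * t) + ?B)"
      using E by simp
    show "0 \<le> ?B" using E E0 by simp
  qed simp
  finally show ?thesis by (simp add: detQ detP detY)
qed

text \<open>The place where the normalisation is used: the determinant of the whole matrix tends to
  exp (t^2/2), which is not 0, and may be divided out.\<close>

lemma ldet_Rn_tendsto:
  assumes t: "0 \<le> t"
  shows "(\<lambda>N. ldet (N - m) (\<lambda>i j. Rn t (m + i) (m + j))) \<longlonglongrightarrow> exp (- t\<^sup>2 / 2) * ldet m (one_L t)"
proof -
  obtain C where C: "0 \<le> C" "\<And>n k. \<bar>resK t n k\<bar> \<le> C" using resK_bounded[of t] by blast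
  let ?a = "\<lambda>N. ldet (N - m) (\<lambda>i j. Rn t (m + i) (m + j))"
  let ?x = "\<lambda>N. real N * Ez_tail (2 * t) (Suc N)"
  have x: "?x \<longlonglongrightarrow> 0" by (rule mult_Ez_tail_tendsto) (use t in simp)
  have "(\<lambda>N. exp (2 * t) * (C * ?x N) * exp (exp (2 * t) * exp (2 * t) + exp (2 * t) * (C * ?x N)))
      \<longlonglongrightarrow> exp (2 * t) * (C * 0) * exp (exp (2 * t) * exp (2 * t) + exp (2 * t) * (C * 0))"
    by (intro tendsto_intros x)
  then have b: "(\<lambda>N. exp (2 * t) * (C * ?x N) * exp (exp (2 * t) * exp (2 * t) + exp (2 * t) * (C * ?x N)))
      \<longlonglongrightarrow> 0" by simp
  have "(\<lambda>N. ldet N (one_L t) * ?a N - ldet m (one_L t)) \<longlonglongrightarrow> 0"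
    by (rule Lim_null_comparison[OF _ b], rule eventually_sequentiallyI[of m])
       (use ldet_complement[OF t _ C(2)] in simp)
  then have 1: "(\<lambda>N. ldet N (one_L t) * ?a N) \<longlonglongrightarrow> ldet m (one_L t)"
    by (simp add: LIM_zero_iff)
  have 2: "(\<lambda>N. ldet N (one_L t)) \<longlonglongrightarrow> exp (t\<^sup>2 / 2)" by (rule ldet_one_L_tendsto[OF t])
  have "(\<lambda>N. ldet N (one_L t) * ?a N / ldet N (one_L t)) \<longlonglongrightarrow> ldet m (one_L t) / exp (t\<^sup>2 / 2)"
    by (intro tendsto_divide 1 2) simp
  moreover have "\<forall>\<^sub>F N in sequentially. ldet N (one_L t) * ?a N / ldet N (one_L t) = ?a N"
  proof -
    have "\<forall>\<^sub>F N in sequentially. ldet N (one_L t) > 0"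
      using order_tendstoD(1)[OF 2, of 0] by simp
    then show ?thesis by eventually_elim simp
  qed
  ultimately have "?a \<longlonglongrightarrow> ldet m (one_L t) / exp (t\<^sup>2 / 2)"
    by (rule Lim_transform_eventually)
  then show ?thesis by (simp add: exp_minus field_simps)
qed

section \<open>Bessel functions in the transition region\<close>

lemma integral_cis:
  "((\<lambda>x. cis (real_of_int n * x)) has_integral (if n = 0 then 2 * pi else 0)) {- pi..pi}"
proof (cases "n = 0")
  case True
  then show ?thesis
    using has_integral_const_real[of "1 :: complex" "- pi" pi] by (simp add: scaleR_conv_of_real)
next
  case False
  let ?F = "\<lambda>x. cis (real_of_int n * x) / (\<i> * of_int n)"
  have "((\<lambda>x. cis (real_of_int n * x)) has_integral (?F pi - ?F (- pi))) {- pi..pi}"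
  proof (rule fundamental_theorem_of_calculus)
    fix x
    have "((\<lambda>x. cis (real_of_int n * x)) has_vector_derivative real_of_int n *\<^sub>R (\<i> * cis (real_of_int n * x))) (at x within {- pi..pi})"
      unfolding cis_conv_exp
      by (rule has_vector_derivative_eq_rhs, rule field_vector_diff_chain_within[unfolded o_def, where f = "\<lambda>x. \<i> * of_real (real_of_int n * x)" and f' = "\<i> * of_int n"])
         (auto intro!: derivative_eq_intros has_vector_derivative_mult_right has_vector_derivative_of_real
           simp: scaleR_conv_of_real has_field_derivative_at_within)
    then have "((\<lambda>x. cis (real_of_int n * x) / (\<i> * of_int n)) has_vector_derivative
        (real_of_int n *\<^sub>R (\<i> * cis (real_of_int n * x))) / (\<i> * of_int n)) (at x within {- pi..pi})"
      by (rule has_vector_derivative_divide)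
    then show "(?F has_vector_derivative cis (real_of_int n * x)) (at x within {- pi..pi})"
      using False by (simp add: scaleR_conv_of_real)
  qed simp
  moreover have "cis (real_of_int n * pi) = cis (real_of_int n * (- pi))"
    using sin_npi_int[of n] by (simp add: complex_eq_iff mult.commute)
  ultimately show ?thesis using False by simp
qed

text \<open>The exponential series converges uniformly on the interval and may be integrated term by
  term. The factor h leaves room for the other exponential, so that exp (t z) and exp (-t/z) are
  treated one after the other, with s = 1 and s = -1.\<close>

lemma integral_exp_cis_series:
  fixes h :: "real \<Rightarrow> complex" and w :: complex
  assumes h: "continuous_on {a..b} h"
  shows "(\<lambda>k. (w ^ k / fact k) * integral {a..b} (\<lambda>x. h x * cis (s * (real k * x)))) sums
    integral {a..b} (\<lambda>x. h x * exp (w * cis (s * x)))"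
proof -
  let ?f = "\<lambda>k x. h x * ((w * cis (s * x)) ^ k / fact k)"
  obtain B where "\<forall>y\<in>h ` {a..b}. norm y \<le> B"
    using compact_imp_bounded[OF compact_continuous_image[OF h compact_Icc]]
    unfolding bounded_iff by blast
  then have B: "\<And>x. x \<in> {a..b} \<Longrightarrow> norm (h x) \<le> B" by auto
  have "uniform_limit {a..b} (\<lambda>n x. \<Sum>k<n. ?f k x) (\<lambda>x. suminf (\<lambda>k. ?f k x)) sequentially"
  proof (rule Weierstrass_m_test)
    show "norm (?f k x) \<le> B * (norm w ^ k / fact k)" if "x \<in> {a..b}" for k x
      using mult_right_mono[OF B[OF that], of "norm w ^ k / fact k"]
      by (simp add: norm_mult norm_divide norm_power power_mult_distrib)
    show "summable (\<lambda>k. B * (norm w ^ k / fact k))"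
      using summable_exp[of "norm w"] by (intro summable_mult) (simp add: field_simps)
  qed
  moreover have "suminf (\<lambda>k. ?f k x) = h x * exp (w * cis (s * x))" for x
  proof -
    have "(\<lambda>k. (w * cis (s * x)) ^ k / fact k) sums exp (w * cis (s * x))"
      using exp_converges[of "w * cis (s * x)"] by (simp add: scaleR_conv_of_real field_simps)
    from sums_mult[OF this, of "h x"] show ?thesis by (rule sums_unique[symmetric])
  qed
  ultimately have u: "uniform_limit {a..b} (\<lambda>n x. \<Sum>k<n. ?f k x) (\<lambda>x. h x * exp (w * cis (s * x))) sequentially"
    by simp
  have c: "continuous_on {a..b} (\<lambda>x. ?f k x)" for k
    by (intro continuous_intros h continuous_on_cis) auto
  obtain I K where I: "\<And>n. ((\<lambda>x. \<Sum>k<n. ?f k x) has_integral I n) {a..b}"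
    "((\<lambda>x. h x * exp (w * cis (s * x))) has_integral K) {a..b}" "I \<longlonglongrightarrow> K"
    using uniform_limit_integral[OF u continuous_on_sum[OF c] sequentially_bot] by blast
  have In: "I n = (\<Sum>k<n. (w ^ k / fact k) * integral {a..b} (\<lambda>x. h x * cis (s * (real k * x))))" for n
  proof -
    have "I n = integral {a..b} (\<lambda>x. \<Sum>k<n. ?f k x)" by (rule integral_unique[symmetric, OF I(1)])
    also have "\<dots> = (\<Sum>k<n. integral {a..b} (?f k))"
      by (intro integral_sum finite_lessThan integrable_continuous_real c)
    also have "\<dots> = (\<Sum>k<n. (w ^ k / fact k) * integral {a..b} (\<lambda>x. h x * cis (s * (real k * x))))"
    proof (rule sum.cong[OF refl])
      fix k
      have "cis (s * x) ^ k = cis (s * (real k * x))" for x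
        using Complex.DeMoivre[of "s * x" k] by (simp add: mult.left_commute)
      then have "?f k = (\<lambda>x. (w ^ k / fact k) * (h x * cis (s * (real k * x))))"
        by (simp add: fun_eq_iff power_mult_distrib)
      then show "integral {a..b} (?f k) = (w ^ k / fact k) * integral {a..b} (\<lambda>x. h x * cis (s * (real k * x)))"
        by simp
    qed
    finally show ?thesis .
  qed
  show ?thesis using I(3) unfolding sums_def integral_unique[OF I(2)] In[symmetric] .
qed

lemma integral_exp_cis_coeff:
  "integral {- pi..pi} (\<lambda>x. cis (- (real_of_int n * x)) * exp (of_real u * cis x)) = of_real (2 * pi * Ez u n)"
proof -
  have 0: "(\<lambda>k. (of_real u ^ k / fact k) * integral {- pi..pi} (\<lambda>x. cis (- (real_of_int n * x)) * cis (1 * (real k * x)))) sums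
      integral {- pi..pi} (\<lambda>x. cis (- (real_of_int n * x)) * exp (of_real u * cis (1 * x)))"
    by (rule integral_exp_cis_series) (intro continuous_intros continuous_on_cis)
  have I: "integral {- pi..pi} (\<lambda>x. cis (- (real_of_int n * x)) * cis (1 * (real k * x))) =
      (if int k = n then 2 * pi else 0)" for k
  proof -
    have "(\<lambda>x. cis (- (real_of_int n * x)) * cis (1 * (real k * x))) = (\<lambda>x. cis (real_of_int (int k - n) * x))"
      by (simp add: cis_mult algebra_simps)
    then show ?thesis using integral_unique[OF integral_cis[of "int k - n"]] by simp
  qed
  have e: "(\<lambda>k. (of_real u ^ k / fact k) * integral {- pi..pi} (\<lambda>x. cis (- (real_of_int n * x)) * cis (1 * (real k * x)))) =
      (\<lambda>k. if int k = n then of_real u ^ k / fact k * of_real (2 * pi) else 0)"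
    by (rule ext, subst I, simp)
  have 1: "(\<lambda>k. if int k = n then of_real u ^ k / fact k * of_real (2 * pi) else 0) sums
      integral {- pi..pi} (\<lambda>x. cis (- (real_of_int n * x)) * exp (of_real u * cis x))"
    using 0 unfolding e by simp
  have 2: "(\<lambda>k. if int k = n then of_real u ^ k / fact k * of_real (2 * pi) else 0) sums
      (of_real (2 * pi * Ez u n) :: complex)"
  proof (cases "n < 0")
    case True
    then have "(\<lambda>k. if int k = n then of_real u ^ k / fact k * of_real (2 * pi) else 0 :: complex) = (\<lambda>_. 0)"
      by (auto simp: fun_eq_iff)
    then show ?thesis using True by simp
  next
    case False
    then obtain N where N: "n = int N" using nonneg_int_cases by (metis not_less)
    show ?thesis
      using sums_single[of N "\<lambda>k. of_real u ^ k / fact k * of_real (2 * pi) :: complex"]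
      by (simp add: N mult.commute)
  qed
  show ?thesis using sums_unique2[OF 1 2] .
qed

lemma bess_sums: "(\<lambda>k. (-1) ^ k * Ez t (n + int k) * (t ^ k / fact k)) sums bess t n"
proof -
  let ?f = "\<lambda>k. sg k * Ez t (n + k) * Ez t k"
  obtain C where C: "0 \<le> C" "\<And>z. \<bar>Ez t z\<bar> \<le> C"
    using summable_on_bounded[OF Ez_summable[of t]] by auto
  have "?f summable_on UNIV"
  proof (rule summable_on_real_comparison)
    show "(\<lambda>k. C * Ez t k) summable_on UNIV" by (intro summable_on_cmult_right Ez_summable)
    show "\<bar>?f k\<bar> \<le> \<bar>C * Ez t k\<bar>" for k
      using mult_right_mono[OF C(2)[of "n + k"], of "\<bar>Ez t k\<bar>"] C(1) by (simp add: abs_mult)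
  qed
  then have "(?f has_sum bess t n) UNIV" by (simp add: bess_eq)
  then have "(?f has_sum bess t n) {0..}"
    by (rule has_sum_cong_neutral[THEN iffD1, rotated -1]) auto
  moreover have "range int = {0..}" using zero_le_imp_eq_int by auto
  ultimately have "(?f has_sum bess t n) (int ` UNIV)" by simp
  then have "(?f \<circ> int has_sum bess t n) UNIV"
    by (subst (asm) has_sum_reindex) auto
  then show ?thesis
    using has_sum_imp_sums[of "?f \<circ> int"] by (simp add: o_def sg_of_nat)
qed

text \<open>Cauchy's formula for a Laurent coefficient on the circle of radius exp s. The radius is
  free: s = 0 gives the oscillatory integral, small s > 0 the exponential bound.\<close>

lemma bess_integral:
  "integral {- pi..pi} (\<lambda>x. cis (- (real_of_int n * x)) * exp (of_real (t * exp s) * cis x) *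
      exp (of_real (- t * exp (- s)) * cis (- x))) = of_real (2 * pi * exp (s * real_of_int n) * bess t n)"
proof -
  let ?h = "\<lambda>x. cis (- (real_of_int n * x)) * exp (of_real (t * exp s) * cis x)"
  let ?w = "of_real (- t * exp (- s)) :: complex"
  have 1: "(\<lambda>k. (?w ^ k / fact k) * integral {- pi..pi} (\<lambda>x. ?h x * cis ((- 1) * (real k * x)))) sums
      integral {- pi..pi} (\<lambda>x. ?h x * exp (?w * cis ((- 1) * x)))"
    by (rule integral_exp_cis_series) (intro continuous_intros continuous_on_cis)
  have 2: "(?w ^ k / fact k) * integral {- pi..pi} (\<lambda>x. ?h x * cis ((- 1) * (real k * x))) =
      of_real (2 * pi * exp (s * real_of_int n) * ((-1) ^ k * Ez t (n + int k) * (t ^ k / fact k)))" for k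
  proof -
    have "(\<lambda>x. ?h x * cis ((- 1) * (real k * x))) =
        (\<lambda>x. cis (- (real_of_int (n + int k) * x)) * exp (of_real (t * exp s) * cis x))"
    proof
      fix x
      have "cis (- (real_of_int n * x)) * cis ((- 1) * (real k * x)) = cis (- (real_of_int (n + int k) * x))"
        by (simp add: cis_mult algebra_simps)
      then show "?h x * cis ((- 1) * (real k * x)) =
          cis (- (real_of_int (n + int k) * x)) * exp (of_real (t * exp s) * cis x)"
        by (metis mult.assoc mult.commute)
    qed
    then have I: "integral {- pi..pi} (\<lambda>x. ?h x * cis ((- 1) * (real k * x))) =
        of_real (2 * pi * Ez (t * exp s) (n + int k))"
      by (simp only: integral_exp_cis_coeff)
    have E: "exp (- s) ^ k * Ez (t * exp s) (n + int k) = exp (s * real_of_int n) * Ez t (n + int k)"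
    proof (cases "n + int k < 0")
      case False
      have "exp (- s) ^ k * exp s ^ nat (n + int k) = exp (s * real_of_int n)"
        using False by (simp add: exp_of_nat_mult[symmetric] exp_add[symmetric] algebra_simps)
      then show ?thesis using False by (simp add: Ez_def power_mult_distrib field_simps)
    qed simp
    have "(?w ^ k / fact k) * of_real (2 * pi * Ez (t * exp s) (n + int k)) =
        of_real ((- t * exp (- s)) ^ k / fact k * (2 * pi * Ez (t * exp s) (n + int k)))"
      by simp
    also have "(- t * exp (- s)) ^ k / fact k * (2 * pi * Ez (t * exp s) (n + int k)) =
        (- t) ^ k / fact k * (2 * pi) * (exp (- s) ^ k * Ez (t * exp s) (n + int k))"
      by (simp only: power_mult_distrib) simp
    also have "of_real \<dots> = (of_real (2 * pi * exp (s * real_of_int n) * ((-1) ^ k * Ez t (n + int k) * (t ^ k / fact k))) :: complex)"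
      unfolding E by (simp add: power_minus[of t] mult_ac)
    finally show ?thesis unfolding I .
  qed
  have "(\<lambda>k. of_real (2 * pi * exp (s * real_of_int n) * ((-1) ^ k * Ez t (n + int k) * (t ^ k / fact k))) :: complex)
      sums of_real (2 * pi * exp (s * real_of_int n) * bess t n)"
    by (intro sums_of_real sums_mult bess_sums)
  then show ?thesis
    using sums_unique2[OF 1[unfolded 2]] by simp
qed

lemma bess_integrand:
  "cis (- (real_of_int n * x)) * exp (of_real (t * exp s) * cis x) * exp (of_real (- t * exp (- s)) * cis (- x)) =
    of_real (exp (2 * t * sinh s * cos x)) * cis (2 * t * cosh s * sin x - real_of_int n * x)"
proof -
  have "exp (of_real (t * exp s) * cis x) * exp (of_real (- t * exp (- s)) * cis (- x)) =
      exp (of_real (2 * t * sinh s * cos x) + \<i> * of_real (2 * t * cosh s * sin x))"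
    unfolding exp_add[symmetric]
    by (rule arg_cong[where f = exp]) (simp add: complex_eq_iff sinh_field_def cosh_field_def algebra_simps)
  also have "\<dots> = of_real (exp (2 * t * sinh s * cos x)) * cis (2 * t * cosh s * sin x)"
    by (simp only: exp_add cis_conv_exp exp_of_real)
  finally have "cis (- (real_of_int n * x)) * (exp (of_real (t * exp s) * cis x) * exp (of_real (- t * exp (- s)) * cis (- x))) =
      of_real (exp (2 * t * sinh s * cos x)) * (cis (- (real_of_int n * x)) * cis (2 * t * cosh s * sin x))"
    by (simp add: mult_ac)
  then show ?thesis by (simp add: cis_mult mult.assoc)
qed

section \<open>An exponential bound for all indices\<close>

lemma sin_ge_third:
  fixes y :: real
  assumes "0 \<le> y" "y \<le> pi / 2"
  shows "y / 3 \<le> sin y"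
proof -
  \<comment> \<open>On this range y^3/6 <= 2 y/3, so the cubic Taylor bound leaves y/3.\<close>
  have y2: "y < 2" using assms pi_half_less_two by linarith
  have "\<bar>sin y - (\<Sum>m<3. sin_coeff m * y ^ m)\<bar> \<le> inverse (fact 3) * \<bar>y\<bar> ^ 3"
    by (rule Maclaurin_sin_bound)
  moreover have "(\<Sum>m<3. sin_coeff m * y ^ m) = y"
    by (simp add: sin_coeff_def numeral_3_eq_3)
  ultimately have "y - y ^ 3 / 6 \<le> sin y"
  proof -
    assume a: "\<bar>sin y - (\<Sum>m<3. sin_coeff m * y ^ m)\<bar> \<le> inverse (fact 3) * \<bar>y\<bar> ^ 3"
      and b: "(\<Sum>m<3. sin_coeff m * y ^ m) = y"
    have "\<bar>sin y - y\<bar> \<le> y ^ 3 / 6" using a assms unfolding b by (simp add: fact_numeral)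
    moreover have "y - sin y \<le> \<bar>sin y - y\<bar>" by simp
    ultimately show ?thesis by linarith
  qed
  moreover have "y ^ 3 \<le> 4 * y"
  proof -
    have "y * y \<le> 2 * 2" using assms y2 by (intro mult_mono) auto
    then have "y * y * y \<le> 4 * y" using assms by (intro mult_right_mono) auto
    then show ?thesis by (simp add: power3_eq_cube)
  qed
  ultimately show ?thesis by simp
qed

text \<open>Half-angle formula with sin y >= y/3: 2 (x/6)^2 = x^2/18. The constants 18 and 54 of the
  oscillatory estimates go back to this one.\<close>

lemma cos_le_quadratic:
  fixes x :: real
  assumes "\<bar>x\<bar> \<le> pi"
  shows "cos x \<le> 1 - x\<^sup>2 / 18"
proof -
  have "\<bar>x\<bar> / 2 / 3 \<le> sin (\<bar>x\<bar> / 2)" by (rule sin_ge_third) (use assms in auto)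
  then have "(\<bar>x\<bar> / 6)\<^sup>2 \<le> (sin (\<bar>x\<bar> / 2))\<^sup>2" by (intro power_mono) auto
  moreover have "cos \<bar>x\<bar> = 1 - 2 * (sin (\<bar>x\<bar> / 2))\<^sup>2"
    using cos_double_sin[of "\<bar>x\<bar> / 2"] by simp
  ultimately show ?thesis by (simp add: power_divide)
qed

text \<open>The integrand majorises the Gaussian exp (-a x^2) and has an arctangent as
  primitive.\<close>

lemma integral_inverse_quadratic_le:
  fixes a :: real
  assumes "0 < a"
  shows "(\<lambda>x. 1 / (1 + a * x\<^sup>2)) integrable_on {- pi..pi}"
    "integral {- pi..pi} (\<lambda>x. 1 / (1 + a * x\<^sup>2)) \<le> pi / sqrt a"
proof -
  let ?F = "\<lambda>x. arctan (sqrt a * x) / sqrt a"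
  have pos: "1 + a * x\<^sup>2 > 0" for x using assms by (simp add: add_pos_nonneg)
  have "((\<lambda>x. 1 / (1 + a * x\<^sup>2)) has_integral (?F pi - ?F (- pi))) {- pi..pi}"
  proof (rule fundamental_theorem_of_calculus)
    fix x
    have "((\<lambda>x. arctan (sqrt a * x) / sqrt a) has_real_derivative
        (inverse (1 + (sqrt a * x)\<^sup>2) * (sqrt a * 1)) / sqrt a) (at x)"
      using assms
      by (intro DERIV_cdivide DERIV_chain2[OF DERIV_arctan] DERIV_cmult DERIV_ident)
    moreover have "(inverse (1 + (sqrt a * x)\<^sup>2) * (sqrt a * 1)) / sqrt a = 1 / (1 + a * x\<^sup>2)"
      using assms by (simp add: power_mult_distrib divide_inverse)
    ultimately show "(?F has_vector_derivative 1 / (1 + a * x\<^sup>2)) (at x within {- pi..pi})"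
      by (simp add: has_real_derivative_iff_has_vector_derivative[symmetric] has_field_derivative_at_within)
  qed simp
  then show "(\<lambda>x. 1 / (1 + a * x\<^sup>2)) integrable_on {- pi..pi}"
    "integral {- pi..pi} (\<lambda>x. 1 / (1 + a * x\<^sup>2)) \<le> pi / sqrt a"
  proof -
    assume I: "((\<lambda>x. 1 / (1 + a * x\<^sup>2)) has_integral (?F pi - ?F (- pi))) {- pi..pi}"
    show "(\<lambda>x. 1 / (1 + a * x\<^sup>2)) integrable_on {- pi..pi}" using I by blast
    have "?F pi - ?F (- pi) = 2 * arctan (sqrt a * pi) / sqrt a"
      by (simp add: arctan_minus)
    also have "\<dots> \<le> 2 * (pi / 2) / sqrt a"
      using arctan_ubound[of "sqrt a * pi"] assms by (intro divide_right_mono mult_left_mono) auto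
    finally show "integral {- pi..pi} (\<lambda>x. 1 / (1 + a * x\<^sup>2)) \<le> pi / sqrt a"
      using I by (simp add: integral_unique)
  qed
qed

lemma sinh_minus_id_le:
  fixes x :: real
  assumes "0 \<le> x"
  shows "x \<le> sinh x" "sinh x \<le> x + x ^ 3 * cosh x"
proof -
  have c1: "1 \<le> cosh y" for y :: real by (rule cosh_real_ge_1)
  have mono: "cosh y \<le> cosh x" if "0 \<le> y" "y \<le> x" for y
    using that by (simp add: cosh_real_nonneg_le_iff)
  have "x \<le> sinh x \<and> sinh x \<le> x + x ^ 3 * cosh x"
  proof (cases "x = 0")
    case False
    then have x: "0 < x" using assms by simp
    have "\<exists>z>0. z < x \<and> sinh x - sinh 0 = (x - 0) * cosh z"
      by (rule MVT2[OF x]) (auto intro!: derivative_eq_intros)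
    then obtain z where z: "0 < z" "z < x" "sinh x - sinh 0 = (x - 0) * cosh z" by blast
    have s: "sinh x \<le> x * cosh x" using z x mono[of z] by simp
    have s': "x \<le> sinh x" using z x c1[of z] by simp
    have "\<exists>z>0. z < x \<and> cosh x - cosh 0 = (x - 0) * sinh z"
      by (rule MVT2[OF x]) (auto intro!: derivative_eq_intros)
    then obtain y where y: "0 < y" "y < x" "cosh x - cosh 0 = (x - 0) * sinh y" by blast
    have "sinh y \<le> sinh x" using y by simp
    then have c: "cosh x - 1 \<le> x * (x * cosh x)"
      using y x s by (simp add: mult_left_mono order_trans[of "sinh y" "sinh x"])
    have "sinh x - x = x * (cosh z - 1)" using z by (simp add: algebra_simps)
    also have "\<dots> \<le> x * (x * (x * cosh x))"
      using x mono[of z] z c by (intro mult_left_mono) auto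
    finally show ?thesis using s' by (simp add: power3_eq_cube mult.assoc)
  qed simp
  then show "x \<le> sinh x" "sinh x \<le> x + x ^ 3 * cosh x" by auto
qed

text \<open>On the circle of radius exp s the integrand has modulus exp (2 t sinh s cos x), a peak
  at x = 0 of width at most of order (t s)^(-1/2); the factor exp (s n) of Cauchy's formula gives
  the decay in n.\<close>

lemma abs_bess_le_exp:
  assumes "0 < t" "0 < s"
  shows "\<bar>bess t n\<bar> \<le> exp (2 * t * sinh s - s * real_of_int n) * (3 / 2) / sqrt (t * s)"
proof -
  let ?f = "\<lambda>x. of_real (exp (2 * t * sinh s * cos x)) * cis (2 * t * cosh s * sin x - real_of_int n * x) :: complex"
  let ?a = "t * s / 9"
  let ?g = "\<lambda>x. exp (2 * t * sinh s) * (1 / (1 + ?a * x\<^sup>2))"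
  have a: "0 < ?a" using assms by simp
  have I: "integral {- pi..pi} ?f = of_real (2 * pi * exp (s * real_of_int n) * bess t n)"
    using bess_integral[of n t s] by (simp only: bess_integrand)
  have "norm (integral {- pi..pi} ?f) \<le> integral {- pi..pi} ?g"
  proof (rule integral_norm_bound_integral)
    show "?f integrable_on {- pi..pi}"
      by (intro integrable_continuous_real continuous_intros continuous_on_cis)
    show "?g integrable_on {- pi..pi}"
      using integrable_on_cmult_left[OF integral_inverse_quadratic_le(1)[OF a]] by simp
    fix x assume x: "x \<in> {- pi..pi}"
    have "2 * t * sinh s * cos x \<le> 2 * t * sinh s * (1 - x\<^sup>2 / 18)"
      using assms x by (intro mult_left_mono cos_le_quadratic) auto
    also have "\<dots> = 2 * t * sinh s - t * sinh s / 9 * x\<^sup>2" by (simp add: algebra_simps)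
    also have "\<dots> \<le> 2 * t * sinh s - ?a * x\<^sup>2"
      using assms sinh_minus_id_le(1)[of s] by (intro diff_left_mono mult_right_mono) auto
    finally have "exp (2 * t * sinh s * cos x) \<le> exp (2 * t * sinh s) * exp (- (?a * x\<^sup>2))"
      by (simp add: exp_add[symmetric])
    also have "exp (- (?a * x\<^sup>2)) \<le> 1 / (1 + ?a * x\<^sup>2)"
    proof -
      have "0 < 1 + ?a * x\<^sup>2" using a by (simp add: add_pos_nonneg)
      then show ?thesis
        using exp_ge_add_one_self[of "?a * x\<^sup>2"] by (simp add: exp_minus inverse_eq_divide frac_le)
    qed
    finally show "norm (?f x) \<le> ?g x" by (simp add: norm_mult mult_left_mono)
  qed
  also have "\<dots> = exp (2 * t * sinh s) * integral {- pi..pi} (\<lambda>x. 1 / (1 + ?a * x\<^sup>2))"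
    by (rule integral_mult_right)
  also have "\<dots> \<le> exp (2 * t * sinh s) * (pi / sqrt ?a)"
    by (intro mult_left_mono integral_inverse_quadratic_le a) simp
  also have "sqrt ?a = sqrt (t * s) / 3"
    using real_sqrt_divide[of "t * s" 9] real_sqrt_power[of 3 2] by simp
  finally have "2 * pi * exp (s * real_of_int n) * \<bar>bess t n\<bar> \<le> exp (2 * t * sinh s) * (pi / (sqrt (t * s) / 3))"
    unfolding I by (simp only: norm_of_real abs_mult) simp
  then have "\<bar>bess t n\<bar> \<le> exp (2 * t * sinh s) * (pi / (sqrt (t * s) / 3)) / (2 * pi * exp (s * real_of_int n))"
    by (subst pos_le_divide_eq) (simp_all add: mult_ac)
  also have "\<dots> = exp (2 * t * sinh s - s * real_of_int n) * (3 / 2) / sqrt (t * s)"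
    using assms by (simp add: exp_diff field_simps)
  finally show ?thesis .
qed

definition bess_const :: "real \<Rightarrow> real" where
  "bess_const c = exp (2 * c ^ 3 * cosh c) * (3 / 2) / sqrt c"

text \<open>With s = c/q the linear part of 2 q^3 sinh s combines with -s n to the scaled distance
  from 2 q^3, and the cubic part stays below 2 c^3 cosh c; the width of the peak supplies 1/q. The
  rate c is arbitrary.\<close>

lemma abs_bess_le:
  assumes q: "1 \<le> q" and c: "0 < c"
  shows "\<bar>bess (q ^ 3) n\<bar> \<le> bess_const c / q * exp (- c * ((real_of_int n - 2 * q ^ 3) / q))"
proof -
  let ?s = "c / q"
  have s: "0 < ?s" "?s \<le> c" using q c by (auto simp: divide_le_eq)
  have "sinh ?s \<le> ?s + ?s ^ 3 * cosh ?s" by (rule sinh_minus_id_le) (use s in simp)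
  also have "cosh ?s \<le> cosh c" using s by (simp add: cosh_real_nonneg_le_iff)
  finally have "sinh ?s \<le> ?s + ?s ^ 3 * cosh c" using s by (simp add: mult_left_mono)
  then have "2 * q ^ 3 * sinh ?s \<le> 2 * q ^ 3 * (?s + ?s ^ 3 * cosh c)"
    using q by (intro mult_left_mono) auto
  also have "\<dots> = 2 * q ^ 3 * ?s + 2 * c ^ 3 * cosh c"
    using q by (simp add: field_simps power_divide)
  finally have "2 * q ^ 3 * sinh ?s \<le> 2 * q ^ 3 * ?s + 2 * c ^ 3 * cosh c" .
  moreover have "- c * ((real_of_int n - 2 * q ^ 3) / q) = 2 * q ^ 3 * ?s - ?s * real_of_int n"
    using q by (simp add: field_simps)
  ultimately have "2 * q ^ 3 * sinh ?s - ?s * real_of_int n \<le>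
      2 * c ^ 3 * cosh c + (- c * ((real_of_int n - 2 * q ^ 3) / q))"
    by linarith
  then have e: "exp (2 * q ^ 3 * sinh ?s - ?s * real_of_int n) \<le>
      exp (2 * c ^ 3 * cosh c) * exp (- c * ((real_of_int n - 2 * q ^ 3) / q))"
    unfolding exp_add[symmetric] by simp
  have "q ^ 3 * ?s = c * q\<^sup>2" using q by (simp add: power3_eq_cube power2_eq_square)
  then have sq: "sqrt (q ^ 3 * ?s) = sqrt c * q" using q by (simp add: real_sqrt_mult)
  have "\<bar>bess (q ^ 3) n\<bar> \<le> exp (2 * q ^ 3 * sinh ?s - ?s * real_of_int n) * (3 / 2) / sqrt (q ^ 3 * ?s)"
    by (rule abs_bess_le_exp) (use q s in auto)
  also have "\<dots> \<le> (exp (2 * c ^ 3 * cosh c) * exp (- c * ((real_of_int n - 2 * q ^ 3) / q))) * (3 / 2) / (sqrt c * q)"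
    unfolding sq using q c by (intro divide_right_mono mult_right_mono e) auto
  finally show ?thesis by (simp add: bess_const_def mult_ac)
qed

section \<open>Oscillatory integrals and the Airy limit\<close>

lemma van_der_corput:
  fixes h h' h'' :: "real \<Rightarrow> real"
  assumes "a \<le> b" and mu: "0 < \<mu>"
    and h: "\<And>x. x \<in> {a..b} \<Longrightarrow> (h has_real_derivative h' x) (at x)"
    and h': "\<And>x. x \<in> {a..b} \<Longrightarrow> (h' has_real_derivative h'' x) (at x)"
    and lb: "\<And>x. x \<in> {a..b} \<Longrightarrow> \<mu> \<le> h' x" and nn: "\<And>x. x \<in> {a..b} \<Longrightarrow> 0 \<le> h'' x"
  shows "\<bar>integral {a..b} (\<lambda>x. cos (h x))\<bar> \<le> 3 / \<mu>"
proof -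
  \<comment> \<open>Integration by parts: cos h is the derivative of (sin h) / h' plus
    \<open>?g\<close>, and \<open>?g\<close> is dominated by h'' / h'^2, which has the primitive
    -1/h'. Two boundary terms and this integral give the constant 3.\<close>
  let ?F = "\<lambda>x. sin (h x) / h' x"
  let ?g = "\<lambda>x. sin (h x) * (h'' x / (h' x)\<^sup>2)"
  let ?G = "\<lambda>x. - (1 / h' x)"
  have pos: "0 < h' x" if "x \<in> {a..b}" for x using lb[OF that] mu by simp
  have 1: "((\<lambda>x. cos (h x) - ?g x) has_integral (?F b - ?F a)) {a..b}"
  proof (rule fundamental_theorem_of_calculus[OF assms(1)])
    fix x assume x: "x \<in> {a..b}"
    have "(?F has_real_derivative ((cos (h x) * h' x) * h' x - sin (h x) * h'' x) / (h' x * h' x)) (at x)"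
      by (rule DERIV_divide[OF DERIV_chain2[OF DERIV_sin h[OF x]] h'[OF x]]) (use pos[OF x] in simp)
    moreover have "((cos (h x) * h' x) * h' x - sin (h x) * h'' x) / (h' x * h' x) = cos (h x) - ?g x"
      using pos[OF x] by (simp add: field_simps power2_eq_square)
    ultimately show "(?F has_vector_derivative cos (h x) - ?g x) (at x within {a..b})"
      by (simp add: has_real_derivative_iff_has_vector_derivative[symmetric] has_field_derivative_at_within)
  qed
  have 2: "((\<lambda>x. h'' x / (h' x)\<^sup>2) has_integral (?G b - ?G a)) {a..b}"
  proof (rule fundamental_theorem_of_calculus[OF assms(1)])
    fix x assume x: "x \<in> {a..b}"
    have "(?G has_real_derivative - ((0 * h' x - 1 * h'' x) / (h' x * h' x))) (at x)"
      by (rule DERIV_minus[OF DERIV_divide[OF DERIV_const h'[OF x]]]) (use pos[OF x] in simp)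
    then show "(?G has_vector_derivative h'' x / (h' x)\<^sup>2) (at x within {a..b})"
      by (simp add: power2_eq_square has_real_derivative_iff_has_vector_derivative[symmetric] has_field_derivative_at_within)
  qed
  have "continuous_on {a..b} h"
    using h by (intro continuous_at_imp_continuous_on ballI DERIV_isCont)
  then have 3: "(\<lambda>x. cos (h x)) integrable_on {a..b}"
    by (intro integrable_continuous_real continuous_intros)
  have "(\<lambda>x. cos (h x) - (cos (h x) - ?g x)) integrable_on {a..b}"
    by (rule integrable_diff[OF 3]) (use 1 in blast)
  then have 4: "?g integrable_on {a..b}" by (rule integrable_eq) simp
  have "integral {a..b} (\<lambda>x. cos (h x)) = (?F b - ?F a) + integral {a..b} ?g"
    using integral_add[OF _ 4, of "\<lambda>x. cos (h x) - ?g x"] 1 by (auto simp: integral_unique has_integral_integrable)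
  moreover have "\<bar>integral {a..b} ?g\<bar> \<le> 1 / \<mu>"
  proof -
    have "norm (integral {a..b} ?g) \<le> integral {a..b} (\<lambda>x. h'' x / (h' x)\<^sup>2)"
    proof (rule integral_norm_bound_integral[OF 4])
      show "(\<lambda>x. h'' x / (h' x)\<^sup>2) integrable_on {a..b}" using 2 by blast
      fix x assume x: "x \<in> {a..b}"
      have "\<bar>sin (h x)\<bar> * (h'' x / (h' x)\<^sup>2) \<le> 1 * (h'' x / (h' x)\<^sup>2)"
        using nn[OF x] by (intro mult_right_mono) auto
      then show "norm (?g x) \<le> h'' x / (h' x)\<^sup>2" using nn[OF x] by (simp add: abs_mult)
    qed
    also have "\<dots> = 1 / h' a - 1 / h' b" using 2 by (simp add: integral_unique)
    also have "\<dots> \<le> 1 / h' a" using pos[of b] assms(1) by simp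
    also have "\<dots> \<le> 1 / \<mu>" using lb[of a] assms(1) mu by (simp add: frac_le)
    finally show ?thesis by simp
  qed
  moreover have "\<bar>?F x\<bar> \<le> 1 / \<mu>" if "x \<in> {a..b}" for x
    unfolding abs_divide using lb[OF that] mu by (intro frac_le) auto
  then have "\<bar>?F b\<bar> \<le> 1 / \<mu>" "\<bar>?F a\<bar> \<le> 1 / \<mu>" using assms(1) by auto
  ultimately have "\<bar>integral {a..b} (\<lambda>x. cos (h x))\<bar> \<le> 1 / \<mu> + 1 / \<mu> + 1 / \<mu>" by linarith
  then show ?thesis by simp
qed

definition airy_int :: "real \<Rightarrow> real \<Rightarrow> real" where
  "airy_int x R = integral {0..R} (\<lambda>u. cos (u ^ 3 / 3 + x * u))"

text \<open>Beyond T the phase derivative u^2 + x is at least T^2/18. The threshold is the one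
  required by the Bessel phase in \<open>bess_phase_tail\<close>, so that both integrals may be cut
  at the same T with the same error.\<close>

lemma airy_int_diff:
  assumes "0 < T" "18 * \<bar>x\<bar> \<le> T\<^sup>2" "T \<le> S"
  shows "\<bar>airy_int x S - airy_int x T\<bar> \<le> 54 / T\<^sup>2"
proof -
  have c: "(\<lambda>u. cos (u ^ 3 / 3 + x * u)) integrable_on {A..B}" for A B
    by (intro integrable_continuous_real continuous_intros) auto
  have "airy_int x S - airy_int x T = integral {T..S} (\<lambda>u. cos (u ^ 3 / 3 + x * u))"
    unfolding airy_int_def using Henstock_Kurzweil_Integration.integral_combine[where a = 0 and c = T and b = S, OF _ _ c] assms by simp
  also have "\<bar>\<dots>\<bar> \<le> 3 / (T\<^sup>2 / 18)"
  proof (rule van_der_corput[where h' = "\<lambda>u. u\<^sup>2 + x" and h'' = "\<lambda>u. 2 * u"])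
    fix u assume u: "u \<in> {T..S}"
    show "((\<lambda>u. u ^ 3 / 3 + x * u) has_real_derivative u\<^sup>2 + x) (at u)"
      by (auto intro!: derivative_eq_intros)
    show "((\<lambda>u. u\<^sup>2 + x) has_real_derivative 2 * u) (at u)"
      by (auto intro!: derivative_eq_intros)
    have "T\<^sup>2 \<le> u\<^sup>2" using u assms by (intro power_mono) auto
    then show "T\<^sup>2 / 18 \<le> u\<^sup>2 + x" using assms(2) by (simp add: abs_if split: if_splits)
    show "0 \<le> 2 * u" using u assms by simp
  qed (use assms in auto)
  finally show ?thesis by simp
qed

text \<open>The Cauchy criterion along the integers shows that the improper integral exists; only
  then does \<open>Lim\<close> in \<open>airy_ai\<close> denote its value.\<close>

lemma airy_int_tendsto:
  obtains l where "(airy_int x \<longlongrightarrow> l) at_top"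
    "\<And>T. 0 < T \<Longrightarrow> 18 * \<bar>x\<bar> \<le> T\<^sup>2 \<Longrightarrow> \<bar>l - airy_int x T\<bar> \<le> 54 / T\<^sup>2"
proof -
  have lim0: "((\<lambda>T. 54 / T\<^sup>2) \<longlongrightarrow> (0::real)) at_top" by real_asymp
  have ev: "\<forall>\<^sub>F T in at_top. 0 < T \<and> 18 * \<bar>x\<bar> \<le> T\<^sup>2"
  proof -
    have "filterlim (\<lambda>T::real. T\<^sup>2) at_top at_top" by real_asymp
    then have "\<forall>\<^sub>F T in at_top. 18 * \<bar>x\<bar> \<le> T\<^sup>2" by (simp add: filterlim_at_top)
    then show ?thesis using eventually_gt_at_top[of 0] by eventually_elim auto
  qed
  have "Cauchy (\<lambda>k. airy_int x (real k))"
  proof (rule metric_CauchyI)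
    fix e :: real assume "0 < e"
    then have "\<forall>\<^sub>F T in at_top. 54 / T\<^sup>2 < e / 2" using order_tendstoD(2)[OF lim0, of "e / 2"] by simp
    with ev have "\<forall>\<^sub>F T in at_top. (0 < T \<and> 18 * \<bar>x\<bar> \<le> T\<^sup>2) \<and> 54 / T\<^sup>2 < e / 2" by eventually_elim auto
    then obtain T0 where T0: "\<And>T. T \<ge> T0 \<Longrightarrow> (0 < T \<and> 18 * \<bar>x\<bar> \<le> T\<^sup>2) \<and> 54 / T\<^sup>2 < e / 2"
      by (auto simp: eventually_at_top_linorder)
    obtain M :: nat where M: "T0 \<le> real M" using real_arch_simple by blast
    have *: "\<bar>airy_int x (real k) - airy_int x (real M)\<bar> < e / 2" if "M \<le> k" for k
      using airy_int_diff[of "real M" x "real k"] T0[OF M] that by fastforce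
    show "\<exists>M. \<forall>m\<ge>M. \<forall>n\<ge>M. dist (airy_int x (real m)) (airy_int x (real n)) < e"
    proof (intro exI allI impI)
      fix m n assume "M \<le> m" "M \<le> n"
      then show "dist (airy_int x (real m)) (airy_int x (real n)) < e"
        using *[of m] *[of n] unfolding dist_real_def by linarith
    qed
  qed
  then obtain l where l: "(\<lambda>k. airy_int x (real k)) \<longlonglongrightarrow> l"
    using real_Cauchy_convergent convergent_def by blast
  have bound: "\<bar>l - airy_int x T\<bar> \<le> 54 / T\<^sup>2" if T: "0 < T" "18 * \<bar>x\<bar> \<le> T\<^sup>2" for T
  proof (rule LIMSEQ_le_const2)
    show "(\<lambda>k. \<bar>airy_int x (real k) - airy_int x T\<bar>) \<longlonglongrightarrow> \<bar>l - airy_int x T\<bar>"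
      by (intro tendsto_intros l)
    obtain M :: nat where "T \<le> real M" using real_arch_simple by blast
    then show "\<exists>N. \<forall>n\<ge>N. \<bar>airy_int x (real n) - airy_int x T\<bar> \<le> 54 / T\<^sup>2"
      using airy_int_diff[OF T] by (intro exI[of _ M] allI impI) (meson of_nat_mono order_trans)
  qed
  have "((\<lambda>T. airy_int x T - l) \<longlongrightarrow> 0) at_top"
  proof (rule Lim_null_comparison[OF _ lim0])
    show "\<forall>\<^sub>F T in at_top. norm (airy_int x T - l) \<le> 54 / T\<^sup>2"
      using ev by eventually_elim (use bound in \<open>auto simp: abs_minus_commute\<close>)
  qed
  then have "(airy_int x \<longlongrightarrow> l) at_top" by (simp add: LIM_zero_iff)
  then show ?thesis using that bound by blast
qed

lemma airy_ai_bound: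
  assumes "0 < T" "18 * \<bar>x\<bar> \<le> T\<^sup>2"
  shows "\<bar>pi * airy_ai x - airy_int x T\<bar> \<le> 54 / T\<^sup>2"
proof -
  obtain l where l: "(airy_int x \<longlongrightarrow> l) at_top"
    "\<And>T. 0 < T \<Longrightarrow> 18 * \<bar>x\<bar> \<le> T\<^sup>2 \<Longrightarrow> \<bar>l - airy_int x T\<bar> \<le> 54 / T\<^sup>2"
    using airy_int_tendsto by blast
  have "Lim at_top (airy_int x) = l" by (rule tendsto_Lim[OF _ l(1)]) simp
  then have "pi * airy_ai x = l" by (simp add: airy_ai_def airy_int_def[abs_def])
  then show ?thesis using l(2)[OF assms] by simp
qed

text \<open>The phase n y - 2 q^3 sin y of the Bessel integral for y = u/q and n = 2 q^3 + x q,
  arranged so that the second summand tends to u^3/3.\<close>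

definition bess_phase :: "real \<Rightarrow> real \<Rightarrow> real \<Rightarrow> real" where
  "bess_phase q x u = x * u + 2 * q ^ 3 * (u / q - sin (u / q))"

text \<open>Cauchy's formula on the unit circle: the real part of the integrand is even, which
  halves the interval, and the substitution u = q x stretches it.\<close>

lemma bess_eq_phase_integral:
  assumes q: "0 < q"
  shows "pi * (q * bess (q ^ 3) n) =
    integral {0..pi * q} (\<lambda>u. cos (bess_phase q ((real_of_int n - 2 * q ^ 3) / q) u))"
proof -
  let ?c = "\<lambda>x. cos (2 * q ^ 3 * sin x - real_of_int n * x)"
  let ?f = "\<lambda>x. cis (2 * q ^ 3 * sin x - real_of_int n * x)"
  have ci: "?c integrable_on {A..B}" for A B
    by (intro integrable_continuous_real continuous_intros)
  have "integral {- pi..pi} ?f = of_real (2 * pi * bess (q ^ 3) n)"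
    using bess_integral[of n "q ^ 3" 0, unfolded bess_integrand] by simp
  moreover have "?f integrable_on {- pi..pi}"
    by (intro integrable_continuous_real continuous_intros continuous_on_cis)
  ultimately have "(?f has_integral of_real (2 * pi * bess (q ^ 3) n)) {- pi..pi}"
    by (metis integrable_integral)
  from has_integral_linear[OF this bounded_linear_Re]
  have "integral {- pi..pi} ?c = 2 * pi * bess (q ^ 3) n"
    by (simp add: o_def integral_unique)
  moreover have "integral {- pi..0} ?c + integral {0..pi} ?c = integral {- pi..pi} ?c"
    by (rule Henstock_Kurzweil_Integration.integral_combine) (auto intro: ci)
  moreover have "integral {- pi..0} ?c = integral {0..pi} ?c"
  proof -
    have "integral {- pi..- 0} (\<lambda>x. ?c (- x)) = integral {0..pi} ?c"
      by (rule Henstock_Kurzweil_Integration.integral_reflect_real[where a = 0 and b = pi and f = ?c])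
    moreover have "?c (- x) = ?c x" for x
      using cos_minus[of "2 * q ^ 3 * sin x - real_of_int n * x"] by (simp add: algebra_simps)
    ultimately show ?thesis by simp
  qed
  ultimately have I: "integral {0..pi} ?c = pi * bess (q ^ 3) n" by simp
  have "((\<lambda>u. ?c ((1 / q) * u)) has_integral (1 / \<bar>1 / q\<bar>) *\<^sub>R integral {0..pi} ?c) ((\<lambda>u. u / (1 / q)) ` {0..pi})"
    by (rule has_integral_stretch_real[OF integrable_integral[OF ci]]) (use q in simp)
  moreover have "(\<lambda>u. u / (1 / q)) ` {0..pi} = {0..pi * q}"
    using q image_mult_atLeastAtMost[of q 0 pi] by (simp add: mult.commute)
  moreover have "?c ((1 / q) * u) = cos (bess_phase q ((real_of_int n - 2 * q ^ 3) / q) u)" for u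
  proof -
    have "bess_phase q ((real_of_int n - 2 * q ^ 3) / q) u = - (2 * q ^ 3 * sin (u / q) - real_of_int n * (u / q))"
      using q by (simp add: bess_phase_def field_simps)
    then have "cos (bess_phase q ((real_of_int n - 2 * q ^ 3) / q) u) =
        cos (2 * q ^ 3 * sin (u / q) - real_of_int n * (u / q))"
      by (simp only: cos_minus)
    then show ?thesis by simp
  qed
  ultimately show ?thesis using I q by (simp add: integral_unique)
qed

text \<open>The phase derivative x + 2 q^2 (1 - cos (u/q)) is at least x + T^2/9 by
  \<open>cos_le_quadratic\<close>, and it increases because the sine is nonnegative up to the end
  point pi q.\<close>

lemma bess_phase_tail:
  assumes q: "0 < q" and T: "0 < T" "18 * \<bar>x\<bar> \<le> T\<^sup>2" "T \<le> pi * q"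
  shows "\<bar>integral {T..pi * q} (\<lambda>u. cos (bess_phase q x u))\<bar> \<le> 54 / T\<^sup>2"
proof -
  have "\<bar>integral {T..pi * q} (\<lambda>u. cos (bess_phase q x u))\<bar> \<le> 3 / (T\<^sup>2 / 18)"
  proof (rule van_der_corput[where h' = "\<lambda>u. x + 2 * q\<^sup>2 * (1 - cos (u / q))" and h'' = "\<lambda>u. 2 * q * sin (u / q)"])
    fix u assume u: "u \<in> {T..pi * q}"
    have uq: "0 \<le> u / q" "u / q \<le> pi" using u T q by (auto simp: divide_le_eq)
    show "(bess_phase q x has_real_derivative x + 2 * q\<^sup>2 * (1 - cos (u / q))) (at u)"
      unfolding bess_phase_def[abs_def] using q
      by (auto intro!: derivative_eq_intros simp: field_simps power2_eq_square power3_eq_cube)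
    show "((\<lambda>u. x + 2 * q\<^sup>2 * (1 - cos (u / q))) has_real_derivative 2 * q * sin (u / q)) (at u)"
      using q by (auto intro!: derivative_eq_intros simp: field_simps power2_eq_square)
    have "T\<^sup>2 \<le> u\<^sup>2" using u T by (intro power_mono) auto
    also have "u\<^sup>2 = q\<^sup>2 * (u / q)\<^sup>2" using q by (simp add: power_divide)
    also have "\<dots> \<le> q\<^sup>2 * (18 * (1 - cos (u / q)))"
    proof (rule mult_left_mono)
      have "\<bar>u / q\<bar> \<le> pi" using uq by linarith
      moreover have "v\<^sup>2 \<le> 18 * (1 - cos v)" if "cos v \<le> 1 - v\<^sup>2 / 18" for v :: real
        using that by simp
      ultimately show "(u / q)\<^sup>2 \<le> 18 * (1 - cos (u / q))" using cos_le_quadratic by blast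
    qed simp
    finally have "T\<^sup>2 / 9 \<le> 2 * q\<^sup>2 * (1 - cos (u / q))" by (simp add: algebra_simps)
    then show "T\<^sup>2 / 18 \<le> x + 2 * q\<^sup>2 * (1 - cos (u / q))"
      using T(2) by (simp add: abs_if split: if_splits)
    show "0 \<le> 2 * q * sin (u / q)" using q sin_ge_zero[OF uq] by simp
  qed (use T in auto)
  then show ?thesis by simp
qed

text \<open>The fifth-order Taylor bound for the sine gives the error |u|^5 / (60 q^2).\<close>

lemma bess_phase_tendsto:
  assumes q: "filterlim q at_top sequentially" and x: "x \<longlonglongrightarrow> x0"
  shows "(\<lambda>k. bess_phase (q k) (x k) u) \<longlonglongrightarrow> u ^ 3 / 3 + x0 * u"
proof -
  have ev: "\<forall>\<^sub>F k in sequentially. 0 < q k" using q by (simp add: filterlim_at_top_dense)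
  have "(\<lambda>k. 2 * q k ^ 3 * (u / q k - sin (u / q k)) - u ^ 3 / 3) \<longlonglongrightarrow> 0"
  proof (rule Lim_null_comparison)
    have "((\<lambda>q. \<bar>u\<bar> ^ 5 / (60 * q\<^sup>2)) \<longlongrightarrow> 0) at_top"
      by (rule real_tendsto_divide_at_top[OF tendsto_const]) real_asymp
    then show "(\<lambda>k. \<bar>u\<bar> ^ 5 / (60 * (q k)\<^sup>2)) \<longlonglongrightarrow> 0"
      by (rule filterlim_compose[OF _ q])
    show "\<forall>\<^sub>F k in sequentially. norm (2 * q k ^ 3 * (u / q k - sin (u / q k)) - u ^ 3 / 3) \<le> \<bar>u\<bar> ^ 5 / (60 * (q k)\<^sup>2)"
      using ev
    proof eventually_elim
      case (elim k)
      let ?v = "u / q k"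
      have s: "(\<Sum>m<5. sin_coeff m * ?v ^ m) = ?v - ?v ^ 3 / 6"
        by (simp add: lessThan_nat_numeral sin_coeff_def fact_numeral power_divide)
      have "\<bar>sin ?v - (?v - ?v ^ 3 / 6)\<bar> \<le> inverse (fact 5) * \<bar>?v\<bar> ^ 5"
        using Maclaurin_sin_bound[of ?v 5] unfolding s .
      also have "inverse (fact 5) * \<bar>?v\<bar> ^ 5 = \<bar>?v\<bar> ^ 5 / 120" by (simp add: fact_numeral)
      finally have b: "\<bar>sin ?v - (?v - ?v ^ 3 / 6)\<bar> \<le> \<bar>?v\<bar> ^ 5 / 120" .
      have "2 * q k ^ 3 * (?v - sin ?v) - u ^ 3 / 3 = - (2 * q k ^ 3 * (sin ?v - (?v - ?v ^ 3 / 6)))"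
        using elim by (simp add: power_divide algebra_simps)
      then have "norm (2 * q k ^ 3 * (?v - sin ?v) - u ^ 3 / 3) = 2 * q k ^ 3 * \<bar>sin ?v - (?v - ?v ^ 3 / 6)\<bar>"
        using elim by (simp add: abs_mult)
      also have "\<dots> \<le> 2 * q k ^ 3 * (\<bar>?v\<bar> ^ 5 / 120)"
        using elim b by (intro mult_left_mono) auto
      also have "\<dots> = \<bar>u\<bar> ^ 5 / (60 * (q k)\<^sup>2)"
        using elim by (simp add: power_divide abs_divide field_simps eval_nat_numeral)
      finally show ?case .
    qed
  qed
  then have "(\<lambda>k. 2 * q k ^ 3 * (u / q k - sin (u / q k))) \<longlonglongrightarrow> u ^ 3 / 3"
    by (simp add: LIM_zero_iff)
  then have "(\<lambda>k. x k * u + 2 * q k ^ 3 * (u / q k - sin (u / q k))) \<longlonglongrightarrow> x0 * u + u ^ 3 / 3"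
    by (intro tendsto_add tendsto_mult x tendsto_const)
  then show ?thesis by (simp add: bess_phase_def add.commute)
qed

text \<open>Both oscillatory integrals are cut at one large T. The two tails and the difference on
  the fixed interval up to T, where dominated convergence applies, make up the three thirds of
  e.\<close>

theorem bess_tendsto_airy:
  assumes q: "filterlim q at_top sequentially"
    and x: "(\<lambda>k. (real_of_int (n k) - 2 * q k ^ 3) / q k) \<longlonglongrightarrow> x0"
  shows "(\<lambda>k. q k * bess (q k ^ 3) (n k)) \<longlonglongrightarrow> airy_ai x0"
proof -
  define x where "x k = (real_of_int (n k) - 2 * q k ^ 3) / q k" for k
  have x': "x \<longlonglongrightarrow> x0" using assms(2) by (simp add: x_def[abs_def])
  have "(\<lambda>k. pi * (q k * bess (q k ^ 3) (n k))) \<longlonglongrightarrow> pi * airy_ai x0"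
  proof (rule LIMSEQ_I)
    fix e :: real assume e: "0 < e"
    have "((\<lambda>T. 54 / T\<^sup>2) \<longlongrightarrow> (0::real)) at_top" by real_asymp
    then have "\<forall>\<^sub>F T in at_top. 54 / T\<^sup>2 < e / 3"
      using order_tendstoD(2)[of "\<lambda>T. 54 / T\<^sup>2" 0 at_top "e / 3"] e by simp
    moreover have "\<forall>\<^sub>F T in at_top. 18 * (\<bar>x0\<bar> + 1) \<le> T\<^sup>2"
    proof -
      have "filterlim (\<lambda>T::real. T\<^sup>2) at_top at_top" by real_asymp
      then show ?thesis by (simp add: filterlim_at_top)
    qed
    moreover have "\<forall>\<^sub>F T in at_top. (0::real) < T" by (rule eventually_gt_at_top)
    ultimately have "\<forall>\<^sub>F T in at_top. 54 / T\<^sup>2 < e / 3 \<and> 18 * (\<bar>x0\<bar> + 1) \<le> T\<^sup>2 \<and> 0 < T"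
      by eventually_elim auto
    \<comment> \<open>Room of 1 beyond |x0|, so that the tail bound also covers the arguments x k
      close to x0.\<close>
    then obtain T where T: "54 / T\<^sup>2 < e / 3" "18 * (\<bar>x0\<bar> + 1) \<le> T\<^sup>2" "0 < T"
      by (auto simp: eventually_at_top_linorder)
    have "18 * \<bar>x0\<bar> \<le> 18 * (\<bar>x0\<bar> + 1)" by simp
    then have x0T: "18 * \<bar>x0\<bar> \<le> T\<^sup>2" using T(2) by (rule order_trans)
    have c: "(\<lambda>u. cos (bess_phase qq y u)) integrable_on {A..B}" for qq y A B
      unfolding bess_phase_def divide_inverse by (intro integrable_continuous_real continuous_intros)
    have lim1: "(\<lambda>k. integral {0..T} (\<lambda>u. cos (bess_phase (q k) (x k) u))) \<longlonglongrightarrow>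
        integral {0..T} (\<lambda>u. cos (u ^ 3 / 3 + x0 * u))"
      by (rule dominated_convergence(2)[where h = "\<lambda>_. 1"])
         (auto intro!: c tendsto_cos bess_phase_tendsto q x')
    have 1: "\<forall>\<^sub>F k in sequentially. \<bar>integral {0..T} (\<lambda>u. cos (bess_phase (q k) (x k) u)) - airy_int x0 T\<bar> < e / 3"
      using tendstoD[OF lim1, of "e / 3"] e unfolding airy_int_def dist_real_def by simp
    have "\<forall>\<^sub>F k in sequentially. \<bar>x k - x0\<bar> < 1"
      using x' by (auto simp: tendsto_iff dist_real_def)
    moreover have "\<forall>\<^sub>F k in sequentially. T < q k" using q by (simp add: filterlim_at_top_dense)
    ultimately have "\<forall>\<^sub>F k in sequentially. norm (pi * (q k * bess (q k ^ 3) (n k)) - pi * airy_ai x0) < e"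
      using 1
    proof eventually_elim
      case (elim k)
      have qk: "0 < q k" using elim T by simp
      have "T * 1 \<le> q k * pi" using elim T pi_ge_two by (intro mult_mono) auto
      then have Tq: "T \<le> pi * q k" by (simp add: mult.commute)
      have "\<bar>x k\<bar> < \<bar>x0\<bar> + 1" using elim(1) by linarith
      then have "18 * \<bar>x k\<bar> \<le> 18 * (\<bar>x0\<bar> + 1)" by (intro mult_left_mono) auto
      then have xk: "18 * \<bar>x k\<bar> \<le> T\<^sup>2" using T(2) by (rule order_trans)
      have "pi * (q k * bess (q k ^ 3) (n k)) = integral {0..pi * q k} (\<lambda>u. cos (bess_phase (q k) (x k) u))"
        using bess_eq_phase_integral[OF qk, of "n k"] by (simp add: x_def)
      also have "\<dots> = integral {0..T} (\<lambda>u. cos (bess_phase (q k) (x k) u)) +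
          integral {T..pi * q k} (\<lambda>u. cos (bess_phase (q k) (x k) u))"
        by (rule Henstock_Kurzweil_Integration.integral_combine[symmetric]) (use T Tq c in auto)
      finally show ?case
        using bess_phase_tail[OF qk T(3) xk Tq] airy_ai_bound[OF T(3) x0T] T(1) elim(3)
        unfolding real_norm_def by linarith
    qed
    then show "\<exists>no. \<forall>k\<ge>no. norm (pi * (q k * bess (q k ^ 3) (n k)) - pi * airy_ai x0) < e"
      by (simp add: eventually_sequentially)
  qed
  then show ?thesis
    by (subst (asm) tendsto_mult_left_iff) auto
qed

section \<open>The scaling limit\<close>

text \<open>Placing the pair 2l, 2l + 1 next to term l of the first part keeps both parts of K in a
  single series under a single majorant.\<close>

definition bpair :: "real \<Rightarrow> int \<Rightarrow> int \<Rightarrow> nat \<Rightarrow> real" where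
  "bpair t n k l = bess t (n + int l) * bess t (k + int l) -
    (bess t (n + int (2 * l)) * bess t (k - int (2 * l)) -
     bess t (n + int (2 * l + 1)) * bess t (k - int (2 * l + 1)))"

lemma infsum_nonneg_int_sums:
  fixes f :: "int \<Rightarrow> real"
  assumes "f summable_on {0..}"
  shows "(\<lambda>l. f (int l)) sums infsum f {0..}"
proof -
  have "range int = {0..}" using zero_le_imp_eq_int by auto
  then have "(f has_sum infsum f {0..}) (int ` UNIV)" using assms by simp
  then have "(f \<circ> int has_sum infsum f {0..}) UNIV"
    by (subst (asm) has_sum_reindex) auto
  then show ?thesis using has_sum_imp_sums[of "f \<circ> int"] by (simp add: o_def)
qed

lemma bess_mult_summable:
  assumes "(\<lambda>l. bess t (h l)) summable_on UNIV"
  shows "(\<lambda>l. bess t (n + l) * bess t (h l)) summable_on A"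
proof -
  obtain C where C: "0 \<le> C" "\<And>n. \<bar>bess t n\<bar> \<le> C" using bess_bounded[of t] by blast
  have "(\<lambda>l. bess t (n + l) * bess t (h l)) summable_on UNIV"
  proof (rule summable_on_real_comparison)
    show "(\<lambda>l. C * bess t (h l)) summable_on UNIV"
      by (intro summable_on_cmult_right assms)
    show "\<bar>bess t (n + l) * bess t (h l)\<bar> \<le> \<bar>C * bess t (h l)\<bar>" for l
      using C by (simp add: abs_mult mult_right_mono)
  qed
  then show ?thesis by (rule summable_on_subset_banach) auto
qed

text \<open>The alternating part of the kernel is summed in consecutive pairs: its terms cancel in the
  limit.\<close>

lemma bpair_sums: "bpair t n k sums bessK t n k"
proof -
  let ?a = "\<lambda>l. bess t (n + l) * bess t (k + l)"
  let ?b = "\<lambda>l. sg l * (bess t (n + l) * bess t (k - l))"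
  have a: "?a summable_on {0..}"
    by (intro bess_mult_summable summable_on_shift bess_summable)
  have b0: "(\<lambda>l. bess t (n + l) * bess t (k - l)) summable_on {0..}"
    by (intro bess_mult_summable summable_on_shift bess_summable)
  have b: "?b summable_on {0..}"
    by (rule summable_on_real_comparison[OF b0]) (simp add: abs_mult)
  have "bessK t n k = (\<Sum>\<^sub>\<infinity>l\<in>{0..}. ?a l + (- ?b l))"
    by (simp add: bessK_def algebra_simps)
  also have "\<dots> = infsum ?a {0..} - infsum ?b {0..}"
    by (subst infsum_add) (use a b in \<open>auto simp: infsum_uminus summable_on_uminus\<close>)
  finally have K: "bessK t n k = infsum ?a {0..} - infsum ?b {0..}" .
  have "(\<lambda>p. sum (\<lambda>l. ?b (int l)) {p * 2..<p * 2 + 2}) sums infsum ?b {0..}"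
    by (rule sums_group[OF infsum_nonneg_int_sums[OF b]]) simp
  moreover have "sum (\<lambda>l. ?b (int l)) {p * 2..<p * 2 + 2} =
      bess t (n + int (2 * p)) * bess t (k - int (2 * p)) -
      bess t (n + int (2 * p + 1)) * bess t (k - int (2 * p + 1))" for p
  proof -
    have "{p * 2..<p * 2 + 2} = {2 * p, 2 * p + 1}" by auto
    then show ?thesis by (simp add: sg_def)
  qed
  ultimately have "(\<lambda>p. bess t (n + int (2 * p)) * bess t (k - int (2 * p)) -
      bess t (n + int (2 * p + 1)) * bess t (k - int (2 * p + 1))) sums infsum ?b {0..}"
    by simp
  from sums_diff[OF infsum_nonneg_int_sums[OF a] this] show ?thesis
    unfolding K bpair_def[abs_def] .
qed

text \<open>A bound at rate 1 for J_{k-j} grows like exp (j/q). Taking J_{n+j} at rate 2 leaves exp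
  (-j/q) for the product, at the cost of one more factor exp (-X).\<close>

lemma abs_bpair_le:
  assumes q: "1 \<le> q" and X: "X \<le> (real_of_int n - 2 * q ^ 3) / q" and Y: "Y \<le> (real_of_int k - 2 * q ^ 3) / q"
  shows "q\<^sup>2 * \<bar>bpair (q ^ 3) n k l\<bar> \<le>
    ((bess_const 1)\<^sup>2 + 2 * bess_const 1 * bess_const 2 * exp (- X)) * exp (- X - Y) * exp (- (real l / q))"
proof -
  define x where "x = (real_of_int n - 2 * q ^ 3) / q"
  define y where "y = (real_of_int k - 2 * q ^ 3) / q"
  let ?t = "q ^ 3" and ?c1 = "bess_const 1" and ?c2 = "bess_const 2"
  have c: "0 \<le> ?c1" "0 \<le> ?c2" by (simp_all add: bess_const_def)
  have b: "q * \<bar>bess ?t j\<bar> \<le> bess_const c * exp (- c * ((real_of_int j - 2 * q ^ 3) / q))" if "0 < c" for c j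
    using mult_left_mono[OF abs_bess_le[OF q that, of j], of q] q by simp
  have e1: "(real_of_int (n + int j) - 2 * q ^ 3) / q = x + real j / q"
    "(real_of_int (k + int j) - 2 * q ^ 3) / q = y + real j / q"
    "(real_of_int (k - int j) - 2 * q ^ 3) / q = y - real j / q" for j
    by (simp_all add: x_def y_def add_divide_distrib diff_divide_distrib)
  have j0: "0 \<le> real j / q" for j using q by simp
  have p1: "q\<^sup>2 * \<bar>bess ?t (n + int j) * bess ?t (k + int j)\<bar> \<le> ?c1\<^sup>2 * exp (- X - Y) * exp (- (real j / q))" for j
  proof -
    have "q\<^sup>2 * \<bar>bess ?t (n + int j) * bess ?t (k + int j)\<bar> =
        (q * \<bar>bess ?t (n + int j)\<bar>) * (q * \<bar>bess ?t (k + int j)\<bar>)"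
      by (simp add: abs_mult power2_eq_square)
    also have "\<dots> \<le> (?c1 * exp (- 1 * (x + real j / q))) * (?c1 * exp (- 1 * (y + real j / q)))"
      using b[of 1 "n + int j"] b[of 1 "k + int j"] q c unfolding e1
      by (intro mult_mono[OF _ _ mult_nonneg_nonneg mult_nonneg_nonneg]) (simp_all del: mult_minus1)
    also have "\<dots> = ?c1\<^sup>2 * exp (- x - y - 2 * (real j / q))"
      by (simp add: power2_eq_square exp_add[symmetric] mult_ac)
    also have "\<dots> \<le> ?c1\<^sup>2 * exp ((- X - Y) + - (real j / q))"
      using X Y j0[of j] unfolding x_def[symmetric] y_def[symmetric] by (intro mult_left_mono) auto
    finally show ?thesis by (simp only: exp_add mult.assoc)
  qed
  have p2: "q\<^sup>2 * \<bar>bess ?t (n + int j) * bess ?t (k - int j)\<bar> \<le>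
      ?c1 * ?c2 * exp (- X) * exp (- X - Y) * exp (- (real l / q))" if "l \<le> j" for j
  proof -
    have "q\<^sup>2 * \<bar>bess ?t (n + int j) * bess ?t (k - int j)\<bar> =
        (q * \<bar>bess ?t (n + int j)\<bar>) * (q * \<bar>bess ?t (k - int j)\<bar>)"
      by (simp add: abs_mult power2_eq_square)
    also have "\<dots> \<le> (?c2 * exp (- 2 * (x + real j / q))) * (?c1 * exp (- 1 * (y - real j / q)))"
      using b[of 2 "n + int j"] b[of 1 "k - int j"] q c unfolding e1
      by (intro mult_mono[OF _ _ mult_nonneg_nonneg mult_nonneg_nonneg]) (simp_all del: mult_minus1)
    also have "\<dots> = ?c1 * ?c2 * exp (- 2 * x - y - real j / q)"
      by (simp add: exp_add[symmetric] mult_ac algebra_simps)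
    also have "\<dots> \<le> ?c1 * ?c2 * exp (- X + ((- X - Y) + - (real l / q)))"
    proof -
      have "real l / q \<le> real j / q" using that q by (intro divide_right_mono) auto
      then show ?thesis
        using X Y c unfolding x_def[symmetric] y_def[symmetric] by (intro mult_left_mono) auto
    qed
    finally show ?thesis by (simp only: exp_add mult.assoc)
  qed
  have "\<bar>bpair ?t n k l\<bar> \<le> \<bar>bess ?t (n + int l) * bess ?t (k + int l)\<bar> +
      (\<bar>bess ?t (n + int (2 * l)) * bess ?t (k - int (2 * l))\<bar> +
       \<bar>bess ?t (n + int (2 * l + 1)) * bess ?t (k - int (2 * l + 1))\<bar>)"
    unfolding bpair_def by linarith
  then have "q\<^sup>2 * \<bar>bpair ?t n k l\<bar> \<le> q\<^sup>2 * (\<bar>bess ?t (n + int l) * bess ?t (k + int l)\<bar> +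
      (\<bar>bess ?t (n + int (2 * l)) * bess ?t (k - int (2 * l))\<bar> +
       \<bar>bess ?t (n + int (2 * l + 1)) * bess ?t (k - int (2 * l + 1))\<bar>))"
    by (intro mult_left_mono) auto
  also have "\<dots> \<le> ?c1\<^sup>2 * exp (- X - Y) * exp (- (real l / q)) +
      (?c1 * ?c2 * exp (- X) * exp (- X - Y) * exp (- (real l / q)) +
       ?c1 * ?c2 * exp (- X) * exp (- X - Y) * exp (- (real l / q)))"
    unfolding distrib_left by (intro add_mono p1 p2) auto
  also have "\<dots> = (?c1\<^sup>2 + 2 * ?c1 * ?c2 * exp (- X)) * exp (- X - Y) * exp (- (real l / q))"
    by (simp add: algebra_simps)
  finally show ?thesis .
qed

lemma bpair_summable:
  assumes q: "1 \<le> q"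
  shows "summable (\<lambda>l. \<bar>bpair (q ^ 3) n k l\<bar>)"
proof -
  obtain D where D: "\<And>l. q\<^sup>2 * \<bar>bpair (q ^ 3) n k l\<bar> \<le> D * exp (- (real l / q))"
    using abs_bpair_le[OF q order_refl order_refl, of n k] by metis
  have "summable (\<lambda>l. D / q\<^sup>2 * exp (- (1 / q)) ^ l)"
    using q by (intro summable_mult summable_geometric) simp
  then show ?thesis
  proof (rule summable_comparison_test')
    fix l :: nat
    have "\<bar>bpair (q ^ 3) n k l\<bar> \<le> D * exp (- (real l / q)) / q\<^sup>2"
      using D[of l] q by (simp add: pos_le_divide_eq mult.commute)
    then show "norm \<bar>bpair (q ^ 3) n k l\<bar> \<le> D / q\<^sup>2 * exp (- (1 / q)) ^ l"
      by (simp add: exp_of_nat_mult[symmetric])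
  qed
qed

section \<open>Sums as integrals of step functions\<close>

lemma nat_floor_eq_iff:
  assumes "0 \<le> u"
  shows "nat \<lfloor>u\<rfloor> = l \<longleftrightarrow> real l \<le> u \<and> u < real l + 1"
  using assms by (auto simp: nat_eq_iff floor_eq_iff)

lemma emeasure_Ico_finite: "emeasure lborel {a..<b::real} < \<infinity>"
  by (cases "a \<le> b") auto

lemma abs_integral_le:
  fixes f g :: "'a \<Rightarrow> real"
  assumes "integrable M f" "integrable M g" "\<And>x. x \<in> space M \<Longrightarrow> \<bar>f x\<bar> \<le> g x"
  shows "\<bar>integral\<^sup>L M f\<bar> \<le> integral\<^sup>L M g"
proof -
  have "norm (integral\<^sup>L M f) \<le> (LINT x|M. norm (f x))" by (rule integral_norm_bound)
  also have "\<dots> \<le> integral\<^sup>L M g"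
    by (rule integral_mono) (use assms in auto)
  finally show ?thesis by simp
qed

text \<open>Cells of length 1/q partition the half-line from 0, and the integrand is constant on
  each. In this form sums over l with spacing 1/q can pass to an integral by dominated
  convergence.\<close>

lemma step_integral:
  fixes f :: "nat \<Rightarrow> real"
  assumes f: "summable (\<lambda>l. \<bar>f l\<bar>)" and q: "0 < q"
  shows "integrable lborel (\<lambda>u. indicator {0..} u *\<^sub>R f (nat \<lfloor>q * u\<rfloor>))"
    "(LINT u|lborel. indicator {0..} u *\<^sub>R f (nat \<lfloor>q * u\<rfloor>)) = suminf f / q"
proof -
  let ?A = "\<lambda>l::nat. {real l / q..<(real l + 1) / q}"
  let ?g = "\<lambda>l u. f l * indicator (?A l) u"
  have mem: "indicator {0..} u *\<^sub>R f (nat \<lfloor>q * u\<rfloor>) = (if 0 \<le> u then f (nat \<lfloor>q * u\<rfloor>) else 0)" for u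
    by simp
  have ind: "u \<in> ?A l \<longleftrightarrow> 0 \<le> u \<and> nat \<lfloor>q * u\<rfloor> = l" for u l
  proof (cases "0 \<le> u")
    case True
    then show ?thesis
      using q nat_floor_eq_iff[of "q * u" l] by (auto simp: field_simps)
  next
    case False
    have "0 \<le> real l / q" using q by simp
    then show ?thesis using False by auto
  qed
  have fin: "(\<lambda>l. ?g l u) sums (indicator {0..} u *\<^sub>R f (nat \<lfloor>q * u\<rfloor>))" for u
  proof -
    have "(\<lambda>l. if l = nat \<lfloor>q * u\<rfloor> then (if 0 \<le> u then f l else 0) else 0) sums
        (if 0 \<le> u then f (nat \<lfloor>q * u\<rfloor>) else 0)"
      by (rule sums_single)
    moreover have "?g l u = (if l = nat \<lfloor>q * u\<rfloor> then (if 0 \<le> u then f l else 0) else 0)" for l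
      using ind[of u l] by (auto simp: indicator_def)
    ultimately show ?thesis by (simp only: mem)
  qed
  have fin': "summable (\<lambda>l. norm (?g l u))" for u
  proof -
    have "?g l u = 0" if "l \<notin> {nat \<lfloor>q * u\<rfloor>}" for l
      using that ind[of u l] by (simp add: indicator_def)
    then show ?thesis by (intro summable_finite[of "{nat \<lfloor>q * u\<rfloor>}"]) auto
  qed
  have meas: "measure lborel (?A l) = 1 / q" for l
    using q by (simp add: divide_right_mono diff_divide_distrib[symmetric])
  have int: "integrable lborel (?g l)" for l
    by (intro integrable_mult_right integrable_real_indicator emeasure_Ico_finite) simp
  have "(LINT u|lborel. norm (?g l u)) = \<bar>f l\<bar> / q" for l
    using meas[of l] by (simp add: abs_mult)
  then have sums: "summable (\<lambda>l. LINT u|lborel. norm (?g l u))"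
    using summable_divide[OF f, of q] by simp
  have 1: "integrable lborel (\<lambda>u. \<Sum>l. ?g l u)"
    by (rule integrable_suminf[OF int _ sums]) (intro AE_I2 fin')
  have 2: "(LINT u|lborel. (\<Sum>l. ?g l u)) = (\<Sum>l. (LINT u|lborel. ?g l u))"
    by (rule integral_suminf[OF int _ sums]) (intro AE_I2 fin')
  have e: "(\<lambda>u. \<Sum>l. ?g l u) = (\<lambda>u. indicator {0..} u *\<^sub>R f (nat \<lfloor>q * u\<rfloor>))"
    using sums_unique[OF fin] by simp
  show "integrable lborel (\<lambda>u. indicator {0..} u *\<^sub>R f (nat \<lfloor>q * u\<rfloor>))"
    using 1 unfolding e .
  have "(LINT u|lborel. ?g l u) = f l / q" for l using meas[of l] by simp
  then show "(LINT u|lborel. indicator {0..} u *\<^sub>R f (nat \<lfloor>q * u\<rfloor>)) = suminf f / q"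
    using 2 unfolding e by (simp add: suminf_divide[OF summable_rabs_cancel[OF f]])
qed

lemma integrable_exp_minus:
  "integrable lborel (\<lambda>u. indicator {c..} u *\<^sub>R exp (- u :: real))"
proof -
  have "(\<lambda>u. exp (- u :: real)) absolutely_integrable_on {c..}"
    using integrable_on_exp_minus_to_infinity[of 1 c] by (intro nonnegative_absolutely_integrable_1) auto
  then have "integrable (completion lborel) (\<lambda>u. indicator {c..} u *\<^sub>R exp (- u :: real))"
    by (simp add: set_integrable_def)
  then show ?thesis by (subst (asm) integrable_completion) auto
qed

text \<open>A pointwise limit of rescaled Bessel values at rounded arguments, which are measurable
  as functions of an integer part.\<close>

lemma airy_ai_measurable [measurable]: "airy_ai \<in> borel_measurable borel"
proof (rule borel_measurable_LIMSEQ_real)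
  let ?q = "\<lambda>k. real (Suc k)"
  let ?n = "\<lambda>k x. \<lfloor>2 * ?q k ^ 3 + x * ?q k\<rfloor>"
  show "(\<lambda>x. ?q k * bess (?q k ^ 3) (?n k x)) \<in> borel_measurable borel" for k
    by measurable
  fix x :: real
  have "filterlim ?q at_top sequentially"
    by (rule filterlim_compose[OF filterlim_real_sequentially filterlim_Suc])
  moreover have "(\<lambda>k. (real_of_int (?n k x) - 2 * ?q k ^ 3) / ?q k) \<longlonglongrightarrow> x"
  proof (rule tendsto_sandwich)
    have "(\<lambda>k. x - 1 / ?q k) \<longlonglongrightarrow> x - 0"
      by (intro tendsto_diff tendsto_const LIMSEQ_Suc[OF lim_1_over_n])
    then show "(\<lambda>k. x - 1 / ?q k) \<longlonglongrightarrow> x" by simp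
    show "\<forall>\<^sub>F k in sequentially. x - 1 / ?q k \<le> (real_of_int (?n k x) - 2 * ?q k ^ 3) / ?q k"
    proof (rule always_eventually, rule allI)
      fix k
      have "x - 1 / ?q k = (2 * ?q k ^ 3 + x * ?q k - 1 - 2 * ?q k ^ 3) / ?q k"
        by (simp add: field_simps)
      also have "\<dots> \<le> (real_of_int (?n k x) - 2 * ?q k ^ 3) / ?q k"
        by (intro divide_right_mono) linarith+
      finally show "x - 1 / ?q k \<le> (real_of_int (?n k x) - 2 * ?q k ^ 3) / ?q k" .
    qed
    show "\<forall>\<^sub>F k in sequentially. (real_of_int (?n k x) - 2 * ?q k ^ 3) / ?q k \<le> x"
    proof (rule always_eventually, rule allI)
      fix k
      have "(real_of_int (?n k x) - 2 * ?q k ^ 3) / ?q k \<le> (x * ?q k) / ?q k"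
        by (intro divide_right_mono) linarith+
      then show "(real_of_int (?n k x) - 2 * ?q k ^ 3) / ?q k \<le> x" by simp
    qed
  qed simp
  ultimately show "(\<lambda>k. ?q k * bess (?q k ^ 3) (?n k x)) \<longlonglongrightarrow> airy_ai x"
    by (rule bess_tendsto_airy)
qed

text \<open>Here $q = \theta^{1/3}$, and \<open>m\<close> is the cut-off: the particles beyond it are placed on the half-line
  $(s,\infty)$ in cells of length $1/q$. The constant \<open>B\<close> only serves to make the bounds uniform in \<open>k\<close>.\<close>

locale airy_scaling =
  fixes q :: "nat \<Rightarrow> real" and m :: "nat \<Rightarrow> nat" and s B :: real
  assumes q_ge: "1 \<le> q k" and q_top: "filterlim q at_top sequentially"
    and m_lim: "(\<lambda>k. (real (m k) - 2 * q k ^ 3) / q k) \<longlonglongrightarrow> s"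
    and m_ge: "s - B \<le> (real (m k) - 2 * q k ^ 3) / q k"
begin

definition cell :: "nat \<Rightarrow> real \<Rightarrow> nat" where
  "cell k x = nat \<lfloor>(x - s) * q k\<rfloor>"

text \<open>Cell l carries the index m + l + 1, since the complement of {1..m} starts at m +
  1.\<close>

definition idx :: "nat \<Rightarrow> real \<Rightarrow> int" where
  "idx k x = int (m k) + int (cell k x) + 1"

lemma q_pos: "0 < q k"
  using q_ge[of k] by simp

lemma inverse_q_tendsto: "(\<lambda>k. c / q k) \<longlonglongrightarrow> 0"
  by (rule real_tendsto_divide_at_top[OF tendsto_const q_top])

lemma floor_tendsto:
  assumes "0 \<le> u"
  shows "(\<lambda>k. real (nat \<lfloor>u * q k\<rfloor>) / q k) \<longlonglongrightarrow> u"
proof (rule tendsto_sandwich)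
  have "(\<lambda>k. u - 1 / q k) \<longlonglongrightarrow> u - 0"
    by (intro tendsto_diff tendsto_const inverse_q_tendsto)
  then show "(\<lambda>k. u - 1 / q k) \<longlonglongrightarrow> u" by simp
  have n: "real (nat \<lfloor>u * q k\<rfloor>) = of_int \<lfloor>u * q k\<rfloor>" for k
    using assms q_pos[of k] by simp
  show "\<forall>\<^sub>F k in sequentially. u - 1 / q k \<le> real (nat \<lfloor>u * q k\<rfloor>) / q k"
  proof (rule always_eventually, rule allI)
    fix k
    have "u - 1 / q k = (u * q k - 1) / q k" using q_pos[of k] by (simp add: field_simps)
    also have "\<dots> \<le> real (nat \<lfloor>u * q k\<rfloor>) / q k"
      unfolding n using q_pos[of k] by (intro divide_right_mono) linarith+
    finally show "u - 1 / q k \<le> real (nat \<lfloor>u * q k\<rfloor>) / q k" .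
  qed
  show "\<forall>\<^sub>F k in sequentially. real (nat \<lfloor>u * q k\<rfloor>) / q k \<le> u"
    using q_pos unfolding n by (intro always_eventually allI) (simp add: pos_divide_le_eq)
qed simp

lemma idx_tendsto:
  assumes "s \<le> x"
  shows "(\<lambda>k. (real_of_int (idx k x) - 2 * q k ^ 3) / q k) \<longlonglongrightarrow> x"
proof -
  have "(\<lambda>k. (real (m k) - 2 * q k ^ 3) / q k + real (cell k x) / q k + 1 / q k) \<longlonglongrightarrow>
      s + (x - s) + 0"
    unfolding cell_def
    by (intro tendsto_add m_lim floor_tendsto inverse_q_tendsto) (use assms in simp)
  then show ?thesis
    by (simp add: idx_def add_divide_distrib[symmetric] algebra_simps)
qed

text \<open>The 1 added in \<open>idx\<close> makes up for rounding down in \<open>cell\<close>, so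
  the only loss is B.\<close>

lemma idx_ge:
  assumes "s \<le> x"
  shows "x - B \<le> (real_of_int (idx k x) - 2 * q k ^ 3) / q k"
proof -
  have "(x - s) * q k \<le> real (cell k x) + 1"
    using assms q_pos[of k] unfolding cell_def by linarith
  then have "x - s \<le> (real (cell k x) + 1) / q k"
    using q_pos[of k] by (simp add: pos_le_divide_eq)
  then have "x - B \<le> (real (m k) - 2 * q k ^ 3) / q k + (real (cell k x) + 1) / q k"
    using m_ge[of k] by linarith
  also have "\<dots> = (real_of_int (idx k x) - 2 * q k ^ 3) / q k"
    by (simp add: idx_def add_divide_distrib[symmetric] algebra_simps)
  finally show ?thesis .
qed

definition scaled_pair :: "nat \<Rightarrow> real \<Rightarrow> real \<Rightarrow> real \<Rightarrow> real" where
  "scaled_pair k x y u = indicator {0..} u *\<^sub>R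
     ((q k)\<^sup>2 * bpair (q k ^ 3) (idx k x) (idx k y) (nat \<lfloor>q k * u\<rfloor>))"

text \<open>Read from \<open>abs_bpair_le\<close> with X = x - B and Y = y - B: exp (B - s) bounds
  exp (-X), exp (2 B) comes from X + Y, and exp 1 from rounding q u down, as 1/q <= 1.\<close>

definition bound_const :: real where
  "bound_const = ((bess_const 1)\<^sup>2 + 2 * bess_const 1 * bess_const 2 * exp (B - s)) * exp (2 * B) * exp 1"

lemma bound_const_nonneg: "0 \<le> bound_const"
  by (simp add: bound_const_def bess_const_def)

lemma scaled_pair_integral:
  "integrable lborel (scaled_pair k x y)"
  "(LINT u|lborel. scaled_pair k x y u) = q k * bessK (q k ^ 3) (idx k x) (idx k y)"
proof -
  let ?f = "\<lambda>l. (q k)\<^sup>2 * bpair (q k ^ 3) (idx k x) (idx k y) l"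
  have S: "summable (\<lambda>l. \<bar>?f l\<bar>)"
    using summable_mult[OF bpair_summable[OF q_ge[of k], of "idx k x" "idx k y"], of "(q k)\<^sup>2"]
    by (simp add: abs_mult)
  show "integrable lborel (scaled_pair k x y)"
    unfolding scaled_pair_def[abs_def] by (rule step_integral(1)[OF S q_pos])
  have "suminf ?f = (q k)\<^sup>2 * bessK (q k ^ 3) (idx k x) (idx k y)"
    by (rule sums_unique[symmetric]) (intro sums_mult bpair_sums)
  then show "(LINT u|lborel. scaled_pair k x y u) = q k * bessK (q k ^ 3) (idx k x) (idx k y)"
    unfolding scaled_pair_def using step_integral(2)[OF S q_pos[of k]] q_pos[of k]
    by (simp add: power2_eq_square)
qed

lemma abs_scaled_pair_le:
  assumes x: "s \<le> x" and y: "s \<le> y"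
  shows "\<bar>scaled_pair k x y u\<bar> \<le> (bound_const * exp (- x - y)) * (indicator {0..} u *\<^sub>R exp (- u))"
proof (cases "0 \<le> u")
  case True
  let ?l = "nat \<lfloor>q k * u\<rfloor>"
  let ?c = "(bess_const 1)\<^sup>2 + 2 * bess_const 1 * bess_const 2 * exp (- (x - B))"
  let ?d = "(bess_const 1)\<^sup>2 + 2 * bess_const 1 * bess_const 2 * exp (B - s)"
  have bc: "0 \<le> bess_const 1" "0 \<le> bess_const 2" by (simp_all add: bess_const_def)
  have cd: "?c \<le> ?d" using x bc by (intro add_left_mono mult_left_mono) auto
  have c0: "0 \<le> ?c" using bc by simp
  have l: "exp (- (real ?l / q k)) \<le> exp 1 * exp (- u)"
  proof -
    have "q k * u - 1 \<le> real ?l" using True q_pos[of k] by linarith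
    then have "(q k * u - 1) / q k \<le> real ?l / q k" using q_pos[of k] by (intro divide_right_mono) auto
    moreover have "(q k * u - 1) / q k = u - 1 / q k" using q_pos[of k] by (simp add: field_simps)
    moreover have "1 / q k \<le> 1" using q_ge[of k] by simp
    ultimately have "- (real ?l / q k) \<le> 1 + - u" by linarith
    then show ?thesis unfolding exp_add[symmetric] by simp
  qed
  have "(q k)\<^sup>2 * \<bar>bpair (q k ^ 3) (idx k x) (idx k y) ?l\<bar> \<le>
      ?c * exp (- (x - B) - (y - B)) * exp (- (real ?l / q k))"
    by (rule abs_bpair_le[OF q_ge idx_ge[OF x] idx_ge[OF y]])
  also have "\<dots> \<le> ?d * exp (- (x - B) - (y - B)) * (exp 1 * exp (- u))"
    by (intro mult_mono cd l mult_nonneg_nonneg c0 order_trans[OF c0 cd]) auto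
  also have "exp (- (x - B) - (y - B)) = exp (2 * B) * exp (- x - y)"
    unfolding exp_add[symmetric] by simp
  finally show ?thesis
    using True by (simp add: scaled_pair_def bound_const_def abs_mult mult_ac)
next
  case False
  then show ?thesis by (simp add: scaled_pair_def)
qed

text \<open>The indices 2l and 2l + 1 have the same scaled limit, so the two products of each pair
  converge to the same value and cancel; only the first term of \<open>bpair\<close>
  survives.\<close>

lemma scaled_pair_tendsto:
  assumes x: "s \<le> x" and y: "s \<le> y"
  shows "(\<lambda>k. scaled_pair k x y u) \<longlonglongrightarrow> indicator {0..} u *\<^sub>R (airy_ai (x + u) * airy_ai (y + u))"
proof (cases "0 \<le> u")
  case True
  let ?l = "\<lambda>k. nat \<lfloor>q k * u\<rfloor>"
  have l: "(\<lambda>k. real (?l k) / q k) \<longlonglongrightarrow> u"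
    using floor_tendsto[OF True] by (simp add: mult.commute)
  have shift: "(\<lambda>k. q k * bess (q k ^ 3) (idx k z + j k)) \<longlonglongrightarrow> airy_ai (z + w)"
    if "s \<le> z" "(\<lambda>k. real_of_int (j k) / q k) \<longlonglongrightarrow> w" for z w and j :: "nat \<Rightarrow> int"
  proof (rule bess_tendsto_airy[OF q_top])
    have "(\<lambda>k. (real_of_int (idx k z) - 2 * q k ^ 3) / q k + real_of_int (j k) / q k) \<longlonglongrightarrow> z + w"
      by (intro tendsto_add idx_tendsto that)
    then show "(\<lambda>k. (real_of_int (idx k z + j k) - 2 * q k ^ 3) / q k) \<longlonglongrightarrow> z + w"
      by (simp add: add_divide_distrib[symmetric] algebra_simps)
  qed
  have l2: "(\<lambda>k. 2 * (real (?l k) / q k)) \<longlonglongrightarrow> 2 * u" by (intro tendsto_intros l)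
  have l3: "(\<lambda>k. 2 * (real (?l k) / q k) + 1 / q k) \<longlonglongrightarrow> 2 * u + 0"
    by (intro tendsto_intros l inverse_q_tendsto)
  have e2: "real_of_int (int (2 * l)) / c = 2 * (real l / c)"
    and e3: "real_of_int (int (2 * l + 1)) / c = 2 * (real l / c) + 1 / c" for l c
    by (simp_all add: add_divide_distrib)
  have j1: "(\<lambda>k. real_of_int (int (?l k)) / q k) \<longlonglongrightarrow> u"
    using l by (simp only: of_int_of_nat_eq)
  have j2: "(\<lambda>k. real_of_int (int (2 * ?l k)) / q k) \<longlonglongrightarrow> 2 * u"
    using l2 by (simp only: e2)
  have j3: "(\<lambda>k. real_of_int (int (2 * ?l k + 1)) / q k) \<longlonglongrightarrow> 2 * u"
    using l3 by (simp only: e3 add_0_right)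
  have j2': "(\<lambda>k. real_of_int (- int (2 * ?l k)) / q k) \<longlonglongrightarrow> - (2 * u)"
    using tendsto_minus[OF j2] by (simp only: of_int_minus minus_divide_left)
  have j3': "(\<lambda>k. real_of_int (- int (2 * ?l k + 1)) / q k) \<longlonglongrightarrow> - (2 * u)"
    using tendsto_minus[OF j3] by (simp only: of_int_minus minus_divide_left)
  have "(\<lambda>k. (q k * bess (q k ^ 3) (idx k x + int (?l k))) * (q k * bess (q k ^ 3) (idx k y + int (?l k))) -
      ((q k * bess (q k ^ 3) (idx k x + int (2 * ?l k))) * (q k * bess (q k ^ 3) (idx k y + - int (2 * ?l k))) -
       (q k * bess (q k ^ 3) (idx k x + int (2 * ?l k + 1))) * (q k * bess (q k ^ 3) (idx k y + - int (2 * ?l k + 1))))) \<longlonglongrightarrow>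
      airy_ai (x + u) * airy_ai (y + u) -
      (airy_ai (x + 2 * u) * airy_ai (y + - (2 * u)) - airy_ai (x + 2 * u) * airy_ai (y + - (2 * u)))"
    by (intro tendsto_diff tendsto_mult shift x y j1 j2 j3 j2' j3')
  then have "(\<lambda>k. (q k)\<^sup>2 * bpair (q k ^ 3) (idx k x) (idx k y) (?l k)) \<longlonglongrightarrow> airy_ai (x + u) * airy_ai (y + u)"
    unfolding bpair_def by (simp add: power2_eq_square algebra_simps)
  then show ?thesis using True by (simp add: scaled_pair_def)
next
  case False
  then show ?thesis by (simp add: scaled_pair_def)
qed

definition exp_mass :: real where
  "exp_mass = (LINT u|lborel. indicator {0..} u *\<^sub>R exp (- u :: real))"

lemma exp_mass_nonneg: "0 \<le> exp_mass"
  unfolding exp_mass_def by (rule integral_nonneg_AE) auto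

lemma kernel_tendsto:
  assumes x: "s \<le> x" and y: "s \<le> y"
  shows "(\<lambda>k. q k * bessK (q k ^ 3) (idx k x) (idx k y)) \<longlonglongrightarrow> airy_kernel x y"
proof -
  have "(\<lambda>k. LINT u|lborel. scaled_pair k x y u) \<longlonglongrightarrow>
      (LINT u|lborel. indicator {0..} u *\<^sub>R (airy_ai (x + u) * airy_ai (y + u)))"
  proof (rule integral_dominated_convergence)
    show "(\<lambda>u. indicator {0..} u *\<^sub>R (airy_ai (x + u) * airy_ai (y + u))) \<in> borel_measurable lborel"
      by measurable
    show "scaled_pair k x y \<in> borel_measurable lborel" for k
      using scaled_pair_integral(1) by (rule borel_measurable_integrable)
    show "integrable lborel (\<lambda>u. (bound_const * exp (- x - y)) * (indicator {0..} u *\<^sub>R exp (- u)))"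
      by (intro integrable_mult_right integrable_exp_minus)
    show "AE u in lborel. (\<lambda>k. scaled_pair k x y u) \<longlonglongrightarrow> indicator {0..} u *\<^sub>R (airy_ai (x + u) * airy_ai (y + u))"
      by (intro AE_I2 scaled_pair_tendsto x y)
    show "AE u in lborel. norm (scaled_pair k x y u) \<le>
        (bound_const * exp (- x - y)) * (indicator {0..} u *\<^sub>R exp (- u))" for k
      unfolding real_norm_def by (intro AE_I2 abs_scaled_pair_le x y)
  qed
  then show ?thesis
    by (simp add: scaled_pair_integral airy_kernel_def set_lebesgue_integral_def)
qed

lemma abs_kernel_le:
  assumes x: "s \<le> x" and y: "s \<le> y"
  shows "\<bar>q k * bessK (q k ^ 3) (idx k x) (idx k y)\<bar> \<le> (bound_const * exp_mass) * (exp (- x) * exp (- y))"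
proof -
  have "\<bar>LINT u|lborel. scaled_pair k x y u\<bar> \<le>
      (LINT u|lborel. (bound_const * exp (- x - y)) * (indicator {0..} u *\<^sub>R exp (- u)))"
  proof (rule abs_integral_le)
    show "integrable lborel (\<lambda>u. (bound_const * exp (- x - y)) * (indicator {0..} u *\<^sub>R exp (- u)))"
      by (intro integrable_mult_right integrable_exp_minus)
    show "\<bar>scaled_pair k x y u\<bar> \<le> (bound_const * exp (- x - y)) * (indicator {0..} u *\<^sub>R exp (- u))" for u
      by (rule abs_scaled_pair_le[OF x y])
  qed (rule scaled_pair_integral)
  also have "\<dots> = (bound_const * exp (- x - y)) * exp_mass"
    unfolding exp_mass_def by (rule integral_mult_right_zero)
  also have "exp (- x - y) = exp (- x) * exp (- y)"
    unfolding exp_add[symmetric] by simp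
  finally show ?thesis by (simp add: scaled_pair_integral mult_ac)
qed

text \<open>Set to 0 outside the first M cells, because the determinants it represents have finite
  size M.\<close>

definition step_kernel :: "nat \<Rightarrow> nat \<Rightarrow> real \<Rightarrow> real \<Rightarrow> real" where
  "step_kernel M k x y = (if cell k x < M \<and> cell k y < M
     then q k * bessK (q k ^ 3) (idx k x) (idx k y) else 0)"

lemma abs_step_kernel_le:
  assumes "s \<le> x" "s \<le> y"
  shows "\<bar>step_kernel M k x y\<bar> \<le> (bound_const * exp_mass) * (exp (- x) * exp (- y))"
  using abs_kernel_le[OF assms, of k] bound_const_nonneg exp_mass_nonneg
  by (auto simp: step_kernel_def)

section \<open>Discrete determinants as integrals over the half-line\<close>

abbreviation half_line :: "real measure" where
  "half_line \<equiv> restrict_space lborel {s<..}"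

lemma product_sigma_finite_half_line: "product_sigma_finite (\<lambda>_::nat. half_line)"
  by (intro product_sigma_finite.intro sigma_finite_measure_restrict_space sigma_finite_lborel) auto

text \<open>Hadamard's inequality, keeping exp (-x i) of each row and bounding exp (-x j) by exp
  (-s). It yields n^(n/2), small against n!; a count of permutations would leave only a geometric
  series.\<close>

lemma abs_kdet_step_kernel_le:
  assumes x: "\<And>i. i < n \<Longrightarrow> s < x i"
  shows "\<bar>kdet (step_kernel M k) n x\<bar> \<le>
    (\<Prod>i<n. (bound_const * exp_mass * exp (- s) * sqrt (real n)) * exp (- x i))"
proof -
  let ?C = "bound_const * exp_mass"
  have C: "0 \<le> ?C" using bound_const_nonneg exp_mass_nonneg by simp
  have "\<bar>kdet (step_kernel M k) n x\<bar> \<le> (\<Prod>i<n. sqrt (\<Sum>j<n. (step_kernel M k (x i) (x j))\<^sup>2))"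
    unfolding kdet_eq_ldet by (rule ldet_hadamard)
  also have "\<dots> \<le> (\<Prod>i<n. (?C * exp (- s) * sqrt (real n)) * exp (- x i))"
  proof (rule prod_mono, intro conjI)
    fix i assume i: "i \<in> {..<n}"
    show "0 \<le> sqrt (\<Sum>j<n. (step_kernel M k (x i) (x j))\<^sup>2)" by (simp add: sum_nonneg)
    have "(\<Sum>j<n. (step_kernel M k (x i) (x j))\<^sup>2) \<le> (\<Sum>j<n. (?C * (exp (- x i) * exp (- s)))\<^sup>2)"
    proof (rule sum_mono)
      fix j assume j: "j \<in> {..<n}"
      have "\<bar>step_kernel M k (x i) (x j)\<bar> \<le> ?C * (exp (- x i) * exp (- x j))"
        using x[of i] x[of j] i j by (intro abs_step_kernel_le) auto
      also have "\<dots> \<le> ?C * (exp (- x i) * exp (- s))"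
        using x[of j] j C by (intro mult_left_mono) auto
      finally have "\<bar>step_kernel M k (x i) (x j)\<bar>\<^sup>2 \<le> (?C * (exp (- x i) * exp (- s)))\<^sup>2"
        by (intro power_mono) auto
      then show "(step_kernel M k (x i) (x j))\<^sup>2 \<le> (?C * (exp (- x i) * exp (- s)))\<^sup>2" by simp
    qed
    also have "\<dots> = real n * (?C * (exp (- x i) * exp (- s)))\<^sup>2" by simp
    finally have "sqrt (\<Sum>j<n. (step_kernel M k (x i) (x j))\<^sup>2) \<le> sqrt (real n * (?C * (exp (- x i) * exp (- s)))\<^sup>2)"
      by (rule real_sqrt_le_mono)
    also have "\<dots> = sqrt (real n) * (?C * (exp (- x i) * exp (- s)))"
      using C by (simp add: real_sqrt_mult)
    finally show "sqrt (\<Sum>j<n. (step_kernel M k (x i) (x j))\<^sup>2) \<le> (?C * exp (- s) * sqrt (real n)) * exp (- x i)"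
      by (simp add: mult_ac)
  qed
  finally show ?thesis .
qed

definition cellset :: "nat \<Rightarrow> nat \<Rightarrow> real set" where
  "cellset k l = {x. s < x \<and> cell k x = l}"

lemma cellset_eq: "cellset k l = {s + real l / q k..<s + (real l + 1) / q k} \<inter> {s<..}"
proof (rule Set.set_eqI)
  fix x
  show "x \<in> cellset k l \<longleftrightarrow> x \<in> {s + real l / q k..<s + (real l + 1) / q k} \<inter> {s<..}"
  proof (cases "s < x")
    case True
    then have "cell k x = l \<longleftrightarrow> real l \<le> (x - s) * q k \<and> (x - s) * q k < real l + 1"
      unfolding cell_def using q_pos[of k] by (intro nat_floor_eq_iff) simp
    also have "\<dots> \<longleftrightarrow> real l / q k \<le> x - s \<and> x - s < (real l + 1) / q k"
      using q_pos[of k] by (simp add: pos_divide_le_eq pos_less_divide_eq)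
    finally show ?thesis using True by (auto simp: cellset_def)
  qed (simp add: cellset_def)
qed

text \<open>The half-line is open at s, so the first cell lacks its left end point, which is a null
  set.\<close>

lemma cellset_integral:
  "integrable half_line (indicator (cellset k l) :: real \<Rightarrow> real)"
  "(LINT x|half_line. indicator (cellset k l) x) = 1 / q k"
proof -
  let ?I = "{s + real l / q k..<s + (real l + 1) / q k}"
  have e: "AE x in lborel. indicator {s<..} x *\<^sub>R indicator (cellset k l) x = (indicator ?I x :: real)"
  proof -
    have "AE x in lborel. x \<noteq> s" by (rule AE_lborel_singleton)
    then show ?thesis
    proof eventually_elim
      case (elim x)
      have "0 \<le> real l / q k" using q_pos[of k] by simp
      then have "x \<in> ?I \<Longrightarrow> s < x" using elim by auto
      then show ?case by (auto simp: cellset_eq indicator_def)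
    qed
  qed
  have meas: "(\<lambda>x. indicator {s<..} x *\<^sub>R indicator (cellset k l) x :: real) \<in> borel_measurable lborel"
    unfolding cellset_eq by measurable
  have I: "integrable lborel (indicator ?I :: real \<Rightarrow> real)"
    by (intro integrable_real_indicator emeasure_Ico_finite) simp
  have "integrable lborel (\<lambda>x. indicator {s<..} x *\<^sub>R indicator (cellset k l) x :: real)"
    using I integrable_cong_AE[OF meas _ e] by auto
  then show "integrable half_line (indicator (cellset k l) :: real \<Rightarrow> real)"
    by (subst integrable_restrict_space) auto
  have "(LINT x|half_line. indicator (cellset k l) x) =
      (LINT x|lborel. indicator {s<..} x *\<^sub>R indicator (cellset k l) x :: real)"
    by (rule integral_restrict_space) auto
  also have "\<dots> = (LINT x|lborel. indicator ?I x)"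
    by (rule integral_cong_AE[OF meas _ e]) auto
  also have "\<dots> = 1 / q k"
    using q_pos[of k] by (simp add: divide_right_mono diff_divide_distrib[symmetric])
  finally show "(LINT x|half_line. indicator (cellset k l) x) = 1 / q k" .
qed

text \<open>The step kernel is constant on products of cells, and x lies in exactly one such box;
  when some cell index is at least M, both sides are 0.\<close>

lemma kdet_step_kernel_eq:
  assumes x: "\<And>i. i < n \<Longrightarrow> s < x i"
  shows "kdet (step_kernel M k) n x =
    (\<Sum>\<tau>\<in>{..<n} \<rightarrow>\<^sub>E {..<M}. q k ^ n * ldet n (\<lambda>i j. bessK (q k ^ 3) (int (m k + \<tau> i) + 1) (int (m k + \<tau> j) + 1)) *
      (\<Prod>i<n. indicator (cellset k (\<tau> i)) (x i)))" (is "_ = (\<Sum>\<tau>\<in>?S. ?h \<tau> * ?p \<tau>)")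
proof -
  let ?t = "\<lambda>i. if i < n then cell k (x i) else undefined"
  have p: "?p \<tau> = (if \<tau> = ?t then 1 else 0)" if \<tau>: "\<tau> \<in> ?S" for \<tau>
  proof (cases "\<tau> = ?t")
    case True
    then show ?thesis using x by (auto simp: cellset_def)
  next
    case False
    then obtain i where i: "\<tau> i \<noteq> ?t i" by auto
    then have "i < n" using \<tau> by (cases "i < n") (auto simp: PiE_def extensional_def)
    then have "indicator (cellset k (\<tau> i)) (x i) = (0::real)" using i by (auto simp: cellset_def)
    then have "?p \<tau> = 0" using \<open>i < n\<close> by (intro prod_zero) auto
    then show ?thesis using False by simp
  qed
  have fin: "finite ?S" by (simp add: finite_PiE)
  have "(\<Sum>\<tau>\<in>?S. ?h \<tau> * ?p \<tau>) = (\<Sum>\<tau>\<in>?S. if \<tau> = ?t then ?h ?t else 0)"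
    by (rule sum.cong) (simp_all add: p)
  also have "\<dots> = (if ?t \<in> ?S then ?h ?t else 0)" using fin by simp
  also have "\<dots> = kdet (step_kernel M k) n x"
  proof (cases "\<forall>i<n. cell k (x i) < M")
    case True
    then have "?t \<in> ?S" by (auto simp: PiE_def extensional_def)
    moreover have "kdet (step_kernel M k) n x = ldet n (\<lambda>i j. q k * bessK (q k ^ 3) (int (m k + ?t i) + 1) (int (m k + ?t j) + 1))"
      unfolding kdet_eq_ldet using True by (intro ldet_cong) (simp add: step_kernel_def idx_def)
    moreover have "\<dots> = ?h ?t"
      by (subst ldet_scale_rows) simp
    ultimately show ?thesis by simp
  next
    case False
    then obtain i where i: "i < n" "\<not> cell k (x i) < M" by blast
    then have "?t \<notin> ?S" by (auto simp: PiE_iff)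
    moreover have "kdet (step_kernel M k) n x = 0"
    proof -
      have "(\<Prod>l<n. step_kernel M k (x l) (x (p l))) = 0" for p :: "nat \<Rightarrow> nat"
        by (rule prod_zero) (use i in \<open>auto simp: step_kernel_def intro!: bexI[of _ i]\<close>)
      then show ?thesis by (simp add: kdet_def del: prod_zero_iff)
    qed
    ultimately show ?thesis by simp
  qed
  finally show ?thesis by simp
qed

abbreviation half_space :: "nat \<Rightarrow> (nat \<Rightarrow> real) measure" where
  "half_space n \<equiv> Pi\<^sub>M {..<n} (\<lambda>_. half_line)"

lemma space_half_space: "x \<in> space (half_space n) \<Longrightarrow> i < n \<Longrightarrow> s < x i"
  by (auto simp: space_PiM space_restrict_space)

text \<open>A box of n cells has volume q^(-n), which cancels the factor q^n from the rescaled
  kernel.\<close>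

lemma kdet_step_kernel_integral:
  "integrable (half_space n) (kdet (step_kernel M k) n)"
  "(LINT x|half_space n. kdet (step_kernel M k) n x) =
    (\<Sum>\<tau>\<in>{..<n} \<rightarrow>\<^sub>E {..<M}. ldet n (\<lambda>i j. bessK (q k ^ 3) (int (m k + \<tau> i) + 1) (int (m k + \<tau> j) + 1)))"
proof -
  interpret product_sigma_finite "\<lambda>_::nat. half_line" by (rule product_sigma_finite_half_line)
  let ?S = "{..<n} \<rightarrow>\<^sub>E {..<M}"
  let ?d = "\<lambda>\<tau>. ldet n (\<lambda>i j. bessK (q k ^ 3) (int (m k + \<tau> i) + 1) (int (m k + \<tau> j) + 1))"
  let ?p = "\<lambda>\<tau> x. \<Prod>i<n. indicator (cellset k (\<tau> i)) (x i) :: real"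
  let ?F = "\<lambda>x. \<Sum>\<tau>\<in>?S. q k ^ n * ?d \<tau> * ?p \<tau> x"
  have ip: "integrable (half_space n) (?p \<tau>)" for \<tau>
    by (rule product_integrable_prod) (auto intro: cellset_integral)
  have lp: "(LINT x|half_space n. ?p \<tau> x) = (1 / q k) ^ n" for \<tau>
    by (subst product_integral_prod[OF finite_lessThan cellset_integral(1)])
       (simp only: cellset_integral(2) prod_constant card_lessThan)
  have iF: "integrable (half_space n) ?F"
    by (intro Bochner_Integration.integrable_sum integrable_mult_right ip)
  have eq: "kdet (step_kernel M k) n x = ?F x" if "x \<in> space (half_space n)" for x
    by (rule kdet_step_kernel_eq) (use space_half_space[OF that] in auto)
  show "integrable (half_space n) (kdet (step_kernel M k) n)"
    using iF by (subst Bochner_Integration.integrable_cong[OF refl eq])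
  have "(LINT x|half_space n. kdet (step_kernel M k) n x) = (LINT x|half_space n. ?F x)"
    by (rule Bochner_Integration.integral_cong) (simp_all add: eq)
  also have "\<dots> = (\<Sum>\<tau>\<in>?S. q k ^ n * ?d \<tau> * (1 / q k) ^ n)"
    by (subst Bochner_Integration.integral_sum) (auto intro!: integrable_mult_right ip simp: lp)
  also have "\<dots> = (\<Sum>\<tau>\<in>?S. ?d \<tau>)"
    using q_pos[of k] by (simp add: power_divide)
  finally show "(LINT x|half_space n. kdet (step_kernel M k) n x) = (\<Sum>\<tau>\<in>?S. ?d \<tau>)" .
qed

text \<open>The finite series \<open>ldet_one_plus\<close> for 1 - K. It may be written as an
  infinite one because the terms beyond M vanish, there being no n-subset of M indices.\<close>

lemma ldet_Rn_eq_series: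
  "(\<lambda>n. (-1) ^ n / fact n * (LINT x|half_space n. kdet (step_kernel M k) n x)) sums
    ldet M (\<lambda>i j. Rn (q k ^ 3) (m k + i) (m k + j))"
proof -
  let ?A = "\<lambda>i j. bessK (q k ^ 3) (int (m k + i) + 1) (int (m k + j) + 1)"
  let ?f = "\<lambda>n. (-1) ^ n / fact n * (LINT x|half_space n. kdet (step_kernel M k) n x)"
  have neg: "ldet n (\<lambda>i j. - A i j) = (-1) ^ n * ldet n A" for n and A :: "nat \<Rightarrow> nat \<Rightarrow> real"
    using ldet_scale_rows[of n "\<lambda>_. - 1" A] by simp
  have "ldet M (\<lambda>i j. Rn (q k ^ 3) (m k + i) (m k + j)) = ldet M (\<lambda>i j. (if i = j then 1 else 0) + - ?A i j)"
    by (rule ldet_cong) (simp add: Rn_def resK_eq_one_minus_bessK)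
  also have "\<dots> = (\<Sum>n\<le>M. (\<Sum>x\<in>{..<n} \<rightarrow>\<^sub>E {..<M}. ldet n (\<lambda>i j. - ?A (x i) (x j))) / fact n)"
    by (rule ldet_one_plus)
  also have "\<dots> = (\<Sum>n\<le>M. ?f n)"
    by (simp only: neg kdet_step_kernel_integral(2) sum_distrib_left[symmetric]) simp
  finally have e: "ldet M (\<lambda>i j. Rn (q k ^ 3) (m k + i) (m k + j)) = (\<Sum>n\<le>M. ?f n)" .
  have z: "?f n = 0" if "n \<notin> {..M}" for n
  proof -
    have "card T \<noteq> n" if "T \<subseteq> {..<M}" for T
      using card_mono[OF finite_lessThan that] \<open>n \<notin> {..M}\<close> by auto
    then have e: "{T. T \<subseteq> {..<M} \<and> card T = n} = {}" by blast
    show ?thesis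
      unfolding kdet_step_kernel_integral(2) sum_tuples_ldet[of n ?A M] e by simp
  qed
  show ?thesis unfolding e by (rule sums_finite) (use z in auto)
qed

definition series_const :: real where
  "series_const = bound_const * exp_mass * exp (- s) * (LINT x|half_line. exp (- x))"

lemma integrable_half_line_exp: "integrable half_line (\<lambda>x. exp (- x))"
proof (subst integrable_restrict_space)
  have "integrable lborel (\<lambda>x. indicator {s<..} x *\<^sub>R (indicator {s..} x *\<^sub>R exp (- x :: real)))"
    using integrable_mult_indicator[OF _ integrable_exp_minus[of s], of "{s<..}"] by simp
  moreover have "(\<lambda>x. indicator {s<..} x *\<^sub>R (indicator {s..} x *\<^sub>R exp (- x :: real))) =
      (\<lambda>x. indicator {s<..} x *\<^sub>R exp (- x))"
    by (auto simp: fun_eq_iff indicator_def)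
  ultimately show "integrable lborel (\<lambda>x. indicator {s<..} x *\<^sub>R exp (- x))"
    by (simp only:)
qed simp

lemma series_const_nonneg: "0 \<le> series_const"
  unfolding series_const_def using bound_const_nonneg exp_mass_nonneg
  by (intro mult_nonneg_nonneg integral_nonneg_AE) auto

lemma kdet_dominator:
  "integrable (half_space n) (\<lambda>x. \<Prod>i<n. (bound_const * exp_mass * exp (- s) * sqrt (real n)) * exp (- x i))"
  "(LINT x|half_space n. (\<Prod>i<n. (bound_const * exp_mass * exp (- s) * sqrt (real n)) * exp (- x i))) =
    (series_const * sqrt (real n)) ^ n"
proof -
  interpret product_sigma_finite "\<lambda>_::nat. half_line" by (rule product_sigma_finite_half_line)
  let ?c = "bound_const * exp_mass * exp (- s) * sqrt (real n)"
  have I: "integrable half_line (\<lambda>x. ?c * exp (- x))"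
    by (intro integrable_mult_right integrable_half_line_exp)
  show "integrable (half_space n) (\<lambda>x. \<Prod>i<n. ?c * exp (- x i))"
    by (rule product_integrable_prod) (use I in auto)
  have "(LINT x|half_space n. (\<Prod>i<n. ?c * exp (- x i))) = (\<Prod>i<n. (LINT x|half_line. ?c * exp (- x)))"
    by (rule product_integral_prod) (use I in auto)
  also have "\<dots> = (series_const * sqrt (real n)) ^ n"
    by (simp add: series_const_def mult_ac)
  finally show "(LINT x|half_space n. (\<Prod>i<n. ?c * exp (- x i))) = (series_const * sqrt (real n)) ^ n" .
qed

lemma abs_kdet_integral_le:
  "\<bar>LINT x|half_space n. kdet (step_kernel M k) n x\<bar> \<le> (series_const * sqrt (real n)) ^ n"
proof -
  have "\<bar>LINT x|half_space n. kdet (step_kernel M k) n x\<bar> \<le>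
      (LINT x|half_space n. (\<Prod>i<n. (bound_const * exp_mass * exp (- s) * sqrt (real n)) * exp (- x i)))"
  proof (rule abs_integral_le)
    fix x assume "x \<in> space (half_space n)"
    then show "\<bar>kdet (step_kernel M k) n x\<bar> \<le>
        (\<Prod>i<n. (bound_const * exp_mass * exp (- s) * sqrt (real n)) * exp (- x i))"
      by (intro abs_kdet_step_kernel_le space_half_space)
  qed (rule kdet_step_kernel_integral kdet_dominator)+
  then show ?thesis by (simp add: kdet_dominator)
qed

text \<open>As M k / q k tends to infinity, the cells in use eventually cover every fixed point and
  the cut-off of \<open>step_kernel\<close> disappears.\<close>

lemma kdet_integral_tendsto:
  assumes M: "filterlim (\<lambda>k. real (M k) / q k) at_top sequentially"
  shows "(\<lambda>k. LINT x|half_space n. kdet (step_kernel (M k) k) n x) \<longlonglongrightarrow>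
    (LINT x|half_space n. kdet airy_kernel n x)"
proof -
  have ker: "(\<lambda>k. step_kernel (M k) k x y) \<longlonglongrightarrow> airy_kernel x y" if xy: "s \<le> x" "s \<le> y" for x y
  proof (rule Lim_transform_eventually[OF kernel_tendsto[OF xy]])
    have c: "\<forall>\<^sub>F k in sequentially. cell k z < M k" if z: "s \<le> z" for z
    proof -
      have "\<forall>\<^sub>F k in sequentially. z - s < real (M k) / q k"
        using M by (simp add: filterlim_at_top_dense)
      then show ?thesis
      proof eventually_elim
        case (elim k)
        then have "(z - s) * q k < real (M k)" using q_pos[of k] by (simp add: pos_less_divide_eq)
        moreover have "0 \<le> (z - s) * q k" using z q_pos[of k] by simp
        ultimately show ?case unfolding cell_def by (subst nat_less_iff) (simp_all add: floor_less_iff)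
      qed
    qed
    show "\<forall>\<^sub>F k in sequentially. q k * bessK (q k ^ 3) (idx k x) (idx k y) = step_kernel (M k) k x y"
      using c[OF xy(1)] c[OF xy(2)] by eventually_elim (simp add: step_kernel_def)
  qed
  have lim: "(\<lambda>k. kdet (step_kernel (M k) k) n x) \<longlonglongrightarrow> kdet airy_kernel n x"
    if x: "x \<in> space (half_space n)" for x
    unfolding kdet_def
  proof (intro tendsto_sum tendsto_mult tendsto_const tendsto_prod ker)
    fix p i assume "p \<in> {p. p permutes {..<n}}" "i \<in> {..<n}"
    then have "i < n" "p i < n" using permutes_in_image[of p "{..<n}" i] by auto
    then show "s \<le> x i" "s \<le> x (p i)" using space_half_space[OF x] by (auto simp: less_imp_le)
  qed
  have meas: "kdet (step_kernel (M k) k) n \<in> borel_measurable (half_space n)" for k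
    using kdet_step_kernel_integral(1) by (rule borel_measurable_integrable)
  show ?thesis
  proof (rule integral_dominated_convergence)
    show "kdet airy_kernel n \<in> borel_measurable (half_space n)"
      by (rule borel_measurable_LIMSEQ_real[OF lim meas])
    show "kdet (step_kernel (M k) k) n \<in> borel_measurable (half_space n)" for k by (rule meas)
    show "integrable (half_space n) (\<lambda>x. \<Prod>i<n. (bound_const * exp_mass * exp (- s) * sqrt (real n)) * exp (- x i))"
      by (rule kdet_dominator)
    show "AE x in half_space n. (\<lambda>k. kdet (step_kernel (M k) k) n x) \<longlonglongrightarrow> kdet airy_kernel n x"
      by (intro AE_I2 lim)
    show "AE x in half_space n. norm (kdet (step_kernel (M k) k) n x) \<le>
        (\<Prod>i<n. (bound_const * exp_mass * exp (- s) * sqrt (real n)) * exp (- x i))" for k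
      unfolding real_norm_def by (intro AE_I2 abs_kdet_step_kernel_le space_half_space)
  qed
qed

end

text \<open>n^n <= e^n n!, as n^n / n! is one term of exp n. Hence the terms are at most (c sqrt
  e)^n / sqrt (n!), and the ratio test applies.\<close>

lemma summable_hadamard_series:
  fixes c :: real
  assumes c: "0 \<le> c"
  shows "summable (\<lambda>n. (c * sqrt (real n)) ^ n / fact n)"
proof -
  let ?d = "c * sqrt (exp 1)"
  have 1: "summable (\<lambda>n. ?d ^ n / sqrt (fact n))"
  proof -
    obtain N :: nat where N: "(2 * ?d)\<^sup>2 \<le> real N" using real_arch_simple by blast
    show ?thesis
    proof (rule summable_ratio_test[where c = "1 / 2" and N = N])
      fix n assume n: "N \<le> n"
      have "2 * ?d \<le> sqrt (real (Suc n))"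
      proof (rule real_le_rsqrt)
        show "(2 * ?d)\<^sup>2 \<le> real (Suc n)" using N n by linarith
      qed
      then have "?d / sqrt (real (Suc n)) \<le> 1 / 2"
        by (subst pos_divide_le_eq) auto
      then have "?d / sqrt (real (Suc n)) * (?d ^ n / sqrt (fact n)) \<le> 1 / 2 * (?d ^ n / sqrt (fact n))"
        using c by (intro mult_right_mono) auto
      moreover have "?d ^ Suc n / sqrt (fact (Suc n)) = ?d / sqrt (real (Suc n)) * (?d ^ n / sqrt (fact n))"
        by (simp add: real_sqrt_mult)
      ultimately show "norm (?d ^ Suc n / sqrt (fact (Suc n))) \<le> 1 / 2 * norm (?d ^ n / sqrt (fact n))"
        using c by (simp del: fact_Suc power_Suc)
    qed simp
  qed
  show ?thesis
  proof (rule summable_comparison_test'[OF 1])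
    fix n :: nat
    have "real n ^ n / fact n \<le> exp (real n)"
      using Ez_le_exp[of "real n" "int n"] by simp
    then have "real n ^ n \<le> exp (real n) * fact n" by (simp add: pos_divide_le_eq)
    then have "sqrt (real n ^ n) \<le> sqrt (exp (real n) * fact n)" by (rule real_sqrt_le_mono)
    then have "sqrt (real n) ^ n \<le> sqrt (exp 1) ^ n * sqrt (fact n)"
      by (simp add: real_sqrt_power real_sqrt_mult exp_of_nat_mult[of n 1, simplified])
    then have "c ^ n * sqrt (real n) ^ n \<le> c ^ n * (sqrt (exp 1) ^ n * sqrt (fact n))"
      using c by (intro mult_left_mono) auto
    then have "(c * sqrt (real n)) ^ n / fact n \<le> (?d ^ n * sqrt (fact n)) / fact n"
      by (intro divide_right_mono) (simp_all add: power_mult_distrib mult_ac)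
    also have "\<dots> = ?d ^ n / sqrt (fact n)"
    proof -
      have w: "a * w / (w * w) = a / w" for a w :: real by simp
      show ?thesis
        using w[of "?d ^ n" "sqrt (fact n)"]
        by (simp only: real_sqrt_mult_self abs_of_nonneg[OF fact_ge_zero])
    qed
    finally show "norm ((c * sqrt (real n)) ^ n / fact n) \<le> ?d ^ n / sqrt (fact n)"
      using c by simp
  qed
qed

section \<open>Passage to the limit in the Fredholm series\<close>

context airy_scaling
begin

text \<open>For each k the size M k is taken so large that the truncated determinant is within
  1/(k+1) of its limit and M k >= k q k. One limit in k then replaces the double limit, and
  Tannery's theorem handles the series.\<close>

lemma ldet_one_L_scaling:
  "(\<lambda>k. exp (- (q k ^ 3)\<^sup>2 / 2) * ldet (m k) (one_L (q k ^ 3))) \<longlonglongrightarrow> F2 s"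
proof -
  let ?P = "\<lambda>k. exp (- (q k ^ 3)\<^sup>2 / 2) * ldet (m k) (one_L (q k ^ 3))"
  let ?D = "\<lambda>M k. ldet M (\<lambda>i j. Rn (q k ^ 3) (m k + i) (m k + j))"
  have "\<exists>M. real k * q k \<le> real M \<and> \<bar>?D M k - ?P k\<bar> < 1 / real (Suc k)" for k
  proof -
    have "(\<lambda>N. ?D (N - m k) k) \<longlonglongrightarrow> ?P k"
      by (rule ldet_Rn_tendsto) (use q_pos[of k] in simp)
    then have "\<forall>\<^sub>F N in sequentially. \<bar>?D (N - m k) k - ?P k\<bar> < 1 / real (Suc k)"
      by (auto simp: tendsto_iff dist_real_def)
    then obtain N0 where N0: "\<And>N. N0 \<le> N \<Longrightarrow> \<bar>?D (N - m k) k - ?P k\<bar> < 1 / real (Suc k)"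
      by (auto simp: eventually_sequentially)
    obtain M0 :: nat where M0: "real k * q k \<le> real M0" using real_arch_simple by blast
    have "\<bar>?D (m k + (M0 + N0) - m k) k - ?P k\<bar> < 1 / real (Suc k)" by (rule N0) simp
    then show ?thesis using M0 by (intro exI[of _ "M0 + N0"]) auto
  qed
  then obtain M where M: "\<And>k. real k * q k \<le> real (M k)" "\<And>k. \<bar>?D (M k) k - ?P k\<bar> < 1 / real (Suc k)"
    by metis
  have Mtop: "filterlim (\<lambda>k. real (M k) / q k) at_top sequentially"
  proof (rule filterlim_at_top_mono[OF filterlim_real_sequentially])
    show "\<forall>\<^sub>F k in sequentially. real k \<le> real (M k) / q k"
      using M(1) q_pos by (intro always_eventually allI) (simp add: pos_le_divide_eq)
  qed
  let ?a = "\<lambda>n k. (-1) ^ n / fact n * (LINT x|half_space n. kdet (step_kernel (M k) k) n x)"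
  let ?b = "\<lambda>n. (-1) ^ n / fact n * (LINT x|half_space n. kdet airy_kernel n x)"
  have "(\<lambda>k. suminf (\<lambda>n. ?a n k)) \<longlonglongrightarrow> suminf ?b"
  proof (rule tannerys_theorem[THEN conjunct2, THEN conjunct2])
    show "(\<lambda>k. ?a n k) \<longlonglongrightarrow> ?b n" for n
      by (intro tendsto_mult tendsto_const kdet_integral_tendsto Mtop)
    show "\<forall>\<^sub>F (n, k) in sequentially \<times>\<^sub>F sequentially. norm (?a n k) \<le> (series_const * sqrt (real n)) ^ n / fact n"
    proof (rule always_eventually, clarify)
      fix n k
      show "norm (?a n k) \<le> (series_const * sqrt (real n)) ^ n / fact n"
        using abs_kdet_integral_le[of n "M k" k]
        by (simp add: abs_mult divide_right_mono)
    qed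
    show "summable (\<lambda>n. (series_const * sqrt (real n)) ^ n / fact n)"
      by (rule summable_hadamard_series[OF series_const_nonneg])
  qed simp
  moreover have "suminf (\<lambda>n. ?a n k) = ?D (M k) k" for k
    using ldet_Rn_eq_series[of "M k" k] by (rule sums_unique[symmetric])
  moreover have "suminf ?b = F2 s"
    by (simp add: F2_def fredholm_det_def)
  ultimately have D: "(\<lambda>k. ?D (M k) k) \<longlonglongrightarrow> F2 s" by simp
  have "(\<lambda>k. ?D (M k) k - ?P k) \<longlonglongrightarrow> 0"
  proof (rule Lim_null_comparison)
    show "\<forall>\<^sub>F k in sequentially. norm (?D (M k) k - ?P k) \<le> 1 / real (Suc k)"
      unfolding real_norm_def by (intro always_eventually allI less_imp_le M(2))
    show "(\<lambda>k. 1 / real (Suc k)) \<longlonglongrightarrow> 0" by (rule LIMSEQ_Suc[OF lim_1_over_n])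
  qed
  from tendsto_diff[OF D this] show ?thesis by simp
qed

end

lemma ldet_one_L_tendsto_F2:
  assumes q: "\<And>k. 1 \<le> q k" "filterlim q at_top sequentially"
    and m: "(\<lambda>k. (real (m k) - 2 * q k ^ 3) / q k) \<longlonglongrightarrow> s"
  shows "(\<lambda>k. exp (- (q k ^ 3)\<^sup>2 / 2) * ldet (m k) (one_L (q k ^ 3))) \<longlonglongrightarrow> F2 s"
proof -
  have "Bseq (\<lambda>k. (real (m k) - 2 * q k ^ 3) / q k)"
    using m by (intro convergent_imp_Bseq) (auto simp: convergent_def)
  then obtain K where K: "\<And>k. \<bar>(real (m k) - 2 * q k ^ 3) / q k\<bar> \<le> K"
    by (auto simp: Bseq_def)
  \<comment> \<open>B = s + K turns the lower bound -K of the convergent sequence into the form of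
    the locale assumption.\<close>
  have K': "s - (s + K) \<le> (real (m k) - 2 * q k ^ 3) / q k" for k
    using K[of k] by linarith
  interpret airy_scaling q m s "s + K"
    by (rule airy_scaling.intro[OF q m K'])
  show ?thesis by (rule ldet_one_L_scaling)
qed

text \<open>The event bounds the first part by an integer, so it selects the finite set
  \<open>frob_upto\<close>. Nonnegativity of the bound keeps \<open>nat\<close> from raising it to
  0.\<close>

lemma infsum_frob_event:
  assumes t: "0 < t" and c: "0 \<le> 2 * t + s * t powr (1/3)"
  shows "infsum (pweight t) {a \<in> frob_set e. (real (largest_part a) - 2 * t) / t powr (1/3) \<le> s} =
    exp (- t\<^sup>2 / 2) * ldet (nat \<lfloor>2 * t + s * t powr (1/3)\<rfloor>) (Grow e t)"
proof -
  let ?m = "nat \<lfloor>2 * t + s * t powr (1/3)\<rfloor>"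
  have "(real l - 2 * t) / t powr (1/3) \<le> s \<longleftrightarrow> l \<le> ?m" for l :: nat
  proof -
    have "(real l - 2 * t) / t powr (1/3) \<le> s \<longleftrightarrow> real l \<le> 2 * t + s * t powr (1/3)"
      using t by (simp add: pos_divide_le_eq algebra_simps)
    also have "\<dots> \<longleftrightarrow> int l \<le> \<lfloor>2 * t + s * t powr (1/3)\<rfloor>" by (simp add: le_floor_iff)
    also have "\<dots> \<longleftrightarrow> l \<le> ?m" using c by (simp add: nat_le_eq_zle le_nat_iff)
    finally show ?thesis .
  qed
  then have "{a \<in> frob_set e. (real (largest_part a) - 2 * t) / t powr (1/3) \<le> s} = frob_upto e ?m"
    by (auto simp: frob_upto_def)
  then have "infsum (pweight t) {a \<in> frob_set e. (real (largest_part a) - 2 * t) / t powr (1/3) \<le> s} =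
      (\<Sum>a\<in>frob_upto e ?m. pweight t a)"
    using finite_frob_upto by simp
  also have "\<dots> = exp (- t\<^sup>2 / 2) * (\<Sum>lam\<in>frob_upto e ?m. t ^ psize lam * real (dimp lam) / fact (psize lam))"
    by (simp add: pweight_def sum_distrib_left mult.assoc)
  finally show ?thesis by (simp add: sum_frob_upto_weight)
qed

theorem theorem6:
  fixes s :: real
  shows "((\<lambda>\<theta>. PA_event \<theta> s) \<longlongrightarrow> F2 s) at_top \<and> ((\<lambda>\<theta>. PB_event \<theta> s) \<longlongrightarrow> F2 s) at_top"
proof -
  \<comment> \<open>Convergence at infinity is tested along sequences, the form that dominated
    convergence provides.\<close>
  have seq: "(\<lambda>k. PA_event (X k) s) \<longlonglongrightarrow> F2 s \<and> (\<lambda>k. PB_event (X k) s) \<longlonglongrightarrow> F2 s"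
    if X: "filterlim X at_top sequentially" for X :: "nat \<Rightarrow> real"
  proof -
    \<comment> \<open>Eventually this is X k powr (1/3); the maximum secures 1 <= q k for all
      k.\<close>
    define q where "q k = max 1 (X k powr (1/3))" for k
    define m where "m k = nat \<lfloor>2 * q k ^ 3 + s * q k\<rfloor>" for k
    have q1: "1 \<le> q k" for k by (simp add: q_def)
    have "filterlim (\<lambda>x::real. x powr (1/3)) at_top at_top" by real_asymp
    then have Xq: "filterlim (\<lambda>k. X k powr (1/3)) at_top sequentially"
      by (rule filterlim_compose[OF _ X])
    have qt: "filterlim q at_top sequentially"
      by (rule filterlim_at_top_mono[OF Xq]) (simp add: q_def)
    have evX: "\<forall>\<^sub>F k in sequentially. 1 \<le> X k" using X by (simp add: filterlim_at_top)
    have q3: "q k = X k powr (1/3)" "q k ^ 3 = X k" if "1 \<le> X k" for k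
    proof -
      show 1: "q k = X k powr (1/3)" using that ge_one_powr_ge_zero[of "X k" "1/3"] by (simp add: q_def)
      show "q k ^ 3 = X k" unfolding 1 using that by (simp add: powr_power)
    qed
    have "filterlim (\<lambda>x::real. 2 * x ^ 3 + s * x) at_top at_top" by real_asymp
    then have big: "filterlim (\<lambda>k. 2 * q k ^ 3 + s * q k) at_top sequentially"
      by (rule filterlim_compose[OF _ qt])
    \<comment> \<open>The 2 makes m k at least 1, so that m k - 1 is a true predecessor for B, and
      leaves room for rounding.\<close>
    then have ev2: "\<forall>\<^sub>F k in sequentially. 2 \<le> 2 * q k ^ 3 + s * q k" by (simp add: filterlim_at_top)
    have inv: "(\<lambda>k. c / q k) \<longlonglongrightarrow> 0" for c
      by (rule real_tendsto_divide_at_top[OF tendsto_const qt])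
    \<comment> \<open>d = 0 serves A and d = 1 serves B. Rounding down and d each lose at most 1,
      hence the 2 / q k.\<close>
    have m_lim: "(\<lambda>k. (real (m k - d) - 2 * q k ^ 3) / q k) \<longlonglongrightarrow> s" if d: "d \<le> 1" for d
    proof (rule tendsto_sandwich)
      have "(\<lambda>k. s - 2 / q k) \<longlonglongrightarrow> s - 0" by (intro tendsto_diff tendsto_const inv)
      then show "(\<lambda>k. s - 2 / q k) \<longlonglongrightarrow> s" by simp
      show "\<forall>\<^sub>F k in sequentially. s - 2 / q k \<le> (real (m k - d) - 2 * q k ^ 3) / q k"
        using ev2
      proof eventually_elim
        case (elim k)
        have "s - 2 / q k = (2 * q k ^ 3 + s * q k - 2 - 2 * q k ^ 3) / q k"
          using q1[of k] by (simp add: field_simps)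
        also have "\<dots> \<le> (real (m k - d) - 2 * q k ^ 3) / q k"
        proof (intro divide_right_mono diff_right_mono)
          have "2 * q k ^ 3 + s * q k - 1 \<le> real (m k)" using elim unfolding m_def by linarith
          then show "2 * q k ^ 3 + s * q k - 2 \<le> real (m k - d)" using d by linarith
        qed (use q1[of k] in simp)
        finally show ?case .
      qed
      show "\<forall>\<^sub>F k in sequentially. (real (m k - d) - 2 * q k ^ 3) / q k \<le> s"
        using ev2
      proof eventually_elim
        case (elim k)
        have "real (m k - d) \<le> real (m k)" by simp
        also have "real (m k) \<le> 2 * q k ^ 3 + s * q k" using elim unfolding m_def by linarith
        finally show ?case using q1[of k] by (simp add: pos_divide_le_eq)
      qed
    qed simp
    have A: "(\<lambda>k. exp (- (q k ^ 3)\<^sup>2 / 2) * ldet (m k) (one_L (q k ^ 3))) \<longlonglongrightarrow> F2 s"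
      using m_lim[of 0] by (intro ldet_one_L_tendsto_F2 q1 qt) simp
    have B: "(\<lambda>k. exp (- (q k ^ 3)\<^sup>2 / 2) * ldet (m k - 1) (one_L (q k ^ 3))) \<longlonglongrightarrow> F2 s"
      using m_lim[of 1] by (intro ldet_one_L_tendsto_F2 q1 qt) simp
    have ev_eq: "infsum (pweight (X k)) {a \<in> frob_set e. (real (largest_part a) - 2 * X k) / X k powr (1/3) \<le> s} =
        exp (- (X k)\<^sup>2 / 2) * ldet (m k) (Grow e (X k))"
      if "1 \<le> X k" "2 \<le> 2 * q k ^ 3 + s * q k" for k e
    proof -
      have "2 * q k ^ 3 + s * q k = 2 * X k + s * X k powr (1/3)"
        unfolding q3(2)[OF that(1)] unfolding q3(1)[OF that(1)] ..
      then show ?thesis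
        using infsum_frob_event[of "X k" s e] that unfolding m_def by simp
    qed
    have evA: "\<forall>\<^sub>F k in sequentially. exp (- (q k ^ 3)\<^sup>2 / 2) * ldet (m k) (one_L (q k ^ 3)) = PA_event (X k) s"
      using evX ev2
    proof eventually_elim
      case (elim k)
      show ?case
        using ev_eq[OF elim, of 1] by (simp only: PA_event_def setA_eq q3(2)[OF elim(1)] ldet_Grow_A)
    qed
    have evB: "\<forall>\<^sub>F k in sequentially. exp (- (q k ^ 3)\<^sup>2 / 2) * ldet (m k - 1) (one_L (q k ^ 3)) = PB_event (X k) s"
      using evX ev2
    proof eventually_elim
      case (elim k)
      have "1 \<le> m k" using elim unfolding m_def by linarith
      then have "ldet (m k) (Grow (- 1) (X k)) = ldet (m k - 1) (one_L (X k))"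
        using ldet_Grow_B[of "m k - 1" "X k"] by simp
      then show ?case
        using ev_eq[OF elim, of "- 1"] by (simp only: PB_event_def setB_eq q3(2)[OF elim(1)])
    qed
    show ?thesis by (intro conjI Lim_transform_eventually[OF A evA] Lim_transform_eventually[OF B evB])
  qed
  show ?thesis
    by (intro conjI tendsto_at_topI_sequentially seq[THEN conjunct1] seq[THEN conjunct2])
qed

end
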